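(* Let $(M,\omega)$ and $(M_1,\omega_1)$ be symplectic manifolds of dimension $2n$, let $0\le l\le n$, let $\sigma:M\to M_1$ be a symplectomorphism, let $\nabla$ be a symplectic connection on $M$, and let $\nabla^2$ be any symplectic connection on $M_1$. Let $\Sigma:\mathcal Z^l_M\to\mathcal Z^l_{M_1}$ be the map $\Sigma(j)=d\sigma\circ j\circ d\sigma^{-1}$. If $\Sigma:(\mathcal Z^l_M,\mathcal J^{\nabla})\to(\mathcal Z^l_{M_1},\mathcal J^{\nabla^2})$ is (pseudo-)holomorphic, then $\nabla^2=\sigma\cdot\nabla$.
   Context: A symplectic connection on a symplectic manifold $(M,\omega)$ is a torsion-free linear connection $\nabla$ on $TM$ with $\nabla\omega=0$. For a diffeomorphism $\sigma:M\to M_1$ and a linear connection $\nabla$ on $M$, $\sigma\cdot\nabla$ is the linear connection on $M_1$ given by $(\sigma\cdot\nabla)_XY=\sigma\cdot\left(\nabla_{\sigma^{-1}\cdot X}(\sigma^{-1}\cdot Y)\right)$, where $(\sigma\cdot Z)_y=d\sigma(Z_{\sigma^{-1}(y)})$ is the push-forward of vector fields. Twistor space: for $(M,\omega)$ of dimension $2n$ and $0\le l\le n$, $\pi:\mathcal Z^l=\mathcal Z^l_M\to M$ is the bundle whose fibre over $x$ consists of all real endomorphisms $j$ of $T_xM$ with $j^2=-\mathrm{Id}$, $\omega(j\cdot,j\cdot)=\omega$, and such that the symmetric form $\omega(\cdot,j\cdot)$ has signature $(2n-2l,2l)$. Let $E=\pi^*TM$ and let $\Phi$ be the tautological section of $\mathrm{End}\,E$,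 $\Phi_j=j$. A symplectic connection $\nabla$ gives the horizontal distribution $\mathcal H^\nabla=\{X\in T\mathcal Z^l:(\pi^*\nabla)_X\Phi=0\}$, complementary to $\mathcal V=\ker d\pi$. The almost complex structure $\mathcal J^\nabla=(J^h,J^v)$ on $\mathcal Z^l$ preserves $\mathcal H^\nabla\oplus\mathcal V$; at $j$, $J^h=(d\pi)^{-1}\circ j\circ d\pi$ on $\mathcal H^\nabla_j\cong T_{\pi(j)}M$, and on $\mathcal V_j$ (whose elements are regarded as endomorphisms of $T_{\pi(j)}M$ anticommuting with $j$) $J^v$ is left multiplication by $j$. *)

theory Defs
  imports "HOL-Analysis.Analysis" "HOL-Library.Function_Algebras"
begin

(* Tangent vectors and vector fields are modelled as functions; the pointwise operations turn
   these function types into real vector spaces, so that linear, span, independent etc. apply. *)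
instantiation "fun" :: (type, real_vector) real_vector
begin
definition scaleR_fun :: "real \<Rightarrow> ('a \<Rightarrow> 'b) \<Rightarrow> 'a \<Rightarrow> 'b"
  where "scaleR_fun r f = (\<lambda>x. r *\<^sub>R f x)"
instance
  by standard (auto simp: scaleR_fun_def fun_eq_iff scaleR_add_right scaleR_add_left)
end


section \<open>Smooth manifolds\<close>

(* Only used for open S; there C_k_on k S f says that f is k times continuously differentiable. *)
primrec C_k_on :: "nat \<Rightarrow> 'e::euclidean_space set \<Rightarrow> ('e \<Rightarrow> 'f::real_normed_vector) \<Rightarrow> bool" where
  "C_k_on 0 S f \<longleftrightarrow> continuous_on S f"
| "C_k_on (Suc k) S f \<longleftrightarrow>
     (\<forall>x\<in>S. f differentiable (at x)) \<and> (\<forall>v. C_k_on k S (\<lambda>x. frechet_derivative f (at x) v))"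

definition smooth_on :: "'e::euclidean_space set \<Rightarrow> ('e \<Rightarrow> 'f::real_normed_vector) \<Rightarrow> bool"
  where "smooth_on S f \<longleftrightarrow> (\<forall>k. C_k_on k S f)"

(* A chart is a domain together with a coordinate map; the values of the coordinate map outside
   the domain are irrelevant. A manifold is given by an atlas: its points are those covered by
   the charts, and its topology is the one for which all charts are homeomorphisms. *)
type_synonym ('a, 'e) chart = "'a set \<times> ('a \<Rightarrow> 'e)"
type_synonym ('a, 'e) atlas = "('a, 'e) chart set"

definition chart_inv :: "('a, 'e) chart \<Rightarrow> 'e \<Rightarrow> 'a"
  where "chart_inv c = inv_into (fst c) (snd c)"

definition carrier_of :: "('a, 'e) atlas \<Rightarrow> 'a set"
  where "carrier_of M = (\<Union>c\<in>M. fst c)"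

definition charts_at :: "('a, 'e) atlas \<Rightarrow> 'a \<Rightarrow> ('a, 'e) chart set"
  where "charts_at M x = {c\<in>M. x \<in> fst c}"

definition manifold_topology :: "('a, 'e::euclidean_space) atlas \<Rightarrow> 'a topology"
  where "manifold_topology M =
    topology (\<lambda>W. W \<subseteq> carrier_of M \<and> (\<forall>c\<in>M. open (snd c ` (W \<inter> fst c))))"

definition smooth_atlas :: "('a, 'e::euclidean_space) atlas \<Rightarrow> bool"
  where "smooth_atlas M \<longleftrightarrow>
    (\<forall>c\<in>M. inj_on (snd c) (fst c) \<and> open (snd c ` fst c)) \<and>
    (\<forall>c\<in>M. \<forall>c'\<in>M. open (snd c ` (fst c \<inter> fst c')) \<and>
        smooth_on (snd c ` (fst c \<inter> fst c')) (snd c' \<circ> chart_inv c))"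

definition smooth_manifold :: "('a, 'e::euclidean_space) atlas \<Rightarrow> bool"
  where "smooth_manifold M \<longleftrightarrow> smooth_atlas M \<and>
    Hausdorff_space (manifold_topology M) \<and> second_countable (manifold_topology M)"

definition smooth_map ::
  "('a, 'e::euclidean_space) atlas \<Rightarrow> ('b, 'f::euclidean_space) atlas \<Rightarrow> ('a \<Rightarrow> 'b) \<Rightarrow> bool"
  where "smooth_map M N f \<longleftrightarrow> f ` carrier_of M \<subseteq> carrier_of N \<and>
    (\<forall>c\<in>M. \<forall>k\<in>N. open (snd c ` (fst c \<inter> f -` fst k)) \<and>
        smooth_on (snd c ` (fst c \<inter> f -` fst k)) (snd k \<circ> f \<circ> chart_inv c))"

definition diffeomorphism ::
  "('a, 'e::euclidean_space) atlas \<Rightarrow> ('b, 'f::euclidean_space) atlas \<Rightarrow> ('a \<Rightarrow> 'b) \<Rightarrow> bool"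
  where "diffeomorphism M N f \<longleftrightarrow> bij_betw f (carrier_of M) (carrier_of N) \<and>
    smooth_map M N f \<and> smooth_map N M (inv_into (carrier_of M) f)"

definition smooth_fun :: "('a, 'e::euclidean_space) atlas \<Rightarrow> ('a \<Rightarrow> real) \<Rightarrow> bool"
  where "smooth_fun M f \<longleftrightarrow> (\<forall>c\<in>M. smooth_on (snd c ` fst c) (f \<circ> chart_inv c))"


section \<open>Tangent vectors and vector fields\<close>

(* A tangent vector at x is the family of its coordinate vectors in the charts at x, related by
   the derivatives of the coordinate changes; it is 0 at charts whose domain does not contain x.
   In particular the tangent space at a point outside the manifold is {0}. *)
type_synonym ('a, 'e) tvec = "('a, 'e) chart \<Rightarrow> 'e"

definition tangent_space :: "('a, 'e::euclidean_space) atlas \<Rightarrow> 'a \<Rightarrow> ('a, 'e) tvec set"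
  where "tangent_space M x = {v.
    (\<forall>c\<in>charts_at M x. \<forall>c'\<in>charts_at M x.
        v c' = frechet_derivative (snd c' \<circ> chart_inv c) (at (snd c x)) (v c)) \<and>
    (\<forall>c. c \<notin> charts_at M x \<longrightarrow> v c = 0)}"

(* The tangent vector at x with coordinates u in the chart c. *)
definition coord_vec ::
  "('a, 'e::euclidean_space) atlas \<Rightarrow> 'a \<Rightarrow> ('a, 'e) chart \<Rightarrow> 'e \<Rightarrow> ('a, 'e) tvec"
  where "coord_vec M x c u = (\<lambda>c'. if c' \<in> charts_at M x
    then frechet_derivative (snd c' \<circ> chart_inv c) (at (snd c x)) u else 0)"

definition some_chart :: "('a, 'e) atlas \<Rightarrow> 'a \<Rightarrow> ('a, 'e) chart"
  where "some_chart M x = (SOME c. c \<in> charts_at M x)"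

definition tangent_map ::
  "('a, 'e::euclidean_space) atlas \<Rightarrow> ('b, 'f::euclidean_space) atlas \<Rightarrow> ('a \<Rightarrow> 'b) \<Rightarrow>
   'a \<Rightarrow> ('a, 'e) tvec \<Rightarrow> ('b, 'f) tvec"
  where "tangent_map M N f x v = (let c = some_chart M x in
    (\<lambda>k. if k \<in> charts_at N (f x)
      then frechet_derivative (snd k \<circ> f \<circ> chart_inv c) (at (snd c x)) (v c) else 0))"

definition dir_deriv ::
  "('a, 'e::euclidean_space) atlas \<Rightarrow> ('a \<Rightarrow> real) \<Rightarrow> 'a \<Rightarrow> ('a, 'e) tvec \<Rightarrow> real"
  where "dir_deriv M f x v = (let c = some_chart M x in
    frechet_derivative (f \<circ> chart_inv c) (at (snd c x)) (v c))"

definition velocity ::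
  "('a, 'e::euclidean_space) atlas \<Rightarrow> (real \<Rightarrow> 'a) \<Rightarrow> real \<Rightarrow> ('a, 'e) tvec"
  where "velocity M \<gamma> t = (\<lambda>c. if c \<in> charts_at M (\<gamma> t)
    then vector_derivative (snd c \<circ> \<gamma>) (at t) else 0)"

(* The tangent space at z of a submanifold S of M: velocities of smooth curves lying in S. *)
definition submanifold_tangent_space ::
  "('a, 'e::euclidean_space) atlas \<Rightarrow> 'a set \<Rightarrow> 'a \<Rightarrow> ('a, 'e) tvec set"
  where "submanifold_tangent_space M S z = {velocity M \<gamma> 0 | \<gamma> e.
    e > 0 \<and> smooth_map {({-e<..<e}, id)} M \<gamma> \<and> \<gamma> ` {-e<..<e} \<subseteq> S \<and> \<gamma> 0 = z}"

type_synonym ('a, 'e) vfield = "'a \<Rightarrow> ('a, 'e) tvec"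

(* X x is 0 for x outside the manifold, as the tangent space is {0} there. *)
definition vector_fields :: "('a, 'e::euclidean_space) atlas \<Rightarrow> ('a, 'e) vfield set"
  where "vector_fields M = {X. (\<forall>x. X x \<in> tangent_space M x) \<and>
    (\<forall>c\<in>M. smooth_on (snd c ` fst c) (\<lambda>p. X (chart_inv c p) c))}"

definition lie_bracket ::
  "('a, 'e::euclidean_space) atlas \<Rightarrow> ('a, 'e) vfield \<Rightarrow> ('a, 'e) vfield \<Rightarrow> ('a, 'e) vfield"
  where "lie_bracket M X Y x = (\<lambda>c. if c \<in> charts_at M x then
      frechet_derivative (\<lambda>p. Y (chart_inv c p) c) (at (snd c x)) (X x c) -
      frechet_derivative (\<lambda>p. X (chart_inv c p) c) (at (snd c x)) (Y x c) else 0)"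

definition push_forward ::
  "('a, 'e::euclidean_space) atlas \<Rightarrow> ('b, 'f::euclidean_space) atlas \<Rightarrow> ('a \<Rightarrow> 'b) \<Rightarrow>
   ('a, 'e) vfield \<Rightarrow> ('b, 'f) vfield"
  where "push_forward M N f X y = (if y \<in> carrier_of N
    then let x = inv_into (carrier_of M) f y in tangent_map M N f x (X x) else 0)"


section \<open>Linear and symplectic connections\<close>

type_synonym ('a, 'e) connection = "('a, 'e) vfield \<Rightarrow> ('a, 'e) vfield \<Rightarrow> ('a, 'e) vfield"

definition linear_connection :: "('a, 'e::euclidean_space) atlas \<Rightarrow> ('a, 'e) connection \<Rightarrow> bool"
  where "linear_connection M D \<longleftrightarrow>
    (\<forall>X\<in>vector_fields M. \<forall>Y\<in>vector_fields M. D X Y \<in> vector_fields M) \<and>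
    (\<forall>X\<in>vector_fields M. \<forall>X'\<in>vector_fields M. \<forall>Y\<in>vector_fields M.
        D (X + X') Y = D X Y + D X' Y) \<and>
    (\<forall>f. smooth_fun M f \<longrightarrow> (\<forall>X\<in>vector_fields M. \<forall>Y\<in>vector_fields M.
        D (\<lambda>x. f x *\<^sub>R X x) Y = (\<lambda>x. f x *\<^sub>R D X Y x))) \<and>
    (\<forall>X\<in>vector_fields M. \<forall>Y\<in>vector_fields M. \<forall>Y'\<in>vector_fields M.
        D X (Y + Y') = D X Y + D X Y') \<and>
    (\<forall>f. smooth_fun M f \<longrightarrow> (\<forall>X\<in>vector_fields M. \<forall>Y\<in>vector_fields M.
        D X (\<lambda>x. f x *\<^sub>R Y x) =
          (\<lambda>x. dir_deriv M f x (X x) *\<^sub>R Y x + f x *\<^sub>R D X Y x)))"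

definition torsion_free :: "('a, 'e::euclidean_space) atlas \<Rightarrow> ('a, 'e) connection \<Rightarrow> bool"
  where "torsion_free M D \<longleftrightarrow> (\<forall>X\<in>vector_fields M. \<forall>Y\<in>vector_fields M.
    D X Y - D Y X = lie_bracket M X Y)"

definition push_connection ::
  "('a, 'e::euclidean_space) atlas \<Rightarrow> ('b, 'f::euclidean_space) atlas \<Rightarrow> ('a \<Rightarrow> 'b) \<Rightarrow>
   ('a, 'e) connection \<Rightarrow> ('b, 'f) connection"
  where "push_connection M N f D X Y = (let g = inv_into (carrier_of M) f in
    push_forward M N f (D (push_forward N M g X) (push_forward N M g Y)))"

type_synonym ('a, 'e) two_form = "'a \<Rightarrow> ('a, 'e) tvec \<Rightarrow> ('a, 'e) tvec \<Rightarrow> real"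

definition smooth_two_form :: "('a, 'e::euclidean_space) atlas \<Rightarrow> ('a, 'e) two_form \<Rightarrow> bool"
  where "smooth_two_form M \<omega> \<longleftrightarrow>
    (\<forall>x\<in>carrier_of M. \<forall>u\<in>tangent_space M x. \<forall>v\<in>tangent_space M x. \<forall>w\<in>tangent_space M x. \<forall>a.
        \<omega> x (u + v) w = \<omega> x u w + \<omega> x v w \<and> \<omega> x (a *\<^sub>R v) w = a * \<omega> x v w \<and>
        \<omega> x v w = - \<omega> x w v) \<and>
    (\<forall>c\<in>M. \<forall>u v. smooth_on (snd c ` fst c) (\<lambda>p.
        \<omega> (chart_inv c p) (coord_vec M (chart_inv c p) c u) (coord_vec M (chart_inv c p) c v)))"

definition ext_deriv ::
  "('a, 'e::euclidean_space) atlas \<Rightarrow> ('a, 'e) two_form \<Rightarrow>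
   ('a, 'e) vfield \<Rightarrow> ('a, 'e) vfield \<Rightarrow> ('a, 'e) vfield \<Rightarrow> 'a \<Rightarrow> real"
  where "ext_deriv M \<omega> X Y Z x =
      dir_deriv M (\<lambda>y. \<omega> y (Y y) (Z y)) x (X x)
    + dir_deriv M (\<lambda>y. \<omega> y (Z y) (X y)) x (Y x)
    + dir_deriv M (\<lambda>y. \<omega> y (X y) (Y y)) x (Z x)
    - \<omega> x (lie_bracket M X Y x) (Z x)
    - \<omega> x (lie_bracket M Y Z x) (X x)
    - \<omega> x (lie_bracket M Z X x) (Y x)"

definition symplectic_manifold :: "('a, 'e::euclidean_space) atlas \<Rightarrow> ('a, 'e) two_form \<Rightarrow> bool"
  where "symplectic_manifold M \<omega> \<longleftrightarrow> smooth_manifold M \<and> smooth_two_form M \<omega> \<and>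
    (\<forall>X\<in>vector_fields M. \<forall>Y\<in>vector_fields M. \<forall>Z\<in>vector_fields M. \<forall>x\<in>carrier_of M.
        ext_deriv M \<omega> X Y Z x = 0) \<and>
    (\<forall>x\<in>carrier_of M. \<forall>v\<in>tangent_space M x.
        (\<forall>w\<in>tangent_space M x. \<omega> x v w = 0) \<longrightarrow> v = 0)"

definition symplectomorphism ::
  "('a, 'e::euclidean_space) atlas \<Rightarrow> ('a, 'e) two_form \<Rightarrow>
   ('b, 'f::euclidean_space) atlas \<Rightarrow> ('b, 'f) two_form \<Rightarrow> ('a \<Rightarrow> 'b) \<Rightarrow> bool"
  where "symplectomorphism M \<omega> N \<omega>' f \<longleftrightarrow> diffeomorphism M N f \<and>
    (\<forall>x\<in>carrier_of M. \<forall>v\<in>tangent_space M x. \<forall>w\<in>tangent_space M x.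
        \<omega>' (f x) (tangent_map M N f x v) (tangent_map M N f x w) = \<omega> x v w)"

definition symplectic_connection ::
  "('a, 'e::euclidean_space) atlas \<Rightarrow> ('a, 'e) two_form \<Rightarrow> ('a, 'e) connection \<Rightarrow> bool"
  where "symplectic_connection M \<omega> D \<longleftrightarrow> linear_connection M D \<and> torsion_free M D \<and>
    (\<forall>X\<in>vector_fields M. \<forall>Y\<in>vector_fields M. \<forall>Z\<in>vector_fields M. \<forall>x\<in>carrier_of M.
        dir_deriv M (\<lambda>y. \<omega> y (Y y) (Z y)) x (X x) =
          \<omega> x (D X Y x) (Z x) + \<omega> x (Y x) (D X Z x))"

(* The derivative at x of the vector field Y in the direction of a single tangent vector v. *)
definition cov_deriv ::
  "('a, 'e::euclidean_space) atlas \<Rightarrow> ('a, 'e) connection \<Rightarrow>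
   'a \<Rightarrow> ('a, 'e) tvec \<Rightarrow> ('a, 'e) vfield \<Rightarrow> ('a, 'e) tvec"
  where "cov_deriv M D x v Y = D (SOME X. X \<in> vector_fields M \<and> X x = v) Y x"

(* A globally defined vector field which near x is the coordinate field of the chart c in the
   direction b. *)
definition coord_field ::
  "('a, 'e::euclidean_space) atlas \<Rightarrow> 'a \<Rightarrow> ('a, 'e) chart \<Rightarrow> 'e \<Rightarrow> ('a, 'e) vfield"
  where "coord_field M x c b = (SOME Y. Y \<in> vector_fields M \<and>
    (\<exists>W. openin (manifold_topology M) W \<and> x \<in> W \<and> W \<subseteq> fst c \<and>
      (\<forall>y\<in>W. Y y = coord_vec M y c b)))"

(* The pull-back connection on f^*TM, for f : N \<rightarrow> M: derivative at z in direction X of a section S,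
   a map with S w in the tangent space of M at f w. With E_b the coordinate fields of a chart
   around f z and S = \<Sum>b. s_b (E_b \<circ> f), it is the \<Sum>b. X(s_b) E_b(f z) + s_b(z) D_{df X} E_b
   required by the Leibniz rule and by (f^*D)_X (Y \<circ> f) = D_{df X} Y. *)
definition pullback_connection ::
  "('b, 'f::euclidean_space) atlas \<Rightarrow> ('a, 'e::euclidean_space) atlas \<Rightarrow> ('b \<Rightarrow> 'a) \<Rightarrow>
   ('a, 'e) connection \<Rightarrow> 'b \<Rightarrow> ('b, 'f) tvec \<Rightarrow> ('b \<Rightarrow> ('a, 'e) tvec) \<Rightarrow> ('a, 'e) tvec"
  where "pullback_connection N M f D z X S = (let c = some_chart M (f z) in
    \<Sum>b\<in>Basis. dir_deriv N (\<lambda>w. S w c \<bullet> b) z X *\<^sub>R coord_vec M (f z) c b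
      + (S z c \<bullet> b) *\<^sub>R cov_deriv M D (f z) (tangent_map N M f z X) (coord_field M (f z) c b))"

(* The induced connection on End(f^*TM), from (D_X \<Psi>) s = D_X (\<Psi> s) - \<Psi> (D_X s), where s is a
   local section with s(z) = v, here the one with constant coordinates in a chart around f z. *)
definition pullback_connection_End ::
  "('b, 'f::euclidean_space) atlas \<Rightarrow> ('a, 'e::euclidean_space) atlas \<Rightarrow> ('b \<Rightarrow> 'a) \<Rightarrow>
   ('a, 'e) connection \<Rightarrow> 'b \<Rightarrow> ('b, 'f) tvec \<Rightarrow>
   ('b \<Rightarrow> ('a, 'e) tvec \<Rightarrow> ('a, 'e) tvec) \<Rightarrow> ('a, 'e) tvec \<Rightarrow> ('a, 'e) tvec"
  where "pullback_connection_End N M f D z X \<Psi> v = (if v \<in> tangent_space M (f z) then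
    let c = some_chart M (f z); s = (\<lambda>w. coord_vec M (f w) c (v c)) in
      pullback_connection N M f D z X (\<lambda>w. \<Psi> w (s w)) - \<Psi> z (pullback_connection N M f D z X s)
    else 0)"


section \<open>The twistor space\<close>

(* Endomorphisms of a tangent space are extended by 0 outside of it. *)
definition End_at ::
  "('a, 'e::euclidean_space) atlas \<Rightarrow> 'a \<Rightarrow> (('a, 'e) tvec \<Rightarrow> ('a, 'e) tvec) set"
  where "End_at M x = {A. (\<forall>v\<in>tangent_space M x. A v \<in> tangent_space M x) \<and>
    (\<forall>v\<in>tangent_space M x. \<forall>w\<in>tangent_space M x. A (v + w) = A v + A w) \<and>
    (\<forall>a. \<forall>v\<in>tangent_space M x. A (a *\<^sub>R v) = a *\<^sub>R A v) \<and>
    (\<forall>v. v \<notin> tangent_space M x \<longrightarrow> A v = 0)}"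

type_synonym ('a, 'e) tendo = "'a \<times> (('a, 'e) tvec \<Rightarrow> ('a, 'e) tvec)"

(* The total space of the vector bundle End(TM), with bundle projection fst; the coordinates of
   (x, A) are those of x and the matrix of A. *)
definition End_chart ::
  "('a, real^'m) atlas \<Rightarrow> ('a, real^'m) chart \<Rightarrow>
   (('a, real^'m) tendo, (real^'m) \<times> (real^'m^'m)) chart"
  where "End_chart M c = (Sigma (fst c) (End_at M),
    \<lambda>(x, A). (snd c x, matrix (\<lambda>u. A (coord_vec M x c u) c)))"

definition End_bundle ::
  "('a, real^'m) atlas \<Rightarrow> (('a, real^'m) tendo, (real^'m) \<times> (real^'m^'m)) atlas"
  where "End_bundle M = End_chart M ` M"

(* Sylvester signature (p, q), without null part, of the symmetric form B on the space V. *)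
definition has_signature :: "'v::real_vector set \<Rightarrow> ('v \<Rightarrow> 'v \<Rightarrow> real) \<Rightarrow> nat \<Rightarrow> nat \<Rightarrow> bool"
  where "has_signature V B p q \<longleftrightarrow> (\<exists>P Q. finite P \<and> finite Q \<and> card P = p \<and> card Q = q \<and>
    P \<inter> Q = {} \<and> independent (P \<union> Q) \<and> span (P \<union> Q) = V \<and>
    (\<forall>v\<in>P \<union> Q. \<forall>w\<in>P \<union> Q. v \<noteq> w \<longrightarrow> B v w = 0) \<and>
    (\<forall>v\<in>P. B v v > 0) \<and> (\<forall>v\<in>Q. B v v < 0))"

definition twistor_space ::
  "('a, 'e::euclidean_space) atlas \<Rightarrow> ('a, 'e) two_form \<Rightarrow> nat \<Rightarrow> nat \<Rightarrow> ('a, 'e) tendo set"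
  where "twistor_space M \<omega> n l = {(x, j). x \<in> carrier_of M \<and> j \<in> End_at M x \<and>
    (\<forall>v\<in>tangent_space M x. j (j v) = - v) \<and>
    (\<forall>v\<in>tangent_space M x. \<forall>w\<in>tangent_space M x. \<omega> x (j v) (j w) = \<omega> x v w) \<and>
    has_signature (tangent_space M x) (\<lambda>v w. \<omega> x v (j w)) (2 * n - 2 * l) (2 * l)}"

(* Below, Z is a twistor space over M, regarded as a submanifold of End(TM). The tautological
   section is snd, and End(pi^*TM) and pi^*D live over all of End(TM). *)

abbreviation d_pi ::
  "('a, real^'m) atlas \<Rightarrow> ('a, real^'m) tendo \<Rightarrow>
   (('a, real^'m) tendo, (real^'m) \<times> (real^'m^'m)) tvec \<Rightarrow> ('a, real^'m) tvec"
  where "d_pi M z \<equiv> tangent_map (End_bundle M) M fst z"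

definition horizontal ::
  "('a, real^'m) atlas \<Rightarrow> ('a, real^'m) tendo set \<Rightarrow> ('a, real^'m) connection \<Rightarrow>
   ('a, real^'m) tendo \<Rightarrow> (('a, real^'m) tendo, (real^'m) \<times> (real^'m^'m)) tvec set"
  where "horizontal M Z D z = {X \<in> submanifold_tangent_space (End_bundle M) Z z.
    pullback_connection_End (End_bundle M) M fst D z X snd = 0}"

definition vertical ::
  "('a, real^'m) atlas \<Rightarrow> ('a, real^'m) tendo set \<Rightarrow> ('a, real^'m) tendo \<Rightarrow>
   (('a, real^'m) tendo, (real^'m) \<times> (real^'m^'m)) tvec set"
  where "vertical M Z z = {X \<in> submanifold_tangent_space (End_bundle M) Z z. d_pi M z X = 0}"

(* The identification of endomorphisms B with vertical vectors. *)
definition vertical_lift ::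
  "('a, real^'m) atlas \<Rightarrow> ('a, real^'m) tendo \<Rightarrow> (('a, real^'m) tvec \<Rightarrow> ('a, real^'m) tvec) \<Rightarrow>
   (('a, real^'m) tendo, (real^'m) \<times> (real^'m^'m)) tvec"
  where "vertical_lift M z B = velocity (End_bundle M) (\<lambda>t. (fst z, snd z + t *\<^sub>R B)) 0"

definition J_horizontal ::
  "('a, real^'m) atlas \<Rightarrow> ('a, real^'m) tendo set \<Rightarrow> ('a, real^'m) connection \<Rightarrow>
   ('a, real^'m) tendo \<Rightarrow> (('a, real^'m) tendo, (real^'m) \<times> (real^'m^'m)) tvec \<Rightarrow>
   (('a, real^'m) tendo, (real^'m) \<times> (real^'m^'m)) tvec"
  where "J_horizontal M Z D z X =
    (THE W. W \<in> horizontal M Z D z \<and> d_pi M z W = snd z (d_pi M z X))"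

definition J_vertical ::
  "('a, real^'m) atlas \<Rightarrow> ('a, real^'m) tendo \<Rightarrow>
   (('a, real^'m) tendo, (real^'m) \<times> (real^'m^'m)) tvec \<Rightarrow>
   (('a, real^'m) tendo, (real^'m) \<times> (real^'m^'m)) tvec"
  where "J_vertical M z X =
    vertical_lift M z (snd z \<circ> (THE B. B \<in> End_at M (fst z) \<and> vertical_lift M z B = X))"

definition twistor_J ::
  "('a, real^'m) atlas \<Rightarrow> ('a, real^'m) tendo set \<Rightarrow> ('a, real^'m) connection \<Rightarrow>
   ('a, real^'m) tendo \<Rightarrow> (('a, real^'m) tendo, (real^'m) \<times> (real^'m^'m)) tvec \<Rightarrow>
   (('a, real^'m) tendo, (real^'m) \<times> (real^'m^'m)) tvec"
  where "twistor_J M Z D z X =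
    (let H = (THE H. H \<in> horizontal M Z D z \<and> X - H \<in> vertical M Z z)
     in J_horizontal M Z D z H + J_vertical M z (X - H))"

(* dsigma o j o dsigma^-1, on all of End(TM). *)
definition twistor_lift ::
  "('a, real^'m) atlas \<Rightarrow> ('b, real^'m) atlas \<Rightarrow> ('a \<Rightarrow> 'b) \<Rightarrow>
   ('a, real^'m) tendo \<Rightarrow> ('b, real^'m) tendo"
  where "twistor_lift M N f z = (f (fst z), \<lambda>v. if v \<in> tangent_space N (f (fst z))
    then tangent_map M N f (fst z)
           (snd z (tangent_map N M (inv_into (carrier_of M) f) (f (fst z)) v))
    else 0)"

(* f is a smooth map of the ambient manifolds which maps the submanifold S to S'; the differential
   of its restriction S \<rightarrow> S' is the restriction of the differential of f. J and J' are almost complex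
   structures on S and S'. *)
definition pseudo_holomorphic ::
  "('a, 'e::euclidean_space) atlas \<Rightarrow> 'a set \<Rightarrow> ('a \<Rightarrow> ('a, 'e) tvec \<Rightarrow> ('a, 'e) tvec) \<Rightarrow>
   ('b, 'f::euclidean_space) atlas \<Rightarrow> 'b set \<Rightarrow> ('b \<Rightarrow> ('b, 'f) tvec \<Rightarrow> ('b, 'f) tvec) \<Rightarrow>
   ('a \<Rightarrow> 'b) \<Rightarrow> bool"
  where "pseudo_holomorphic N S J N' S' J' f \<longleftrightarrow> smooth_map N N' f \<and> f ` S \<subseteq> S' \<and>
    (\<forall>z\<in>S. \<forall>X\<in>submanifold_tangent_space N S z.
        tangent_map N N' f z (J z X) = J' (f z) (tangent_map N N' f z X))"

end

theory Submission
  imports Defs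
begin

text \<open>
  Fix \<open>x\<close> in \<open>M\<close> and transport \<open>\<nabla>\<^sup>2\<close> to \<open>M\<close> with \<open>\<sigma>\<close>. The difference of the transported connection and
  \<open>\<nabla>\<close> is a bilinear map \<open>S\<close> on the tangent space \<open>V\<close> at \<open>x\<close>. It is symmetric, since both connections
  are torsion-free, and \<open>S(\<xi>)\<close> is skew for \<open>\<omega>\<close>, since both preserve \<open>\<omega>\<close>. So
  \<open>T(u, v, w) = \<omega>(S(u)v, w)\<close> is a symmetric cubic form, and it is enough to show \<open>T = 0\<close>.

  In a chart with Christoffel map \<open>\<Gamma>\<close>, a tangent vector at \<open>(x, j)\<close> is a pair of \<open>\<xi>\<close> and a matrix
  \<open>B\<close>, horizontal iff \<open>B = [j, \<Gamma>(\<xi>)]\<close>. If \<open>X\<close> is horizontal for \<open>\<nabla>\<close>, then its vertical part for the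
  other connection is \<open>[S(\<xi>), j]\<close>. Comparing the two almost complex structures on \<open>X\<close> therefore
  gives the equation \<open>[S(j\<xi>), j] = j [S(\<xi>), j]\<close>, for every \<open>\<xi>\<close> and every \<open>j\<close> of the fibre
  (\<open>difference_tensor_commutator\<close>). In terms of \<open>T\<close> it says in particular that
  \<open>T(\<xi>, \<xi>, \<xi>) = 3 T(j\<xi>, j\<xi>, \<xi>)\<close>: the part of type (3, 0) of \<open>T\<close> vanishes for each \<open>j\<close>.

  Given \<open>v \<noteq> 0\<close>, complete it to a symplectic basis \<open>v = e\<^sub>0, f\<^sub>0, \<dots>\<close>. The fibre contains \<open>j\<close> with
  \<open>jv = \<plusminus> f\<^sub>0\<close>, and another one with \<open>jv = \<plusminus> f\<^sub>0/4\<close>, from the rescaled basis \<open>2v, f\<^sub>0/2, \<dots>\<close>. The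
  equations for these two force \<open>T(v, v, v) = 0\<close>, and then \<open>T = 0\<close> by polarisation
  (\<open>cubic_form_vanishes\<close>).

  Two points need work. The first is that the splitting into horizontal and vertical vectors lives in the
  tangent spaces of the twistor space, which consist of velocities of curves. One has to find
  curves of complex structures \<open>j(t)\<close>, compatible with \<open>\<omega>\<close> at a moving point, whose velocity is
  the given horizontal or vertical vector. They are built from frames: a curve of approximately
  symplectic frames is corrected by a symplectic Gram-Schmidt process, which does not change its
  velocity (\<open>smooth_symplectic_frame\<close>), and \<open>j(t)\<close> is the structure that is standard in the
  corrected frame (\<open>twistor_tangent_vector\<close>). The argument takes place at the points \<open>j\<close> that
  come from a frame in this way.

  The second is that connections act on global vector fields. Their coordinate expression
  (\<open>connection_in_coordinates\<close>) needs locality, hence smooth bump functions and the extension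
  of local fields by zero, where the Hausdorff property is used.
\<close>

section \<open>Calculus of smooth functions\<close>

lemma C_k_on_cong:
  assumes "open S" "\<And>x. x \<in> S \<Longrightarrow> f x = g x"
  shows "C_k_on k S f \<longleftrightarrow> C_k_on k S g"
  using assms(2)
proof (induction k arbitrary: f g)
  case 0
  then show ?case by (auto cong: continuous_on_cong)
next
  case (Suc k)
  have d: "f differentiable (at x) \<longleftrightarrow> g differentiable (at x)" if "x \<in> S" for x
    unfolding differentiable_def
    using that assms(1) Suc.prems by (metis has_derivative_transform_within_open)
  have e: "frechet_derivative f (at x) = frechet_derivative g (at x)"
    if "x \<in> S" "f differentiable (at x)" for x
    using that assms(1) Suc.prems by (intro frechet_derivative_transform_within_open) auto
  have "C_k_on k S (\<lambda>x. frechet_derivative f (at x) v) \<longleftrightarrow>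
        C_k_on k S (\<lambda>x. frechet_derivative g (at x) v)"
    if "\<forall>x\<in>S. f differentiable (at x)" for v
    using that e by (intro Suc.IH) auto
  then show ?case using d by auto
qed

text \<open>
  The derivative may be given by any formula; on an open set it agrees with the chosen one.
\<close>

lemma C_k_on_SucI:
  assumes "open S" "\<And>x. x \<in> S \<Longrightarrow> (f has_derivative f' x) (at x)"
    "\<And>v. C_k_on k S (\<lambda>x. f' x v)"
  shows "C_k_on (Suc k) S f"
proof -
  have "frechet_derivative f (at x) = f' x" if "x \<in> S" for x
    using assms(2)[OF that] frechet_derivative_at by metis
  then have "C_k_on k S (\<lambda>x. frechet_derivative f (at x) v)" for v
    using assms(3)[of v] C_k_on_cong[OF assms(1), of "\<lambda>x. frechet_derivative f (at x) v"] by auto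
  then show ?thesis using assms(2) by (auto simp: differentiable_def)
qed

lemma C_k_on_SucD: "C_k_on (Suc k) S f \<Longrightarrow> C_k_on k S f"
proof (induction k arbitrary: f)
  case 0
  then show ?case
    by (auto intro!: differentiable_imp_continuous_on
        simp: differentiable_on_def differentiable_at_withinI)
next
  case (Suc k)
  have "C_k_on k S (\<lambda>x. frechet_derivative f (at x) v)" for v
    using Suc.prems by (intro Suc.IH) auto
  with Suc.prems show ?case by auto
qed

lemma C_k_on_subset: "C_k_on k S f \<Longrightarrow> T \<subseteq> S \<Longrightarrow> C_k_on k T f"
  by (induction k arbitrary: f) (auto intro: continuous_on_subset)

lemma C_k_on_local:
  assumes "\<And>x. x \<in> S \<Longrightarrow> \<exists>U. open U \<and> x \<in> U \<and> C_k_on k U f"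
  shows "C_k_on k S f"
  using assms
proof (induction k arbitrary: f)
  case 0
  have "isCont f x" if x: "x \<in> S" for x
    using 0[OF x] by (auto simp: continuous_on_eq_continuous_at)
  then show ?case by (auto intro: continuous_at_imp_continuous_on)
next
  case (Suc k)
  show ?case
    using Suc.prems by (fastforce intro!: Suc.IH)
qed

lemma C_k_on_const: "C_k_on k S (\<lambda>x. c)"
  by (induction k arbitrary: c) (auto simp: frechet_derivative_const)

lemma C_k_on_bounded_linear:
  assumes "open S" "bounded_linear L"
  shows "C_k_on k S f \<Longrightarrow> C_k_on k S (\<lambda>x. L (f x))"
proof (induction k arbitrary: f)
  case 0
  then show ?case using assms(2)
    by (auto intro: bounded_linear.continuous_on)
next
  case (Suc k)
  have d: "(f has_derivative frechet_derivative f (at x)) (at x)" if "x \<in> S" for x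
    using Suc.prems that frechet_derivative_works by auto
  show ?case
  proof (rule C_k_on_SucI[OF assms(1)])
    show "((\<lambda>x. L (f x)) has_derivative (\<lambda>v. L (frechet_derivative f (at x) v))) (at x)"
      if "x \<in> S" for x
      using bounded_linear.has_derivative[OF assms(2) d[OF that]] .
    show "C_k_on k S (\<lambda>x. L (frechet_derivative f (at x) v))" for v
      using Suc.prems by (intro Suc.IH) auto
  qed
qed

lemma C_k_on_ident: "open S \<Longrightarrow> C_k_on k S (\<lambda>x. x)"
  by (cases k) (auto intro!: C_k_on_SucI[where f' = "\<lambda>x v. v"] C_k_on_const
      simp del: C_k_on.simps(2))

lemma C_k_on_add:
  assumes "open S" "C_k_on k S f" "C_k_on k S g"
  shows "C_k_on k S (\<lambda>x. f x + g x)"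
  using assms(2,3)
proof (induction k arbitrary: f g)
  case 0
  then show ?case by (auto intro: continuous_on_add)
next
  case (Suc k)
  show ?case
  proof (rule C_k_on_SucI[OF assms(1)])
    show "((\<lambda>x. f x + g x) has_derivative
      (\<lambda>v. frechet_derivative f (at x) v + frechet_derivative g (at x) v)) (at x)" if "x \<in> S" for x
      using Suc.prems that by (intro has_derivative_add) (auto simp: frechet_derivative_works)
    show "C_k_on k S (\<lambda>x. frechet_derivative f (at x) v + frechet_derivative g (at x) v)" for v
      using Suc.prems by (intro Suc.IH) auto
  qed
qed

lemma C_k_on_bilinear:
  assumes "open S" "bounded_bilinear B"
  shows "C_k_on k S f \<Longrightarrow> C_k_on k S g \<Longrightarrow> C_k_on k S (\<lambda>x. B (f x) (g x))"
proof (induction k arbitrary: f g)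
  case 0
  then show ?case using bounded_bilinear.continuous_on[OF assms(2)] by auto
next
  case (Suc k)
  show ?case
  proof (rule C_k_on_SucI[OF assms(1)])
    show "((\<lambda>x. B (f x) (g x)) has_derivative
      (\<lambda>v. B (f x) (frechet_derivative g (at x) v) + B (frechet_derivative f (at x) v) (g x)))
        (at x)" if "x \<in> S" for x
      using Suc.prems that
      by (intro bounded_bilinear.FDERIV[OF assms(2)]) (auto simp: frechet_derivative_works)
    show "C_k_on k S (\<lambda>x. B (f x) (frechet_derivative g (at x) v)
            + B (frechet_derivative f (at x) v) (g x))" for v
      using Suc.prems Suc.prems[THEN C_k_on_SucD]
      by (intro C_k_on_add[OF assms(1)] Suc.IH) auto
  qed
qed

lemma C_k_on_sum:
  assumes "open S" "\<And>i. i \<in> I \<Longrightarrow> C_k_on k S (f i)"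
  shows "C_k_on k S (\<lambda>x. \<Sum>i\<in>I. f i x)"
  using assms(2)
  by (induction I rule: infinite_finite_induct) (auto intro!: C_k_on_const C_k_on_add assms(1))

text \<open>
  By the chain rule the derivative of the composition is that of \<open>g\<close> at \<open>f x\<close>, in a direction that
  depends on \<open>x\<close>. Expanding this direction in a basis leaves sums of products of functions to which
  the induction hypothesis applies.
\<close>

lemma C_k_on_compose:
  fixes f :: "'a::euclidean_space \<Rightarrow> 'b::euclidean_space"
    and g :: "'b \<Rightarrow> 'c::real_normed_vector"
  assumes "open S" "open T" "f ` S \<subseteq> T"
  shows "C_k_on k S f \<Longrightarrow> C_k_on k T g \<Longrightarrow> C_k_on k S (\<lambda>x. g (f x))"
proof (induction k arbitrary: g)
  case 0
  then show ?case using assms(3) by (auto intro: continuous_on_compose2)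
next
  case (Suc k)
  note fk = C_k_on_SucD[OF Suc.prems(1)]
  show ?case
  proof (rule C_k_on_SucI[OF assms(1)])
    fix x assume x: "x \<in> S"
    have f: "(f has_derivative frechet_derivative f (at x)) (at x)"
      using Suc.prems(1) x by (auto simp: frechet_derivative_works)
    have "f x \<in> T" using x assms(3) by auto
    then have g: "(g has_derivative frechet_derivative g (at (f x))) (at (f x))"
      using Suc.prems(2) by (auto simp: frechet_derivative_works)
    have l: "linear (frechet_derivative g (at (f x)))"
      using g by (rule has_derivative_linear)
    have eq: "frechet_derivative g (at (f x)) w =
        (\<Sum>b\<in>Basis. (w \<bullet> b) *\<^sub>R frechet_derivative g (at (f x)) b)" for w
      by (subst euclidean_representation[of w, symmetric])
         (simp only: linear_sum[OF l] linear_cmul[OF l])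
    show "((\<lambda>x. g (f x)) has_derivative (\<lambda>v. \<Sum>b\<in>Basis. (frechet_derivative f (at x) v \<bullet> b) *\<^sub>R
        frechet_derivative g (at (f x)) b)) (at x)"
      using diff_chain_at[OF f g] unfolding o_def eq[of "frechet_derivative f (at x) _"] .
  next
    fix v
    have "C_k_on k S (\<lambda>x. frechet_derivative f (at x) v \<bullet> b)" for b
      using Suc.prems(1) by (intro C_k_on_bounded_linear[OF assms(1) bounded_linear_inner_left]) auto
    moreover have "C_k_on k S (\<lambda>x. frechet_derivative g (at (f x)) b)" for b
      using Suc.prems(2) by (intro Suc.IH fk) auto
    ultimately show "C_k_on k S (\<lambda>x. \<Sum>b\<in>Basis. (frechet_derivative f (at x) v \<bullet> b) *\<^sub>R
        frechet_derivative g (at (f x)) b)"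
      by (intro C_k_on_sum[OF assms(1)] C_k_on_bilinear[OF assms(1) bounded_bilinear_scaleR]) auto
  qed
qed

lemma smooth_on_cong:
  "open S \<Longrightarrow> (\<And>x. x \<in> S \<Longrightarrow> f x = g x) \<Longrightarrow> smooth_on S f \<longleftrightarrow> smooth_on S g"
  unfolding smooth_on_def using C_k_on_cong by metis

lemma smooth_on_subset: "smooth_on S f \<Longrightarrow> T \<subseteq> S \<Longrightarrow> smooth_on T f"
  unfolding smooth_on_def using C_k_on_subset by metis

lemma smooth_on_local:
  "(\<And>x. x \<in> S \<Longrightarrow> \<exists>U. open U \<and> x \<in> U \<and> smooth_on U f) \<Longrightarrow> smooth_on S f"
  unfolding smooth_on_def by (intro allI C_k_on_local) blast

lemma smooth_on_const: "smooth_on S (\<lambda>x. c)"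
  by (simp add: smooth_on_def C_k_on_const)

lemma smooth_on_ident: "open S \<Longrightarrow> smooth_on S (\<lambda>x. x)"
  by (simp add: smooth_on_def C_k_on_ident)

lemma smooth_on_bounded_linear:
  "open S \<Longrightarrow> bounded_linear L \<Longrightarrow> smooth_on S f \<Longrightarrow> smooth_on S (\<lambda>x. L (f x))"
  by (simp add: smooth_on_def C_k_on_bounded_linear)

lemma smooth_on_linear:
  fixes L :: "'b::euclidean_space \<Rightarrow> 'c::real_normed_vector"
  shows "open S \<Longrightarrow> linear L \<Longrightarrow> smooth_on S f \<Longrightarrow> smooth_on S (\<lambda>x. L (f x))"
  by (simp add: smooth_on_bounded_linear linear_conv_bounded_linear)

lemma smooth_on_bilinear:
  "open S \<Longrightarrow> bounded_bilinear B \<Longrightarrow> smooth_on S f \<Longrightarrow> smooth_on S g \<Longrightarrow>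
    smooth_on S (\<lambda>x. B (f x) (g x))"
  by (simp add: smooth_on_def C_k_on_bilinear)

lemmas smooth_on_scaleR = smooth_on_bilinear[OF _ bounded_bilinear_scaleR]
lemmas smooth_on_mult = smooth_on_bilinear[OF _ bounded_bilinear_mult]
lemmas smooth_on_inner_const = smooth_on_bounded_linear[OF _ bounded_linear_inner_left]

lemma smooth_on_add:
  "open S \<Longrightarrow> smooth_on S f \<Longrightarrow> smooth_on S g \<Longrightarrow> smooth_on S (\<lambda>x. f x + g x)"
  by (simp add: smooth_on_def C_k_on_add)

lemma smooth_on_uminus: "open S \<Longrightarrow> smooth_on S f \<Longrightarrow> smooth_on S (\<lambda>x. - f x)"
  by (rule smooth_on_bounded_linear[OF _ bounded_linear_minus[OF bounded_linear_ident]])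

lemma smooth_on_diff:
  "open S \<Longrightarrow> smooth_on S f \<Longrightarrow> smooth_on S g \<Longrightarrow> smooth_on S (\<lambda>x. f x - g x)"
  using smooth_on_add[of S f "\<lambda>x. - g x"] smooth_on_uminus[of S g] by simp

lemma smooth_on_sum:
  "open S \<Longrightarrow> (\<And>i. i \<in> I \<Longrightarrow> smooth_on S (f i)) \<Longrightarrow> smooth_on S (\<lambda>x. \<Sum>i\<in>I. f i x)"
  by (simp add: smooth_on_def C_k_on_sum)

lemma smooth_on_Pair:
  fixes f :: "'a::euclidean_space \<Rightarrow> 'b::euclidean_space" and g :: "'a \<Rightarrow> 'c::euclidean_space"
  assumes "open S" "smooth_on S f" "smooth_on S g"
  shows "smooth_on S (\<lambda>x. (f x, g x))"
proof -
  have l: "linear (\<lambda>x. (x :: 'b, 0 :: 'c))" "linear (\<lambda>x. (0 :: 'b, x :: 'c))"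
    by (auto intro!: linearI)
  have "smooth_on S (\<lambda>x. (f x, 0) + (0, g x))"
    by (intro smooth_on_add assms smooth_on_linear[OF assms(1) l(1)] smooth_on_linear[OF assms(1) l(2)])
  then show ?thesis by simp
qed

lemma smooth_on_compose:
  fixes f :: "'a::euclidean_space \<Rightarrow> 'b::euclidean_space"
    and g :: "'b \<Rightarrow> 'c::real_normed_vector"
  shows "open S \<Longrightarrow> open T \<Longrightarrow> smooth_on T g \<Longrightarrow> smooth_on S f \<Longrightarrow> f ` S \<subseteq> T \<Longrightarrow>
    smooth_on S (\<lambda>x. g (f x))"
  unfolding smooth_on_def using C_k_on_compose by blast

lemma smooth_on_has_derivative:
  assumes "smooth_on S f" "x \<in> S"
  shows "(f has_derivative frechet_derivative f (at x)) (at x)"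
proof -
  have "C_k_on 1 S f" using assms(1) unfolding smooth_on_def by blast
  then show ?thesis using assms(2) by (simp add: frechet_derivative_works)
qed

lemma smooth_on_frechet: "smooth_on S f \<Longrightarrow> smooth_on S (\<lambda>x. frechet_derivative f (at x) v)"
  unfolding smooth_on_def by (metis C_k_on.simps(2))

lemma smooth_on_continuous: "smooth_on S f \<Longrightarrow> continuous_on S f"
  unfolding smooth_on_def by (metis C_k_on.simps(1))

lemma smooth_on_inverse:
  fixes f :: "'a::euclidean_space \<Rightarrow> real"
  assumes "open S" "smooth_on S f" "\<And>x. x \<in> S \<Longrightarrow> f x \<noteq> 0"
  shows "smooth_on S (\<lambda>x. inverse (f x))"
proof -
  have op: "open (- {0::real})" by auto
  have "C_k_on k (- {0}) (inverse :: real \<Rightarrow> real)" for k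
  proof (induction k)
    case 0
    show ?case by (auto intro!: continuous_intros)
  next
    case (Suc k)
    have m: "C_k_on k (- {0}) (\<lambda>x. - v * (inverse x * inverse x))" for v :: real
      using Suc.IH
      by (intro C_k_on_bilinear[OF op bounded_bilinear_mult] C_k_on_const)
    show ?case
    proof (rule C_k_on_SucI[OF op, where f' = "\<lambda>x v. - v * (inverse x * inverse x)"])
      fix x :: real assume "x \<in> - {0}"
      then have "(inverse has_derivative (\<lambda>h. - (inverse x * h * inverse x))) (at x)"
        by (intro has_derivative_inverse') auto
      moreover have "(\<lambda>h. - (inverse x * h * inverse x)) = (\<lambda>v. - v * (inverse x * inverse x))"
        by (auto simp: algebra_simps)
      ultimately show "(inverse has_derivative (\<lambda>v. - v * (inverse x * inverse x))) (at x)" by simp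
    qed (rule m)
  qed
  then have "smooth_on (- {0}) (inverse :: real \<Rightarrow> real)" by (simp add: smooth_on_def)
  from smooth_on_compose[OF assms(1) op this assms(2)] assms(3) show ?thesis by force
qed

lemma has_real_derivative_along_line:
  fixes f :: "'a::euclidean_space \<Rightarrow> real"
  assumes "smooth_on S f" "a + t *\<^sub>R v \<in> S"
  shows "((\<lambda>s. f (a + s *\<^sub>R v)) has_real_derivative frechet_derivative f (at (a + t *\<^sub>R v)) v) (at t)"
proof -
  note d = smooth_on_has_derivative[OF assms]
  have "((\<lambda>s. a + s *\<^sub>R v) has_derivative (\<lambda>s. s *\<^sub>R v)) (at t)"
    by (auto intro!: derivative_eq_intros)
  from diff_chain_at[OF this d]
  have "((\<lambda>s. f (a + s *\<^sub>R v)) has_derivative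
      (\<lambda>s. frechet_derivative f (at (a + t *\<^sub>R v)) (s *\<^sub>R v))) (at t)"
    by (simp add: o_def)
  then show ?thesis
    by (simp add: has_field_derivative_def linear_cmul[OF has_derivative_linear[OF d]] mult_commute_abs)
qed

text \<open>
  Apply the mean value theorem first to the increment of \<open>f\<close> in direction \<open>w\<close>, as a function of the step in
  direction \<open>u\<close>, and then to the derivative along \<open>u\<close>. The second difference is symmetric in \<open>u\<close> and
  \<open>w\<close>, which gives Schwarz's theorem below.
\<close>

lemma second_difference_eq_second_derivative:
  fixes f :: "'a::euclidean_space \<Rightarrow> real"
  assumes f: "smooth_on S f" and "h > 0"
    and S: "\<And>s t. 0 \<le> s \<Longrightarrow> s \<le> h \<Longrightarrow> 0 \<le> t \<Longrightarrow> t \<le> h \<Longrightarrow> x + s *\<^sub>R u + t *\<^sub>R w \<in> S"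
  shows "\<exists>s t. 0 < s \<and> s < h \<and> 0 < t \<and> t < h \<and>
    f (x + h *\<^sub>R u + h *\<^sub>R w) - f (x + h *\<^sub>R u) - f (x + h *\<^sub>R w) + f x =
    h * (h * frechet_derivative (\<lambda>y. frechet_derivative f (at y) u) (at (x + s *\<^sub>R u + t *\<^sub>R w)) w)"
proof -
  let ?d = "\<lambda>y. frechet_derivative f (at y) u"
  have S': "x + h *\<^sub>R w + s *\<^sub>R u \<in> S" "x + s *\<^sub>R u \<in> S" if "0 \<le> s" "s \<le> h" for s
    using S[OF that, of h] S[OF that, of 0] \<open>h > 0\<close> by (auto simp: algebra_simps)
  have "\<exists>s>0. s < h \<and>
      (f ((x + h *\<^sub>R w) + h *\<^sub>R u) - f (x + h *\<^sub>R u)) - (f ((x + h *\<^sub>R w) + 0 *\<^sub>R u) - f (x + 0 *\<^sub>R u))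
      = (h - 0) * (?d ((x + h *\<^sub>R w) + s *\<^sub>R u) - ?d (x + s *\<^sub>R u))"
    using S' \<open>h > 0\<close>
    by (intro MVT2) (auto intro!: DERIV_diff has_real_derivative_along_line[OF f])
  then obtain s where s: "0 < s" "s < h" and
    1: "f (x + h *\<^sub>R u + h *\<^sub>R w) - f (x + h *\<^sub>R u) - f (x + h *\<^sub>R w) + f x =
      h * (?d (x + s *\<^sub>R u + h *\<^sub>R w) - ?d (x + s *\<^sub>R u))"
    by (auto simp: algebra_simps)
  have "\<exists>t>0. t < h \<and> ?d ((x + s *\<^sub>R u) + h *\<^sub>R w) - ?d ((x + s *\<^sub>R u) + 0 *\<^sub>R w) =
      (h - 0) * frechet_derivative ?d (at ((x + s *\<^sub>R u) + t *\<^sub>R w)) w"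
    using S s \<open>h > 0\<close>
    by (intro MVT2) (auto intro!: has_real_derivative_along_line[OF smooth_on_frechet[OF f]])
  then obtain t where "0 < t" "t < h" "?d (x + s *\<^sub>R u + h *\<^sub>R w) - ?d (x + s *\<^sub>R u) =
      h * frechet_derivative ?d (at (x + s *\<^sub>R u + t *\<^sub>R w)) w"
    by auto
  with s 1 show ?thesis by auto
qed

lemma second_derivative_symmetric_real:
  fixes f :: "'a::euclidean_space \<Rightarrow> real"
  assumes f: "smooth_on S f" and S: "open S" and x: "x \<in> S"
  shows "frechet_derivative (\<lambda>y. frechet_derivative f (at y) u) (at x) w =
    frechet_derivative (\<lambda>y. frechet_derivative f (at y) w) (at x) u"
proof (rule ccontr)
  let ?A = "\<lambda>u w y. frechet_derivative (\<lambda>y. frechet_derivative f (at y) u) (at y) w"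
  assume ne: "?A u w x \<noteq> ?A w u x"
  define e where "e = \<bar>?A u w x - ?A w u x\<bar> / 2"
  have e: "e > 0" using ne by (simp add: e_def)
  have "\<exists>r>0. \<forall>y\<in>ball x r. \<bar>?A u w y - ?A u w x\<bar> < e" for u w
  proof -
    have "isCont (?A u w) x"
      using smooth_on_continuous[OF smooth_on_frechet[OF smooth_on_frechet[OF f]]] S x
      by (auto simp: continuous_on_eq_continuous_at)
    then show ?thesis using e by (force simp: continuous_at_eps_delta dist_real_def dist_commute)
  qed
  then obtain r1 r2 where r: "r1 > 0" "\<forall>y\<in>ball x r1. \<bar>?A u w y - ?A u w x\<bar> < e"
    "r2 > 0" "\<forall>y\<in>ball x r2. \<bar>?A w u y - ?A w u x\<bar> < e"
    by blast
  obtain r3 where r3: "r3 > 0" "ball x r3 \<subseteq> S" using S x open_contains_ball by metis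
  define r where "r = min r1 (min r2 r3)"
  have "r > 0" using r r3 by (simp add: r_def)
  define h where "h = r / (norm u + norm w + 1) / 2"
  have pos: "norm u + norm w + 1 > 0" by (simp add: add_nonneg_pos)
  have h: "h > 0" using \<open>r > 0\<close> pos by (simp add: h_def)
  have h2: "h * (norm u + norm w + 1) = r / 2"
    unfolding h_def using pos by (metis nonzero_eq_divide_eq less_irrefl divide_divide_eq_left
        divide_divide_eq_left' mult.commute times_divide_eq_left)
  have hr: "h * (norm u + norm w) < r"
  proof -
    have "h * (norm u + norm w) \<le> h * (norm u + norm w + 1)" using h by simp
    also have "\<dots> = r / 2" by (rule h2)
    finally show ?thesis using \<open>r > 0\<close> by simp
  qed
  have ball: "x + s *\<^sub>R u + t *\<^sub>R w \<in> ball x r" if "0 \<le> s" "s \<le> h" "0 \<le> t" "t \<le> h" for s t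
  proof -
    have "norm (s *\<^sub>R u + t *\<^sub>R w) \<le> norm (s *\<^sub>R u) + norm (t *\<^sub>R w)" by (rule norm_triangle_ineq)
    also have "\<dots> \<le> h * norm u + h * norm w"
      using that by (auto intro!: add_mono mult_right_mono)
    also have "\<dots> < r" using hr by (simp add: algebra_simps)
    finally have "norm (s *\<^sub>R u + t *\<^sub>R w) < r" .
    moreover have "dist x (x + s *\<^sub>R u + t *\<^sub>R w) = norm (s *\<^sub>R u + t *\<^sub>R w)"
      by (metis add.assoc dist_add_cancel dist_0_norm add.right_neutral)
    ultimately show ?thesis by simp
  qed
  have sub: "ball x r \<subseteq> S" "ball x r \<subseteq> ball x r1" "ball x r \<subseteq> ball x r2"
    using r3 by (auto simp: r_def)
  obtain s t where st: "0 < s" "s < h" "0 < t" "t < h"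
    "f (x + h *\<^sub>R u + h *\<^sub>R w) - f (x + h *\<^sub>R u) - f (x + h *\<^sub>R w) + f x =
      h * (h * ?A u w (x + s *\<^sub>R u + t *\<^sub>R w))"
    using second_difference_eq_second_derivative[OF f h, of x u w] ball sub by blast
  have ball': "x + t *\<^sub>R w + s *\<^sub>R u \<in> ball x r" if "0 \<le> s" "s \<le> h" "0 \<le> t" "t \<le> h" for s t
    using ball[OF that] by (simp add: algebra_simps)
  obtain s' t' where st': "0 < s'" "s' < h" "0 < t'" "t' < h"
    "f (x + h *\<^sub>R w + h *\<^sub>R u) - f (x + h *\<^sub>R w) - f (x + h *\<^sub>R u) + f x =
      h * (h * ?A w u (x + t' *\<^sub>R w + s' *\<^sub>R u))"
    using second_difference_eq_second_derivative[OF f h, of x w u] ball' sub by blast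
  have "h * (h * ?A u w (x + s *\<^sub>R u + t *\<^sub>R w)) = h * (h * ?A w u (x + t' *\<^sub>R w + s' *\<^sub>R u))"
    using st(5) st'(5) by (simp add: algebra_simps)
  then have "?A u w (x + s *\<^sub>R u + t *\<^sub>R w) = ?A w u (x + t' *\<^sub>R w + s' *\<^sub>R u)" using h by simp
  moreover have "\<bar>?A u w (x + s *\<^sub>R u + t *\<^sub>R w) - ?A u w x\<bar> < e"
    using ball[of s t] st sub r by auto
  moreover have "\<bar>?A w u (x + t' *\<^sub>R w + s' *\<^sub>R u) - ?A w u x\<bar> < e"
    using ball'[of s' t'] st' sub r by auto
  moreover have "\<And>a b c d::real. a = b \<Longrightarrow> \<bar>a - c\<bar> < \<bar>c - d\<bar> / 2 \<Longrightarrow> \<bar>b - d\<bar> < \<bar>c - d\<bar> / 2 \<Longrightarrow> False"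
  proof -
    fix a b c d :: real
    assume "a = b" "\<bar>a - c\<bar> < \<bar>c - d\<bar> / 2" "\<bar>b - d\<bar> < \<bar>c - d\<bar> / 2"
    moreover have "\<bar>c - d\<bar> \<le> \<bar>a - c\<bar> + \<bar>a - d\<bar>" by linarith
    ultimately show False by simp
  qed
  ultimately show False unfolding e_def by blast
qed

lemma frechet_derivative_inner:
  assumes "f differentiable (at x)"
  shows "frechet_derivative (\<lambda>y. f y \<bullet> b) (at x) v = frechet_derivative f (at x) v \<bullet> b"
  using has_derivative_inner_left[OF assms[unfolded frechet_derivative_works], of b]
  by (metis frechet_derivative_at)

lemma second_derivative_symmetric:
  fixes f :: "'a::euclidean_space \<Rightarrow> 'b::euclidean_space"
  assumes f: "smooth_on S f" and S: "open S" and x: "x \<in> S"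
  shows "frechet_derivative (\<lambda>y. frechet_derivative f (at y) u) (at x) w =
    frechet_derivative (\<lambda>y. frechet_derivative f (at y) w) (at x) u"
proof (rule euclidean_eqI)
  fix b :: 'b assume "b \<in> Basis"
  have df: "f differentiable (at y)" if "y \<in> S" for y
    using smooth_on_has_derivative[OF f that] by (auto simp: differentiable_def)
  have ddf: "(\<lambda>y. frechet_derivative f (at y) u) differentiable (at x)" for u
    using smooth_on_has_derivative[OF smooth_on_frechet[OF f] x] by (auto simp: differentiable_def)
  have "frechet_derivative (\<lambda>y. frechet_derivative f (at y) u) (at x) w \<bullet> b =
      frechet_derivative (\<lambda>y. frechet_derivative (\<lambda>y. f y \<bullet> b) (at y) u) (at x) w" for u w
  proof -
    have "frechet_derivative (\<lambda>y. frechet_derivative f (at y) u \<bullet> b) (at x) =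
        frechet_derivative (\<lambda>y. frechet_derivative (\<lambda>y. f y \<bullet> b) (at y) u) (at x)"
      by (rule frechet_derivative_transform_within_open[OF _ S x])
        (use ddf df in \<open>auto simp: frechet_derivative_inner intro!: differentiable_inner\<close>)
    then show ?thesis using frechet_derivative_inner[OF ddf] by metis
  qed
  then show "frechet_derivative (\<lambda>y. frechet_derivative f (at y) u) (at x) w \<bullet> b =
      frechet_derivative (\<lambda>y. frechet_derivative f (at y) w) (at x) u \<bullet> b"
    using second_derivative_symmetric_real[OF smooth_on_inner_const[OF S f] S x] by metis
qed


section \<open>Bump functions\<close>

text \<open>
  The family is closed under differentiation up to linear combinations, so that smoothness of the
  function with \<open>n = 0\<close> can be proved by induction on the order for all \<open>n\<close> at once.
\<close>

definition exp_inverse :: "nat \<Rightarrow> real \<Rightarrow> real"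
  where "exp_inverse n t = (if t > 0 then inverse t ^ n * exp (- inverse t) else 0)"

lemma exp_inverse_tendsto_0: "(exp_inverse n \<longlongrightarrow> 0) (at 0)"
proof -
  have "((\<lambda>t. inverse t ^ n / exp (inverse t)) \<longlongrightarrow> (0::real)) (at_right 0)"
    by (rule filterlim_compose[OF tendsto_power_div_exp_0 filterlim_inverse_at_top_right])
  then have "((\<lambda>t. exp_inverse n t) \<longlongrightarrow> 0) (at_right 0)"
    by (rule Lim_transform_eventually)
      (auto simp: exp_inverse_def exp_minus divide_inverse eventually_at_right_less
        intro!: eventually_mono[OF eventually_at_right_less])
  moreover have "((\<lambda>t. exp_inverse n t) \<longlongrightarrow> 0) (at_left 0)"
    by (rule Lim_transform_eventually[OF tendsto_const])
      (auto simp: exp_inverse_def eventually_at_filter)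
  ultimately show ?thesis by (simp add: filterlim_split_at)
qed

lemma exp_inverse_has_derivative:
  "(exp_inverse n has_real_derivative exp_inverse (n + 2) t - n * exp_inverse (n + 1) t) (at t)"
proof -
  consider "t > 0" | "t < 0" | "t = 0" by linarith
  then show ?thesis
  proof cases
    case 1
    have i: "(inverse has_real_derivative - (inverse t ^ Suc (Suc 0))) (at t)"
      using 1 by (intro DERIV_inverse) auto
    have p: "((\<lambda>t. inverse t ^ n) has_real_derivative - (real n * inverse t ^ Suc n)) (at t)"
      using DERIV_power[OF i, of n] by (cases n) (auto simp: algebra_simps)
    have "((\<lambda>t. inverse t ^ n * exp (- inverse t)) has_real_derivative
        exp_inverse (n + 2) t - n * exp_inverse (n + 1) t) (at t)"
      by (rule derivative_eq_intros p i refl)+ (use 1 in \<open>simp add: exp_inverse_def algebra_simps\<close>)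
    then show ?thesis
      by (rule has_field_derivative_transform_within_open[where S = "{0<..}"])
        (use 1 in \<open>auto simp: exp_inverse_def\<close>)
  next
    case 2
    have "((\<lambda>t. 0) has_real_derivative exp_inverse (n + 2) t - n * exp_inverse (n + 1) t) (at t)"
      using 2 by (simp add: exp_inverse_def)
    then show ?thesis
      by (rule has_field_derivative_transform_within_open[where S = "{..<0}"])
        (use 2 in \<open>auto simp: exp_inverse_def\<close>)
  next
    case 3
    have "(\<lambda>h. (exp_inverse n (0 + h) - exp_inverse n 0) / h) = exp_inverse (n + 1)"
      by (auto simp: exp_inverse_def fun_eq_iff divide_inverse)
    then show ?thesis
      using exp_inverse_tendsto_0[of "n + 1"] 3 by (simp add: DERIV_def exp_inverse_def)
  qed
qed

lemma smooth_on_exp_inverse: "smooth_on UNIV (exp_inverse n)"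
proof -
  have "C_k_on k UNIV (exp_inverse n)" for k
  proof (induction k arbitrary: n)
    case 0
    show ?case
      by (auto intro!: continuous_at_imp_continuous_on DERIV_isCont[OF exp_inverse_has_derivative])
  next
    case (Suc k)
    have "C_k_on k UNIV (\<lambda>t. v * (exp_inverse (n + 2) t + - real n * exp_inverse (n + 1) t))" for v
      by (intro C_k_on_add C_k_on_bilinear[OF _ bounded_bilinear_mult] C_k_on_const Suc.IH) auto
    then show ?case
      by (intro C_k_on_SucI[where f' = "\<lambda>t v. v * (exp_inverse (n + 2) t + - real n * exp_inverse (n + 1) t)"])
        (use exp_inverse_has_derivative in
          \<open>auto simp: has_field_derivative_def mult.commute[of _ "_ - _"]\<close>)
  qed
  then show ?thesis by (simp add: smooth_on_def)
qed

text \<open>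
  The quotient \<open>a / (a + b)\<close>, where \<open>a\<close> vanishes outside the ball of radius \<open>R\<close> and \<open>b\<close> vanishes on
  the ball of radius \<open>R/2\<close>, is constantly 1 on the small ball, as needed for fields
  that are to be extended without change near a point.
\<close>

lemma bump_function_exists:
  fixes p :: "'e::euclidean_space"
  assumes "open S" "p \<in> S"
  obtains \<phi> :: "'e \<Rightarrow> real" and K U where "smooth_on UNIV \<phi>" "compact K" "K \<subseteq> S"
    "\<And>q. q \<notin> K \<Longrightarrow> \<phi> q = 0" "open U" "p \<in> U" "U \<subseteq> S" "\<And>q. q \<in> U \<Longrightarrow> \<phi> q = 1"
proof -
  obtain R where R: "R > 0" "cball p R \<subseteq> S" using assms open_contains_cball by metis
  define a where "a q = exp_inverse 0 (R\<^sup>2 - (q - p) \<bullet> (q - p))" for q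
  define b where "b q = exp_inverse 0 ((q - p) \<bullet> (q - p) - (R/2)\<^sup>2)" for q
  have sq: "smooth_on UNIV (\<lambda>q. (q - p) \<bullet> (q - p))"
    by (intro smooth_on_bilinear[OF _ bounded_bilinear_inner] smooth_on_diff smooth_on_ident
        smooth_on_const) auto
  have sa: "smooth_on UNIV a" unfolding a_def
    by (rule smooth_on_compose[OF _ _ smooth_on_exp_inverse])
      (intro smooth_on_diff smooth_on_const sq | simp)+
  have sb: "smooth_on UNIV b" unfolding b_def
    by (rule smooth_on_compose[OF _ _ smooth_on_exp_inverse])
      (intro smooth_on_diff smooth_on_const sq | simp)+
  have lt: "(R/2)\<^sup>2 < R\<^sup>2" using R by (simp add: power_divide)
  have nn: "a q \<ge> 0" "b q \<ge> 0" for q by (auto simp: a_def b_def exp_inverse_def)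
  have pos: "a q + b q > 0" for q
  proof (cases "(q - p) \<bullet> (q - p) < R\<^sup>2")
    case True
    then have "a q > 0" by (simp add: a_def exp_inverse_def)
    then show ?thesis using nn(2)[of q] by linarith
  next
    case False
    then have "b q > 0" using lt by (simp add: b_def exp_inverse_def)
    then show ?thesis using nn(1)[of q] by linarith
  qed
  define \<phi> where "\<phi> q = a q * inverse (a q + b q)" for q
  show thesis
  proof
    show "smooth_on UNIV \<phi>" unfolding \<phi>_def
      using pos by (intro smooth_on_mult smooth_on_inverse smooth_on_add sa sb)
        (auto simp: less_imp_neq[symmetric])
    show "compact (cball p R)" "cball p R \<subseteq> S" using R by auto
    show "\<phi> q = 0" if "q \<notin> cball p R" for q
    proof -
      have "R < norm (q - p)" using that by (simp add: dist_norm norm_minus_commute)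
      then have "R\<^sup>2 \<le> (q - p) \<bullet> (q - p)"
        using R by (simp add: power2_norm_eq_inner[symmetric] power_mono)
      then show ?thesis by (simp add: \<phi>_def a_def exp_inverse_def)
    qed
    show "open (ball p (R/2))" "p \<in> ball p (R/2)" "ball p (R/2) \<subseteq> S" using R by auto
    show "\<phi> q = 1" if "q \<in> ball p (R/2)" for q
    proof -
      have "norm (q - p) \<le> R / 2" using that by (simp add: dist_norm norm_minus_commute)
      then have "(q - p) \<bullet> (q - p) \<le> (R/2)\<^sup>2"
        using R by (simp add: power2_norm_eq_inner[symmetric] power_mono)
      then have "b q = 0" by (simp add: b_def exp_inverse_def)
      then show ?thesis using pos[of q] by (simp add: \<phi>_def)
    qed
  qed
qed

lemma smooth_on_frechet_apply:
  fixes g :: "'b::euclidean_space \<Rightarrow> 'c::real_normed_vector"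
    and f :: "'a::euclidean_space \<Rightarrow> 'b"
  assumes "open S" "open T" "smooth_on T g" "smooth_on S f" "f ` S \<subseteq> T" "smooth_on S w"
  shows "smooth_on S (\<lambda>x. frechet_derivative g (at (f x)) (w x))"
proof -
  have "smooth_on S (\<lambda>x. frechet_derivative g (at (f x)) b)" for b
    using smooth_on_compose[OF assms(1,2) smooth_on_frechet[OF assms(3)] assms(4,5)] .
  then have "smooth_on S (\<lambda>x. \<Sum>b\<in>Basis. (w x \<bullet> b) *\<^sub>R frechet_derivative g (at (f x)) b)"
    by (intro smooth_on_sum smooth_on_scaleR smooth_on_inner_const assms)
  moreover have "frechet_derivative g (at (f x)) (w x) =
      (\<Sum>b\<in>Basis. (w x \<bullet> b) *\<^sub>R frechet_derivative g (at (f x)) b)" if "x \<in> S" for x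
  proof -
    have l: "linear (frechet_derivative g (at (f x)))"
      using smooth_on_has_derivative[OF assms(3), of "f x"] that assms(5) has_derivative_linear by blast
    show ?thesis
      by (subst euclidean_representation[of "w x", symmetric])
         (simp only: linear_sum[OF l] linear_cmul[OF l])
  qed
  ultimately show ?thesis using smooth_on_cong[OF assms(1)] by (metis (no_types, lifting))
qed


lemma frechet_derivative_eq: "(f has_derivative f') (at x) \<Longrightarrow> frechet_derivative f (at x) v = f' v"
  using frechet_derivative_at by metis


section \<open>Charts and tangent vectors\<close>

lemma chart_inv_in: "q \<in> snd c ` S \<Longrightarrow> S \<subseteq> fst c \<Longrightarrow> inj_on (snd c) (fst c) \<Longrightarrow> chart_inv c q \<in> S"
  by (auto simp: chart_inv_def inv_into_f_f subset_iff)

lemma chart_chart_inv: "q \<in> snd c ` fst c \<Longrightarrow> snd c (chart_inv c q) = q"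
  by (simp add: chart_inv_def f_inv_into_f)

lemma atlas_inj: "smooth_atlas M \<Longrightarrow> c \<in> M \<Longrightarrow> inj_on (snd c) (fst c)"
  by (simp add: smooth_atlas_def)

lemma atlas_open: "smooth_atlas M \<Longrightarrow> c \<in> M \<Longrightarrow> open (snd c ` fst c)"
  by (simp add: smooth_atlas_def)

lemma atlas_open_overlap:
  "smooth_atlas M \<Longrightarrow> c \<in> M \<Longrightarrow> c' \<in> M \<Longrightarrow> open (snd c ` (fst c \<inter> fst c'))"
  by (simp add: smooth_atlas_def)

lemma atlas_transition:
  "smooth_atlas M \<Longrightarrow> c \<in> M \<Longrightarrow> c' \<in> M \<Longrightarrow>
    smooth_on (snd c ` (fst c \<inter> fst c')) (\<lambda>p. snd c' (chart_inv c p))"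
  by (simp add: smooth_atlas_def o_def)

lemma chart_inv_chart: "smooth_atlas M \<Longrightarrow> c \<in> M \<Longrightarrow> x \<in> fst c \<Longrightarrow> chart_inv c (snd c x) = x"
  by (simp add: chart_inv_def inv_into_f_f atlas_inj)

lemma charts_atD: "c \<in> charts_at M x \<Longrightarrow> c \<in> M" "c \<in> charts_at M x \<Longrightarrow> x \<in> fst c"
  by (auto simp: charts_at_def)

lemma charts_at_carrier: "c \<in> charts_at M x \<Longrightarrow> x \<in> carrier_of M"
  by (auto simp: charts_at_def carrier_of_def)

lemma some_chart_in: "x \<in> carrier_of M \<Longrightarrow> some_chart M x \<in> charts_at M x"
  unfolding some_chart_def by (rule someI_ex) (auto simp: carrier_of_def charts_at_def)

text \<open>
  All coordinate changes of tangent vectors come from this instance of the chain rule.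
\<close>

lemma has_derivative_change_chart:
  assumes M: "smooth_atlas M" and c: "c \<in> charts_at M x" "c' \<in> charts_at M x"
    and f: "((\<lambda>p. f (chart_inv c p)) has_derivative f') (at (snd c x))"
  shows "((\<lambda>p. f (chart_inv c' p)) has_derivative
    (\<lambda>v. f' (frechet_derivative (snd c \<circ> chart_inv c') (at (snd c' x)) v))) (at (snd c' x))"
proof -
  note cM = charts_atD[OF c(1)] charts_atD[OF c(2)]
  let ?S = "snd c' ` (fst c' \<inter> fst c)"
  have x: "snd c' x \<in> ?S" using cM by auto
  have t: "((\<lambda>p. snd c (chart_inv c' p)) has_derivative
      frechet_derivative (snd c \<circ> chart_inv c') (at (snd c' x))) (at (snd c' x))"
    using smooth_on_has_derivative[OF atlas_transition[OF M cM(3,1)] x] by (simp add: o_def)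
  have "((\<lambda>p. f (chart_inv c p)) has_derivative f') (at (snd c (chart_inv c' (snd c' x))))"
    using f by (simp add: chart_inv_chart[OF M cM(3,4)])
  from diff_chain_at[OF t this]
  have "((\<lambda>p. f (chart_inv c (snd c (chart_inv c' p)))) has_derivative
    (\<lambda>v. f' (frechet_derivative (snd c \<circ> chart_inv c') (at (snd c' x)) v))) (at (snd c' x))"
    by (simp add: o_def)
  then show ?thesis
  proof (rule has_derivative_transform_within_open[OF _ atlas_open_overlap[OF M cM(3,1)] x])
    fix q assume "q \<in> ?S"
    then have "chart_inv c' q \<in> fst c' \<inter> fst c"
      by (rule chart_inv_in) (auto intro: atlas_inj[OF M cM(3)])
    then show "f (chart_inv c (snd c (chart_inv c' q))) = f (chart_inv c' q)"
      by (simp add: chart_inv_chart[OF M cM(1)])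
  qed
qed

lemma transition_has_derivative:
  assumes M: "smooth_atlas M" and c: "c \<in> charts_at M x" "c' \<in> charts_at M x"
  shows "((\<lambda>p. snd c' (chart_inv c p)) has_derivative
    frechet_derivative (snd c' \<circ> chart_inv c) (at (snd c x))) (at (snd c x))"
proof -
  have "snd c x \<in> snd c ` (fst c \<inter> fst c')" using c by (auto simp: charts_at_def)
  from smooth_on_has_derivative[OF atlas_transition[OF M charts_atD(1)[OF c(1)] charts_atD(1)[OF c(2)]] this]
  show ?thesis by (simp add: o_def)
qed

lemma transition_cocycle:
  assumes M: "smooth_atlas M"
    and c: "c \<in> charts_at M x" "c' \<in> charts_at M x" "c'' \<in> charts_at M x"
  shows "frechet_derivative (snd c'' \<circ> chart_inv c') (at (snd c' x))
      (frechet_derivative (snd c' \<circ> chart_inv c) (at (snd c x)) u) =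
    frechet_derivative (snd c'' \<circ> chart_inv c) (at (snd c x)) u"
  using frechet_derivative_eq[OF has_derivative_change_chart[OF M c(2,1)
      transition_has_derivative[OF M c(2,3)]], of u]
  unfolding o_def by (rule sym)

lemma transition_self:
  assumes M: "smooth_atlas M" and c: "c \<in> charts_at M x"
  shows "frechet_derivative (snd c \<circ> chart_inv c) (at (snd c x)) u = u"
proof -
  note cM = charts_atD[OF c]
  have "((\<lambda>p. p) has_derivative (\<lambda>v. v)) (at (snd c x))" by (rule has_derivative_ident)
  then have "((\<lambda>p. snd c (chart_inv c p)) has_derivative (\<lambda>v. v)) (at (snd c x))"
    by (rule has_derivative_transform_within_open[OF _ atlas_open[OF M cM(1)]])
      (use cM in \<open>auto simp: chart_chart_inv\<close>)
  from frechet_derivative_eq[OF this] show ?thesis by (simp add: o_def)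
qed

lemma transition_linear:
  "smooth_atlas M \<Longrightarrow> c \<in> charts_at M x \<Longrightarrow> c' \<in> charts_at M x \<Longrightarrow>
    linear (frechet_derivative (snd c' \<circ> chart_inv c) (at (snd c x)))"
  by (rule has_derivative_linear[OF transition_has_derivative])

lemma tangent_vec_chart:
  "v \<in> tangent_space M x \<Longrightarrow> c \<in> charts_at M x \<Longrightarrow> c' \<in> charts_at M x \<Longrightarrow>
    v c' = frechet_derivative (snd c' \<circ> chart_inv c) (at (snd c x)) (v c)"
  unfolding tangent_space_def by blast

lemma tangent_vec_outside: "v \<in> tangent_space M x \<Longrightarrow> c \<notin> charts_at M x \<Longrightarrow> v c = 0"
  unfolding tangent_space_def by blast

lemma coord_vec_tangent:
  "smooth_atlas M \<Longrightarrow> c \<in> charts_at M x \<Longrightarrow> coord_vec M x c u \<in> tangent_space M x"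
  by (auto simp: tangent_space_def coord_vec_def transition_cocycle)

lemma coord_vec_self:
  "smooth_atlas M \<Longrightarrow> c \<in> charts_at M x \<Longrightarrow> coord_vec M x c u c = u"
  by (simp add: coord_vec_def transition_self)

lemma coord_vec_eq:
  "v \<in> tangent_space M x \<Longrightarrow> c \<in> charts_at M x \<Longrightarrow> coord_vec M x c (v c) = v"
  unfolding coord_vec_def by (rule ext) (metis tangent_vec_chart tangent_vec_outside)

lemma tangent_vec_eqI:
  assumes "v \<in> tangent_space M x" "w \<in> tangent_space M x" "c \<in> charts_at M x" "v c = w c"
  shows "v = w"
  using coord_vec_eq[OF assms(1,3)] coord_vec_eq[OF assms(2,3)] assms(4) by metis

lemma tangent_space_outside: "x \<notin> carrier_of M \<Longrightarrow> v \<in> tangent_space M x \<Longrightarrow> v = 0"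
  by (auto simp: fun_eq_iff intro: tangent_vec_outside dest: charts_at_carrier)

lemma tangent_spaceI:
  assumes "\<And>c c'. c \<in> charts_at M x \<Longrightarrow> c' \<in> charts_at M x \<Longrightarrow>
      v c' = frechet_derivative (snd c' \<circ> chart_inv c) (at (snd c x)) (v c)"
    and "\<And>c. c \<notin> charts_at M x \<Longrightarrow> v c = 0"
  shows "v \<in> tangent_space M x"
  using assms unfolding tangent_space_def by blast

lemma tangent_add:
  assumes "smooth_atlas M" "v \<in> tangent_space M x" "w \<in> tangent_space M x"
  shows "v + w \<in> tangent_space M x"
  using tangent_vec_chart[OF assms(2), symmetric] tangent_vec_chart[OF assms(3), symmetric]
  by (intro tangent_spaceI)
    (simp_all add: linear_add[OF transition_linear[OF assms(1)]] tangent_vec_outside[OF assms(2)]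
      tangent_vec_outside[OF assms(3)])

lemma tangent_scale:
  assumes "smooth_atlas M" "v \<in> tangent_space M x"
  shows "a *\<^sub>R v \<in> tangent_space M x"
  using tangent_vec_chart[OF assms(2), symmetric]
  by (intro tangent_spaceI)
    (simp_all add: scaleR_fun_def linear_cmul[OF transition_linear[OF assms(1)]]
      tangent_vec_outside[OF assms(2)])

lemma tangent_zero: "smooth_atlas M \<Longrightarrow> 0 \<in> tangent_space M x"
  by (intro tangent_spaceI) (simp_all add: linear_0[OF transition_linear])

lemma tangent_subspace: "smooth_atlas M \<Longrightarrow> subspace (tangent_space M x)"
  by (auto simp: subspace_def tangent_add tangent_scale tangent_zero)

lemma coord_vec_linear: "smooth_atlas M \<Longrightarrow> c \<in> charts_at M x \<Longrightarrow> linear (coord_vec M x c)"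
  by (intro linearI ext) (simp_all add: coord_vec_def scaleR_fun_def
      linear_add[OF transition_linear] linear_cmul[OF transition_linear])

text \<open>
  The derivative of a function along a tangent vector, like the differential of a map below, is defined
  through an arbitrarily chosen chart. It can be computed in any chart.
\<close>

lemma tangent_has_derivative_independent:
  assumes M: "smooth_atlas M" and c: "c \<in> charts_at M x" "c' \<in> charts_at M x"
    and v: "v \<in> tangent_space M x"
    and f: "((\<lambda>p. f (chart_inv c p)) has_derivative f') (at (snd c x))"
  shows "frechet_derivative (\<lambda>p. f (chart_inv c' p)) (at (snd c' x)) (v c') = f' (v c)"
  using frechet_derivative_eq[OF has_derivative_change_chart[OF M c f], of "v c'"]
  unfolding tangent_vec_chart[OF v c(2,1), symmetric] .

lemma dir_deriv_eq:
  assumes M: "smooth_atlas M" and c: "c \<in> charts_at M x" and v: "v \<in> tangent_space M x"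
    and f: "((\<lambda>p. f (chart_inv c p)) has_derivative f') (at (snd c x))"
  shows "dir_deriv M f x v = f' (v c)"
  unfolding dir_deriv_def Let_def o_def
  using tangent_has_derivative_independent[OF M c some_chart_in[OF charts_at_carrier[OF c]] v f] .

lemma smooth_map_has_derivative:
  assumes M: "smooth_atlas M" and f: "smooth_map M N f"
    and c: "c \<in> charts_at M x" and k: "k \<in> charts_at N (f x)"
  shows "((\<lambda>p. snd k (f (chart_inv c p))) has_derivative
    frechet_derivative (snd k \<circ> f \<circ> chart_inv c) (at (snd c x))) (at (snd c x))"
proof -
  have "smooth_on (snd c ` (fst c \<inter> f -` fst k)) (snd k \<circ> f \<circ> chart_inv c)"
    using f c k by (auto simp: smooth_map_def charts_at_def)
  moreover have "snd c x \<in> snd c ` (fst c \<inter> f -` fst k)" using c k by (auto simp: charts_at_def)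
  ultimately show ?thesis using smooth_on_has_derivative by (fastforce simp: o_def)
qed

lemma tangent_map_eq:
  assumes M: "smooth_atlas M" and N: "smooth_atlas N" and f: "smooth_map M N f"
    and c: "c \<in> charts_at M x" and k: "k \<in> charts_at N (f x)" and v: "v \<in> tangent_space M x"
  shows "tangent_map M N f x v =
    coord_vec N (f x) k (frechet_derivative (snd k \<circ> f \<circ> chart_inv c) (at (snd c x)) (v c))"
proof (rule ext)
  fix k'
  show "tangent_map M N f x v k' =
    coord_vec N (f x) k (frechet_derivative (snd k \<circ> f \<circ> chart_inv c) (at (snd c x)) (v c)) k'"
  proof (cases "k' \<in> charts_at N (f x)")
    case k': True
    let ?c = "some_chart M x"
    have sc: "?c \<in> charts_at M x" by (rule some_chart_in[OF charts_at_carrier[OF c]])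
    have "frechet_derivative (\<lambda>p. snd k' (f (chart_inv ?c p))) (at (snd ?c x)) (v ?c) =
        frechet_derivative (snd k' \<circ> f \<circ> chart_inv c) (at (snd c x)) (v c)"
      by (rule tangent_has_derivative_independent[OF M c sc v smooth_map_has_derivative[OF M f c k']])
    moreover have "frechet_derivative (snd k' \<circ> f \<circ> chart_inv c) (at (snd c x)) (v c) =
        frechet_derivative (snd k' \<circ> chart_inv k) (at (snd k (f x)))
          (frechet_derivative (snd k \<circ> f \<circ> chart_inv c) (at (snd c x)) (v c))"
    proof -
      have cx: "chart_inv c (snd c x) = x" by (rule chart_inv_chart[OF M charts_atD[OF c]])
      have 1: "((\<lambda>p. snd k' (chart_inv k p)) has_derivative
          frechet_derivative (snd k' \<circ> chart_inv k) (at (snd k (f x))))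
          (at (snd k (f (chart_inv c (snd c x)))))"
        using transition_has_derivative[OF N k k'] cx by simp
      have 2: "((\<lambda>p. snd k' (chart_inv k (snd k (f (chart_inv c p))))) has_derivative
        (\<lambda>v. frechet_derivative (snd k' \<circ> chart_inv k) (at (snd k (f x)))
          (frechet_derivative (snd k \<circ> f \<circ> chart_inv c) (at (snd c x)) v))) (at (snd c x))"
        using diff_chain_at[OF smooth_map_has_derivative[OF M f c k] 1] by (simp add: o_def)
      let ?S = "snd c ` (fst c \<inter> f -` fst k)"
      have o: "open ?S" using f c k by (auto simp: smooth_map_def charts_at_def)
      have xS: "snd c x \<in> ?S" using c k by (auto simp: charts_at_def)
      have 3: "((\<lambda>p. snd k' (f (chart_inv c p))) has_derivative
        (\<lambda>v. frechet_derivative (snd k' \<circ> chart_inv k) (at (snd k (f x)))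
          (frechet_derivative (snd k \<circ> f \<circ> chart_inv c) (at (snd c x)) v))) (at (snd c x))"
      proof (rule has_derivative_transform_within_open[OF 2 o xS])
        fix p assume "p \<in> ?S"
        then have "chart_inv c p \<in> fst c \<inter> f -` fst k"
          by (rule chart_inv_in) (auto intro: atlas_inj[OF M charts_atD(1)[OF c]])
        then show "snd k' (chart_inv k (snd k (f (chart_inv c p)))) = snd k' (f (chart_inv c p))"
          by (simp add: chart_inv_chart[OF N charts_atD(1)[OF k]])
      qed
      show ?thesis using frechet_derivative_eq[OF 3] by (simp add: o_def)
    qed
    ultimately show ?thesis using k'
      by (simp add: tangent_map_def coord_vec_def Let_def o_def)
  qed (simp add: tangent_map_def coord_vec_def Let_def)
qed

section \<open>Extending local objects to the whole manifold\<close>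

lemma inj_on_image_Int_chart:
  "smooth_atlas M \<Longrightarrow> c \<in> M \<Longrightarrow> A \<subseteq> fst c \<Longrightarrow> B \<subseteq> fst c \<Longrightarrow> snd c ` (A \<inter> B) = snd c ` A \<inter> snd c ` B"
  by (rule inj_on_image_Int[OF atlas_inj])

lemma openin_manifold_topology:
  assumes M: "smooth_atlas M"
  shows "openin (manifold_topology M) W \<longleftrightarrow>
    W \<subseteq> carrier_of M \<and> (\<forall>c\<in>M. open (snd c ` (W \<inter> fst c)))"
proof -
  have "istopology (\<lambda>W. W \<subseteq> carrier_of M \<and> (\<forall>c\<in>M. open (snd c ` (W \<inter> fst c))))"
    unfolding istopology_def
  proof (intro conjI allI impI ballI)
    fix W W'
    assume W: "W \<subseteq> carrier_of M \<and> (\<forall>c\<in>M. open (snd c ` (W \<inter> fst c)))"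
      "W' \<subseteq> carrier_of M \<and> (\<forall>c\<in>M. open (snd c ` (W' \<inter> fst c)))"
    show "W \<inter> W' \<subseteq> carrier_of M" using W by auto
    fix c assume c: "c \<in> M"
    have "snd c ` ((W \<inter> W') \<inter> fst c) = snd c ` (W \<inter> fst c) \<inter> snd c ` (W' \<inter> fst c)"
      by (subst inj_on_image_Int_chart[OF M c, symmetric]) (auto intro: arg_cong[where f = "image (snd c)"])
    then show "open (snd c ` ((W \<inter> W') \<inter> fst c))" using W c by auto
  next
    fix \<W>
    assume W: "\<forall>W\<in>\<W>. W \<subseteq> carrier_of M \<and> (\<forall>c\<in>M. open (snd c ` (W \<inter> fst c)))"
    show "\<Union>\<W> \<subseteq> carrier_of M" using W by auto
    fix c assume c: "c \<in> M"
    have "snd c ` (\<Union>\<W> \<inter> fst c) = (\<Union>W\<in>\<W>. snd c ` (W \<inter> fst c))" by auto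
    then show "open (snd c ` (\<Union>\<W> \<inter> fst c))" using W c by auto
  qed
  then show ?thesis unfolding manifold_topology_def by simp
qed

lemma topspace_manifold_topology: "smooth_atlas M \<Longrightarrow> topspace (manifold_topology M) = carrier_of M"
proof -
  assume M: "smooth_atlas M"
  have "fst c \<subseteq> carrier_of M" if "c \<in> M" for c using that by (auto simp: carrier_of_def)
  then have "snd c ` (carrier_of M \<inter> fst c) = snd c ` fst c" if "c \<in> M" for c
    using that by (metis inf.absorb2)
  then have "openin (manifold_topology M) (carrier_of M)"
    using M by (simp add: openin_manifold_topology atlas_open)
  moreover have "topspace (manifold_topology M) \<subseteq> carrier_of M"
    unfolding topspace_def using openin_manifold_topology[OF M] by blast
  ultimately show ?thesis by (simp add: openin_subset subset_antisym)
qed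

lemma openin_chart_image:
  assumes M: "smooth_atlas M" and c: "c \<in> M" and U: "open U" "U \<subseteq> snd c ` fst c"
  shows "openin (manifold_topology M) (chart_inv c ` U)"
  unfolding openin_manifold_topology[OF M]
proof (intro conjI ballI)
  have "chart_inv c ` U \<subseteq> fst c"
    using chart_inv_in[OF _ _ atlas_inj[OF M c]] U(2) by blast
  then show "chart_inv c ` U \<subseteq> carrier_of M" using c by (auto simp: carrier_of_def)
  fix c' assume c': "c' \<in> M"
  let ?S = "snd c' ` (fst c' \<inter> fst c)"
  have inS: "chart_inv c' q \<in> fst c' \<inter> fst c" if "q \<in> ?S" for q
    using that by (rule chart_inv_in) (auto intro: atlas_inj[OF M c'])
  have "snd c' ` (chart_inv c ` U \<inter> fst c') = {q \<in> ?S. snd c (chart_inv c' q) \<in> U}"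
  proof (intro set_eqI iffI)
    fix q assume "q \<in> snd c' ` (chart_inv c ` U \<inter> fst c')"
    then obtain p where p: "p \<in> U" "chart_inv c p \<in> fst c'" "q = snd c' (chart_inv c p)" by auto
    have "chart_inv c p \<in> fst c" "snd c (chart_inv c p) = p"
      using p(1) U(2) chart_chart_inv[of p c] chart_inv_in[OF _ _ atlas_inj[OF M c]] by blast+
    then show "q \<in> {q \<in> ?S. snd c (chart_inv c' q) \<in> U}"
      using p by (auto simp: chart_inv_chart[OF M c'])
  next
    fix q assume q: "q \<in> {q \<in> ?S. snd c (chart_inv c' q) \<in> U}"
    then have "chart_inv c (snd c (chart_inv c' q)) = chart_inv c' q" "snd c' (chart_inv c' q) = q"
      using inS[of q] chart_chart_inv[of q c'] by (auto simp: chart_inv_chart[OF M c])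
    then show "q \<in> snd c' ` (chart_inv c ` U \<inter> fst c')"
      using q inS[of q] by (intro image_eqI[of _ _ "chart_inv c' q"]) (auto intro: rev_image_eqI)
  qed
  moreover have "open {q \<in> ?S. snd c (chart_inv c' q) \<in> U}"
    using continuous_open_preimage[OF smooth_on_continuous[OF atlas_transition[OF M c' c]]
        atlas_open_overlap[OF M c' c] U(1)]
    by (simp add: vimage_def Int_def)
  ultimately show "open (snd c' ` (chart_inv c ` U \<inter> fst c'))" by simp
qed

text \<open>
  The function is zero off the image of a compact set \<open>K\<close>. This image is compact, hence closed because the
  manifold is Hausdorff, so the chart domain and the complement of the image form an open cover on whose
  members the function is smooth.
\<close>

lemma smooth_extension_by_zero:
  assumes M: "smooth_manifold M" and c: "c \<in> M" and c': "c' \<in> M"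
    and K: "compact K" "K \<subseteq> snd c ` fst c"
    and F: "smooth_on (snd c' ` (fst c' \<inter> fst c)) (\<lambda>p. F (chart_inv c' p))"
    and F0: "\<And>y. y \<in> carrier_of M \<Longrightarrow> y \<notin> chart_inv c ` K \<Longrightarrow> F y = 0"
  shows "smooth_on (snd c' ` fst c') (\<lambda>p. F (chart_inv c' p))"
proof -
  have A: "smooth_atlas M" using M by (simp add: smooth_manifold_def)
  have inc: "chart_inv c q \<in> fst c" if "q \<in> snd c ` fst c" for q
    using that by (rule chart_inv_in) (auto intro: atlas_inj[OF A c])
  have "continuous_map (subtopology euclidean (snd c ` fst c)) (manifold_topology M) (chart_inv c)"
    unfolding continuous_map_def
  proof (intro conjI allI impI)
    show "chart_inv c \<in> topspace (subtopology euclidean (snd c ` fst c)) \<rightarrow> topspace (manifold_topology M)"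
      using inc c by (auto simp: topspace_manifold_topology[OF A] carrier_of_def)
    fix W assume W: "openin (manifold_topology M) W"
    have "{x \<in> snd c ` fst c. chart_inv c x \<in> W} = snd c ` (W \<inter> fst c)"
      using inc by (auto simp: chart_inv_chart[OF A c] chart_chart_inv image_iff)
    then show "openin (subtopology euclidean (snd c ` fst c))
        {x \<in> topspace (subtopology euclidean (snd c ` fst c)). chart_inv c x \<in> W}"
      using W c by (auto simp: openin_manifold_topology[OF A] openin_open_eq[OF atlas_open[OF A c]])
  qed
  moreover have "compactin (subtopology euclidean (snd c ` fst c)) K"
    using K by (simp add: compactin_subtopology)
  ultimately have "compactin (manifold_topology M) (chart_inv c ` K)"
    by (rule image_compactin[rotated])
  then have "closedin (manifold_topology M) (chart_inv c ` K)"
    using M compactin_imp_closedin by (auto simp: smooth_manifold_def)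
  then have W: "openin (manifold_topology M) (carrier_of M - chart_inv c ` K)" (is "openin _ ?W")
    by (simp add: closedin_def topspace_manifold_topology[OF A])
  show ?thesis
  proof (rule smooth_on_local)
    fix q assume q: "q \<in> snd c' ` fst c'"
    then have y: "chart_inv c' q \<in> fst c'" "snd c' (chart_inv c' q) = q"
      by (auto intro: chart_inv_in[OF _ _ atlas_inj[OF A c']] chart_chart_inv)
    show "\<exists>U. open U \<and> q \<in> U \<and> smooth_on U (\<lambda>p. F (chart_inv c' p))"
    proof (cases "chart_inv c' q \<in> fst c")
      case True
      then have "q \<in> snd c' ` (fst c' \<inter> fst c)" using y by (metis IntI imageI)
      then show ?thesis using F atlas_open_overlap[OF A c' c] by blast
    next
      case False
      let ?U = "snd c' ` (?W \<inter> fst c')"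
      have "chart_inv c' q \<notin> chart_inv c ` K" using False inc[OF subsetD[OF K(2)]] by auto
      moreover have "chart_inv c' q \<in> carrier_of M" using y c' by (auto simp: carrier_of_def)
      ultimately have "q \<in> ?U" using y by (metis DiffI IntI imageI)
      moreover have o: "open ?U" using W c' by (simp add: openin_manifold_topology[OF A])
      moreover have "smooth_on ?U (\<lambda>p. F (chart_inv c' p))"
      proof (subst smooth_on_cong[OF o])
        fix p assume "p \<in> ?U"
        then have "chart_inv c' p \<in> ?W \<inter> fst c'"
          by (rule chart_inv_in) (auto intro: atlas_inj[OF A c'])
        then show "F (chart_inv c' p) = 0" using F0 by auto
      qed (rule smooth_on_const)
      ultimately show ?thesis by blast
    qed
  qed
qed

lemma coord_vec_smooth:
  assumes M: "smooth_atlas M" and c: "c \<in> M" and c': "c' \<in> M" and h: "smooth_on (snd c ` fst c) h"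
  shows "smooth_on (snd c' ` (fst c' \<inter> fst c))
    (\<lambda>p. coord_vec M (chart_inv c' p) c (h (snd c (chart_inv c' p))) c')"
proof -
  let ?S = "snd c' ` (fst c' \<inter> fst c)" and ?T = "snd c ` (fst c \<inter> fst c')"
  have inS: "chart_inv c' q \<in> fst c' \<inter> fst c" if "q \<in> ?S" for q
    using that by (rule chart_inv_in) (auto intro: atlas_inj[OF M c'])
  note S = atlas_open_overlap[OF M c' c] and tr = atlas_transition[OF M c' c]
  have im: "(\<lambda>p. snd c (chart_inv c' p)) ` ?S \<subseteq> ?T" using inS by blast
  have sh: "smooth_on ?S (\<lambda>p. h (snd c (chart_inv c' p)))"
    by (rule smooth_on_compose[OF S atlas_open[OF M c] h tr]) (use im in blast)
  have "smooth_on ?S (\<lambda>p. frechet_derivative (\<lambda>p. snd c' (chart_inv c p))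
      (at (snd c (chart_inv c' p))) (h (snd c (chart_inv c' p))))"
    by (rule smooth_on_frechet_apply[OF S atlas_open_overlap[OF M c c'] atlas_transition[OF M c c'] tr im sh])
  then show ?thesis
    by (subst smooth_on_cong[OF S]) (use inS c' in \<open>auto simp: coord_vec_def charts_at_def o_def\<close>)
qed

lemma vector_fieldD:
  "X \<in> vector_fields M \<Longrightarrow> X x \<in> tangent_space M x"
  "X \<in> vector_fields M \<Longrightarrow> c \<in> M \<Longrightarrow> smooth_on (snd c ` fst c) (\<lambda>p. X (chart_inv c p) c)"
  by (auto simp: vector_fields_def)

lemma manifold_bump_function:
  assumes M: "smooth_manifold M" and c: "c \<in> charts_at M x"
    and W: "openin (manifold_topology M) W" "x \<in> W"
  obtains \<beta> K V where "smooth_on UNIV \<beta>" "compact K" "K \<subseteq> snd c ` (W \<inter> fst c)"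
    "\<And>q. q \<notin> K \<Longrightarrow> \<beta> q = (0::real)"
    "openin (manifold_topology M) V" "x \<in> V" "V \<subseteq> W \<inter> fst c" "\<And>y. y \<in> V \<Longrightarrow> \<beta> (snd c y) = 1"
proof -
  have A: "smooth_atlas M" using M by (simp add: smooth_manifold_def)
  note cM = charts_atD[OF c]
  have o: "open (snd c ` (W \<inter> fst c))" using W cM by (simp add: openin_manifold_topology[OF A])
  have x: "snd c x \<in> snd c ` (W \<inter> fst c)" using W cM by auto
  obtain \<beta> K U where b: "smooth_on UNIV \<beta>" "compact K" "K \<subseteq> snd c ` (W \<inter> fst c)"
    "\<And>q. q \<notin> K \<Longrightarrow> \<beta> q = (0::real)" "open U" "snd c x \<in> U" "U \<subseteq> snd c ` (W \<inter> fst c)"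
    "\<And>q. q \<in> U \<Longrightarrow> \<beta> q = 1"
    using bump_function_exists[OF o x] by metis
  have Uc: "U \<subseteq> snd c ` fst c" using b(7) by auto
  show thesis
  proof (rule that[of \<beta> K "chart_inv c ` U"])
    show "openin (manifold_topology M) (chart_inv c ` U)"
      by (rule openin_chart_image[OF A cM(1) b(5) Uc])
    show "x \<in> chart_inv c ` U" using b(6) chart_inv_chart[OF A cM] by (metis imageI)
    show "chart_inv c ` U \<subseteq> W \<inter> fst c"
      using b(7) chart_inv_in[OF _ _ atlas_inj[OF A cM(1)]] by (metis Int_lower2 image_subsetI subsetD)
    show "\<beta> (snd c y) = 1" if "y \<in> chart_inv c ` U" for y
    proof -
      from that obtain q where q: "q \<in> U" "y = chart_inv c q" by auto
      show ?thesis using b(8)[OF q(1)] chart_chart_inv[OF subsetD[OF Uc q(1)]] q(2) by simp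
    qed
  qed (use b in auto)
qed

lemma smooth_fun_extension:
  assumes M: "smooth_manifold M" and c: "c \<in> charts_at M x" and h: "smooth_on (snd c ` fst c) h"
    and W: "openin (manifold_topology M) W" "x \<in> W"
  obtains f V where "smooth_fun M f" "\<And>y. y \<notin> W \<Longrightarrow> f y = 0"
    "openin (manifold_topology M) V" "x \<in> V" "V \<subseteq> W \<inter> fst c"
    "\<And>y. y \<in> V \<Longrightarrow> f y = h (snd c y)"
proof -
  have A: "smooth_atlas M" using M by (simp add: smooth_manifold_def)
  note cM = charts_atD[OF c]
  obtain \<beta> K V where b: "smooth_on UNIV \<beta>" "compact K" "K \<subseteq> snd c ` (W \<inter> fst c)"
    "\<And>q. q \<notin> K \<Longrightarrow> \<beta> q = (0::real)"
    "openin (manifold_topology M) V" "x \<in> V" "V \<subseteq> W \<inter> fst c" "\<And>y. y \<in> V \<Longrightarrow> \<beta> (snd c y) = 1"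
    using manifold_bump_function[OF M c W] by metis
  define f where "f y = (if y \<in> fst c then \<beta> (snd c y) * h (snd c y) else 0)" for y
  have Kc: "K \<subseteq> snd c ` fst c" using b(3) by auto
  have bh: "smooth_on (snd c ` fst c) (\<lambda>p. \<beta> p * h p)"
    using smooth_on_subset[OF b(1)] by (intro smooth_on_mult atlas_open[OF A cM(1)] h) auto
  have f0: "f y = 0" if "y \<notin> chart_inv c ` K" for y
  proof (cases "y \<in> fst c")
    case True
    then have "snd c y \<notin> K" using that chart_inv_chart[OF A cM(1) True] by (metis imageI)
    then show ?thesis by (simp add: f_def b(4))
  qed (simp add: f_def)
  show thesis
  proof (rule that[of f V])
    show "smooth_fun M f" unfolding smooth_fun_def o_def
    proof
      fix c' assume c': "c' \<in> M"
      let ?S = "snd c' ` (fst c' \<inter> fst c)"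
      have inS: "chart_inv c' q \<in> fst c' \<inter> fst c" if "q \<in> ?S" for q
        using that by (rule chart_inv_in) (auto intro: atlas_inj[OF A c'])
      note S = atlas_open_overlap[OF A c' cM(1)]
      have "smooth_on ?S (\<lambda>p. \<beta> (snd c (chart_inv c' p)) * h (snd c (chart_inv c' p)))"
        using inS by (intro smooth_on_compose[OF S atlas_open[OF A cM(1)] bh atlas_transition[OF A c' cM(1)]]) auto
      then have "smooth_on ?S (\<lambda>p. f (chart_inv c' p))"
        by (subst smooth_on_cong[OF S]) (use inS in \<open>auto simp: f_def\<close>)
      then show "smooth_on (snd c' ` fst c') (\<lambda>p. f (chart_inv c' p))"
        by (rule smooth_extension_by_zero[OF M cM(1) c' b(2) Kc]) (use f0 in auto)
    qed
    show "f y = 0" if "y \<notin> W" for y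
    proof (rule f0)
      have "chart_inv c ` K \<subseteq> W \<inter> fst c"
        using b(3) chart_inv_in[OF _ _ atlas_inj[OF A cM(1)]] by (metis Int_lower2 image_subsetI subsetD)
      then show "y \<notin> chart_inv c ` K" using that by auto
    qed
    show "f y = h (snd c y)" if "y \<in> V" for y using that b(7,8) by (auto simp: f_def)
  qed (use b in auto)
qed

text \<open>
  Cut off with a bump function that is 1 near the point.
\<close>

lemma vector_field_extension:
  assumes M: "smooth_manifold M" and c: "c \<in> charts_at M x" and h: "smooth_on (snd c ` fst c) h"
  obtains X V where "X \<in> vector_fields M" "openin (manifold_topology M) V" "x \<in> V" "V \<subseteq> fst c"
    "\<And>y. y \<in> V \<Longrightarrow> X y = coord_vec M y c (h (snd c y))"
proof -
  have A: "smooth_atlas M" using M by (simp add: smooth_manifold_def)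
  note cM = charts_atD[OF c]
  have W: "openin (manifold_topology M) (carrier_of M)" "x \<in> carrier_of M"
    using topspace_manifold_topology[OF A] charts_at_carrier[OF c] by (metis openin_topspace)+
  obtain \<beta> K V where b: "smooth_on UNIV \<beta>" "compact K" "K \<subseteq> snd c ` (carrier_of M \<inter> fst c)"
    "\<And>q. q \<notin> K \<Longrightarrow> \<beta> q = (0::real)"
    "openin (manifold_topology M) V" "x \<in> V" "V \<subseteq> carrier_of M \<inter> fst c" "\<And>y. y \<in> V \<Longrightarrow> \<beta> (snd c y) = 1"
    using manifold_bump_function[OF M c W] by metis
  define X where "X y = (if y \<in> fst c then coord_vec M y c (\<beta> (snd c y) *\<^sub>R h (snd c y)) else 0)" for y
  have Kc: "K \<subseteq> snd c ` fst c" using b(3) by auto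
  have bh: "smooth_on (snd c ` fst c) (\<lambda>p. \<beta> p *\<^sub>R h p)"
    using smooth_on_subset[OF b(1)] by (intro smooth_on_scaleR atlas_open[OF A cM(1)] h) auto
  have cat: "c \<in> charts_at M y" if "y \<in> fst c" for y using that cM by (simp add: charts_at_def)
  show thesis
  proof (rule that[of X V])
    show "X \<in> vector_fields M" unfolding vector_fields_def
    proof (intro CollectI conjI allI ballI)
      show "X y \<in> tangent_space M y" for y
        using cat by (simp add: X_def coord_vec_tangent[OF A] tangent_zero[OF A])
      fix c' assume c': "c' \<in> M"
      let ?S = "snd c' ` (fst c' \<inter> fst c)"
      have inS: "chart_inv c' q \<in> fst c' \<inter> fst c" if "q \<in> ?S" for q
        using that by (rule chart_inv_in) (auto intro: atlas_inj[OF A c'])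
      have "smooth_on ?S (\<lambda>p. X (chart_inv c' p) c')"
        using coord_vec_smooth[OF A cM(1) c' bh]
        by (subst smooth_on_cong[OF atlas_open_overlap[OF A c' cM(1)]]) (use inS in \<open>auto simp: X_def\<close>)
      then show "smooth_on (snd c' ` fst c') (\<lambda>p. X (chart_inv c' p) c')"
      proof (rule smooth_extension_by_zero[OF M cM(1) c' b(2) Kc])
        fix y assume "y \<notin> chart_inv c ` K"
        then have "\<beta> (snd c y) = 0" if "y \<in> fst c"
          using that chart_inv_chart[OF A cM(1) that] b(4) by (metis imageI)
        then have "X y = 0" using linear_0[OF coord_vec_linear[OF A cat]] by (simp add: X_def)
        then show "X y c' = 0" by simp
      qed
    qed
    show "X y = coord_vec M y c (h (snd c y))" if "y \<in> V" for y
      using that b(7,8) by (auto simp: X_def)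
  qed (use b in auto)
qed

lemma vector_field_through:
  assumes M: "smooth_manifold M" and v: "v \<in> tangent_space M x"
  shows "\<exists>X. X \<in> vector_fields M \<and> X x = v"
proof (cases "x \<in> carrier_of M")
  case True
  have A: "smooth_atlas M" using M by (simp add: smooth_manifold_def)
  note c = some_chart_in[OF True]
  obtain X V where "X \<in> vector_fields M" "x \<in> V"
    "\<And>y. y \<in> V \<Longrightarrow> X y = coord_vec M y (some_chart M x) (v (some_chart M x))"
    using vector_field_extension[OF M c smooth_on_const] by metis
  then show ?thesis using coord_vec_eq[OF v c] by metis
next
  case False
  have A: "smooth_atlas M" using M by (simp add: smooth_manifold_def)
  have "(\<lambda>x. 0) \<in> vector_fields M"
    by (simp add: vector_fields_def tangent_zero[OF A] smooth_on_const)
  then show ?thesis using tangent_space_outside[OF False v] by metis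
qed

text \<open>
  The choice in the definition is possible, since constant coordinate fields extend.
\<close>

lemma coord_field_props:
  assumes M: "smooth_manifold M" and c: "c \<in> charts_at M x"
  shows "coord_field M x c b \<in> vector_fields M"
    "\<exists>W. openin (manifold_topology M) W \<and> x \<in> W \<and> W \<subseteq> fst c \<and>
      (\<forall>y\<in>W. coord_field M x c b y = coord_vec M y c b)"
proof -
  have "\<exists>Y. Y \<in> vector_fields M \<and> (\<exists>W. openin (manifold_topology M) W \<and> x \<in> W \<and> W \<subseteq> fst c \<and>
      (\<forall>y\<in>W. Y y = coord_vec M y c b))"
    using vector_field_extension[OF M c smooth_on_const] by metis
  from someI_ex[OF this] show "coord_field M x c b \<in> vector_fields M"
    "\<exists>W. openin (manifold_topology M) W \<and> x \<in> W \<and> W \<subseteq> fst c \<and>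
      (\<forall>y\<in>W. coord_field M x c b y = coord_vec M y c b)"
    unfolding coord_field_def by blast+
qed

section \<open>Connections in local coordinates\<close>

lemma smooth_manifold_atlas: "smooth_manifold M \<Longrightarrow> smooth_atlas M"
  by (simp add: smooth_manifold_def)

lemma vector_field_add:
  assumes "smooth_atlas M" "X \<in> vector_fields M" "Y \<in> vector_fields M"
  shows "X + Y \<in> vector_fields M"
  using assms by (auto simp: vector_fields_def intro!: tangent_add smooth_on_add atlas_open)

lemma vector_field_scale:
  assumes "smooth_atlas M" "smooth_fun M f" "X \<in> vector_fields M"
  shows "(\<lambda>x. f x *\<^sub>R X x) \<in> vector_fields M"
  using assms
  by (auto simp: vector_fields_def smooth_fun_def o_def scaleR_fun_def
      intro!: tangent_scale[unfolded scaleR_fun_def] smooth_on_scaleR atlas_open)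

lemma vector_field_zero: "smooth_atlas M \<Longrightarrow> 0 \<in> vector_fields M"
  by (auto simp: vector_fields_def tangent_zero smooth_on_const)

lemma vector_field_sum:
  assumes "smooth_atlas M" "\<And>i. i \<in> I \<Longrightarrow> X i \<in> vector_fields M"
  shows "(\<Sum>i\<in>I. X i) \<in> vector_fields M"
  using assms(2)
  by (induction I rule: infinite_finite_induct) (auto intro!: vector_field_add vector_field_zero assms(1))

lemma sum_fun_at: "(\<Sum>i\<in>I. X i) x = (\<Sum>i\<in>I. X i x)"
  by (induction I rule: infinite_finite_induct) auto

lemma connection_in:
  "linear_connection M D \<Longrightarrow> X \<in> vector_fields M \<Longrightarrow> Y \<in> vector_fields M \<Longrightarrow> D X Y \<in> vector_fields M"
  by (simp add: linear_connection_def)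

lemma connection_add_left:
  "linear_connection M D \<Longrightarrow> X \<in> vector_fields M \<Longrightarrow> X' \<in> vector_fields M \<Longrightarrow> Y \<in> vector_fields M \<Longrightarrow>
    D (X + X') Y = D X Y + D X' Y"
  unfolding linear_connection_def by blast

lemma connection_add_right:
  "linear_connection M D \<Longrightarrow> X \<in> vector_fields M \<Longrightarrow> Y \<in> vector_fields M \<Longrightarrow> Y' \<in> vector_fields M \<Longrightarrow>
    D X (Y + Y') = D X Y + D X Y'"
  unfolding linear_connection_def by blast

lemma connection_scale_left:
  "linear_connection M D \<Longrightarrow> smooth_fun M f \<Longrightarrow> X \<in> vector_fields M \<Longrightarrow> Y \<in> vector_fields M \<Longrightarrow>
    D (\<lambda>x. f x *\<^sub>R X x) Y x = f x *\<^sub>R D X Y x"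
proof -
  assume "linear_connection M D" "smooth_fun M f" "X \<in> vector_fields M" "Y \<in> vector_fields M"
  then have "D (\<lambda>x. f x *\<^sub>R X x) Y = (\<lambda>x. f x *\<^sub>R D X Y x)"
    unfolding linear_connection_def by blast
  then show ?thesis by (rule fun_cong)
qed

lemma connection_leibniz:
  "linear_connection M D \<Longrightarrow> smooth_fun M f \<Longrightarrow> X \<in> vector_fields M \<Longrightarrow> Y \<in> vector_fields M \<Longrightarrow>
    D X (\<lambda>x. f x *\<^sub>R Y x) x = dir_deriv M f x (X x) *\<^sub>R Y x + f x *\<^sub>R D X Y x"
proof -
  assume "linear_connection M D" "smooth_fun M f" "X \<in> vector_fields M" "Y \<in> vector_fields M"
  then have "D X (\<lambda>x. f x *\<^sub>R Y x) = (\<lambda>x. dir_deriv M f x (X x) *\<^sub>R Y x + f x *\<^sub>R D X Y x)"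
    unfolding linear_connection_def by blast
  then show ?thesis by (rule fun_cong)
qed

lemma connection_zero:
  assumes "smooth_atlas M" "linear_connection M D" "Z \<in> vector_fields M"
  shows "D 0 Z = 0" "D Z 0 = 0"
proof -
  have "D (0 + 0) Z = D 0 Z + D 0 Z" "D Z (0 + 0) = D Z 0 + D Z 0"
    using assms vector_field_zero connection_add_left connection_add_right by metis+
  then show "D 0 Z = 0" "D Z 0 = 0" by auto
qed

lemma connection_sum:
  assumes "smooth_atlas M" "linear_connection M D" "Z \<in> vector_fields M" "finite I"
    "\<And>i. i \<in> I \<Longrightarrow> X i \<in> vector_fields M"
  shows "D (\<Sum>i\<in>I. X i) Z = (\<Sum>i\<in>I. D (X i) Z)" "D Z (\<Sum>i\<in>I. X i) = (\<Sum>i\<in>I. D Z (X i))"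
  using assms(4,5)
proof (induction I rule: finite_induct)
  case empty
  { case 1 show ?case by (simp only: sum.empty connection_zero[OF assms(1-3)]) }
  { case 2 show ?case by (simp only: sum.empty connection_zero[OF assms(1-3)]) }
next
  case (insert i I)
  { case 1
    have "D (X i + (\<Sum>i\<in>I. X i)) Z = D (X i) Z + D (\<Sum>i\<in>I. X i) Z"
      using 1 by (intro connection_add_left[OF assms(2)] vector_field_sum[OF assms(1)] assms(3)) auto
    then show ?case using insert 1 by (simp only: sum.insert[OF insert(1,2)]) auto }
  { case 2
    have "D Z (X i + (\<Sum>i\<in>I. X i)) = D Z (X i) + D Z (\<Sum>i\<in>I. X i)"
      using 2 by (intro connection_add_right[OF assms(2)] vector_field_sum[OF assms(1)] assms(3)) auto
    then show ?case using insert 2 by (simp only: sum.insert[OF insert(1,2)]) auto }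
qed

lemma openin_in_chart:
  assumes "smooth_atlas M" "openin (manifold_topology M) W" "x \<in> W"
  obtains c where "c \<in> charts_at M x"
proof -
  have "W \<subseteq> carrier_of M" using assms(1,2) by (simp add: openin_manifold_topology)
  then show thesis using that[OF some_chart_in[of x M]] assms(3) by auto
qed

lemma open_chart_image:
  assumes M: "smooth_atlas M" and c: "c \<in> M" and W: "openin (manifold_topology M) W" "W \<subseteq> fst c"
  shows "open (snd c ` W)"
  using assms openin_manifold_topology by (metis inf.absorb1)

lemma chart_image_in: "smooth_atlas M \<Longrightarrow> c \<in> M \<Longrightarrow> W \<subseteq> fst c \<Longrightarrow> p \<in> snd c ` W \<Longrightarrow> chart_inv c p \<in> W"
  by (metis chart_inv_in atlas_inj)

lemma frechet_derivative_local:
  assumes M: "smooth_atlas M" and c: "c \<in> charts_at M x"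
    and W: "openin (manifold_topology M) W" "x \<in> W" "W \<subseteq> fst c"
    and g: "(g has_derivative g') (at (snd c x))" and eq: "\<And>y. y \<in> W \<Longrightarrow> f y = g (snd c y)"
  shows "((\<lambda>p. f (chart_inv c p)) has_derivative g') (at (snd c x))"
proof (rule has_derivative_transform_within_open[OF g])
  note cM = charts_atD[OF c]
  show "open (snd c ` W)" by (rule open_chart_image[OF M cM(1) W(1,3)])
  show "snd c x \<in> snd c ` W" using W(2) by simp
  fix p assume p: "p \<in> snd c ` W"
  then have "snd c (chart_inv c p) = p" using W(3) by (blast intro: chart_chart_inv)
  then show "g p = f (chart_inv c p)" using eq[OF chart_image_in[OF M cM(1) W(3) p]] by simp
qed

text \<open>
  If \<open>Y\<close> and \<open>Y'\<close> agree near \<open>x\<close>, then \<open>f Y = f Y'\<close> everywhere for a bump function \<open>f\<close>, and the Leibniz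
  rule at \<open>x\<close>, where \<open>f = 1\<close>, removes the factor.
\<close>

lemma connection_local_right:
  assumes M: "smooth_manifold M" and D: "linear_connection M D"
    and X: "X \<in> vector_fields M" and Y: "Y \<in> vector_fields M" "Y' \<in> vector_fields M"
    and W: "openin (manifold_topology M) W" "x \<in> W" and eq: "\<And>y. y \<in> W \<Longrightarrow> Y y = Y' y"
  shows "D X Y x = D X Y' x"
proof -
  note A = smooth_manifold_atlas[OF M]
  obtain c where c: "c \<in> charts_at M x" using openin_in_chart[OF A W] .
  obtain f V where f: "smooth_fun M f" "\<And>y. y \<notin> W \<Longrightarrow> f y = 0" "x \<in> V" "\<And>y. y \<in> V \<Longrightarrow> f y = 1"
    using smooth_fun_extension[OF M c smooth_on_const W] by metis
  have "(\<lambda>y. f y *\<^sub>R Y y) = (\<lambda>y. f y *\<^sub>R Y' y)"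
  proof
    fix y show "f y *\<^sub>R Y y = f y *\<^sub>R Y' y" using f(2) eq by (cases "y \<in> W") auto
  qed
  then have "dir_deriv M f x (X x) *\<^sub>R Y x + f x *\<^sub>R D X Y x =
      dir_deriv M f x (X x) *\<^sub>R Y' x + f x *\<^sub>R D X Y' x"
    by (simp only: connection_leibniz[OF D f(1) X Y(1), symmetric]
        connection_leibniz[OF D f(1) X Y(2), symmetric])
  then show ?thesis using f(3,4) eq[OF W(2)] by simp
qed

lemma connection_local_left:
  assumes M: "smooth_manifold M" and D: "linear_connection M D"
    and X: "X \<in> vector_fields M" "X' \<in> vector_fields M" and Y: "Y \<in> vector_fields M"
    and W: "openin (manifold_topology M) W" "x \<in> W" and eq: "\<And>y. y \<in> W \<Longrightarrow> X y = X' y"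
  shows "D X Y x = D X' Y x"
proof -
  note A = smooth_manifold_atlas[OF M]
  obtain c where c: "c \<in> charts_at M x" using openin_in_chart[OF A W] .
  obtain f V where f: "smooth_fun M f" "\<And>y. y \<notin> W \<Longrightarrow> f y = 0" "x \<in> V" "\<And>y. y \<in> V \<Longrightarrow> f y = 1"
    using smooth_fun_extension[OF M c smooth_on_const W] by metis
  have "(\<lambda>y. f y *\<^sub>R X y) = (\<lambda>y. f y *\<^sub>R X' y)"
  proof
    fix y show "f y *\<^sub>R X y = f y *\<^sub>R X' y" using f(2) eq by (cases "y \<in> W") auto
  qed
  then have "f x *\<^sub>R D X Y x = f x *\<^sub>R D X' Y x"
    by (simp only: connection_scale_left[OF D f(1) X(1) Y, symmetric]
        connection_scale_left[OF D f(1) X(2) Y, symmetric])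
  then show ?thesis using f(3,4) by simp
qed

lemma local_frame_expansion:
  fixes M :: "('a, 'e::euclidean_space) atlas"
  assumes M: "smooth_manifold M" and c: "c \<in> charts_at M x" and Y: "Y \<in> vector_fields M"
  shows "\<exists>f V. (\<forall>b\<in>Basis. smooth_fun M (f b)) \<and>
      openin (manifold_topology M) V \<and> x \<in> V \<and> V \<subseteq> fst c \<and>
      (\<forall>b\<in>Basis. \<forall>y\<in>V. f b y = Y y c \<bullet> b) \<and>
      (\<forall>y\<in>V. Y y = (\<Sum>b\<in>Basis. f b y *\<^sub>R coord_field M x c b y))"
proof -
  note A = smooth_manifold_atlas[OF M]
  note cM = charts_atD[OF c]
  have T: "openin (manifold_topology M) (carrier_of M)" "x \<in> carrier_of M"
    using topspace_manifold_topology[OF A] charts_at_carrier[OF c] by (metis openin_topspace)+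
  have "\<exists>g V. smooth_fun M g \<and> openin (manifold_topology M) V \<and> x \<in> V \<and> V \<subseteq> fst c \<and>
      (\<forall>y\<in>V. g y = Y y c \<bullet> b) \<and> (\<forall>y\<in>V. coord_field M x c b y = coord_vec M y c b)"
    if "b \<in> Basis" for b
  proof -
    have sm: "smooth_on (snd c ` fst c) (\<lambda>p. Y (chart_inv c p) c \<bullet> b)"
      by (intro smooth_on_inner_const atlas_open[OF A cM(1)] vector_fieldD(2)[OF Y cM(1)])
    obtain g V where g: "smooth_fun M g" "openin (manifold_topology M) V" "x \<in> V"
        "V \<subseteq> carrier_of M \<inter> fst c" "\<And>y. y \<in> V \<Longrightarrow> g y = Y (chart_inv c (snd c y)) c \<bullet> b"
      using smooth_fun_extension[OF M c sm T] by metis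
    obtain W where W: "openin (manifold_topology M) W" "x \<in> W" "W \<subseteq> fst c"
      "\<forall>y\<in>W. coord_field M x c b y = coord_vec M y c b"
      using coord_field_props(2)[OF M c] by metis
    show ?thesis
      using g W chart_inv_chart[OF A cM(1)]
      by (intro exI[of _ g] exI[of _ "V \<inter> W"]) (auto intro: openin_Int)
  qed
  then obtain f V where fV: "\<And>b. b \<in> Basis \<Longrightarrow> smooth_fun M (f b) \<and> openin (manifold_topology M) (V b) \<and>
      x \<in> V b \<and> V b \<subseteq> fst c \<and> (\<forall>y\<in>V b. f b y = Y y c \<bullet> b) \<and>
      (\<forall>y\<in>V b. coord_field M x c b y = coord_vec M y c b)"
    by metis
  let ?V = "\<Inter>b\<in>Basis. V b"
  show ?thesis
  proof (intro exI[of _ f] exI[of _ ?V] conjI ballI)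
    show "openin (manifold_topology M) ?V"
      using fV by (intro openin_INT2) (auto simp: nonempty_Basis)
    show sub: "?V \<subseteq> fst c" using fV nonempty_Basis by fastforce
    show "Y y = (\<Sum>b\<in>Basis. f b y *\<^sub>R coord_field M x c b y)" if y: "y \<in> ?V" for y
    proof -
      have cy: "c \<in> charts_at M y" using sub y cM by (auto simp: charts_at_def)
      have "Y y = coord_vec M y c (\<Sum>b\<in>Basis. (Y y c \<bullet> b) *\<^sub>R b)"
        using coord_vec_eq[OF vector_fieldD(1)[OF Y] cy] by (simp add: euclidean_representation)
      also have "\<dots> = (\<Sum>b\<in>Basis. (Y y c \<bullet> b) *\<^sub>R coord_vec M y c b)"
        by (simp add: linear_sum[OF coord_vec_linear[OF A cy]] linear_cmul[OF coord_vec_linear[OF A cy]])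
      also have "\<dots> = (\<Sum>b\<in>Basis. f b y *\<^sub>R coord_field M x c b y)"
        using fV y by (intro sum.cong) auto
      finally show ?thesis .
    qed
  qed (use fV in auto)
qed

text \<open>
  Near \<open>x\<close> the field \<open>X\<close> is a combination of coordinate fields with functions as coefficients, and
  only their values at \<open>x\<close> enter.
\<close>

lemma connection_tensorial:
  assumes M: "smooth_manifold M" and D: "linear_connection M D"
    and X: "X \<in> vector_fields M" "X' \<in> vector_fields M" and Y: "Y \<in> vector_fields M"
    and eq: "X x = X' x"
  shows "D X Y x = D X' Y x"
proof (cases "x \<in> carrier_of M")
  case True
  note A = smooth_manifold_atlas[OF M]
  define c where "c = some_chart M x"
  have c: "c \<in> charts_at M x" using some_chart_in[OF True] by (simp add: c_def)
  have "D Z Y x = (\<Sum>b\<in>Basis. (Z x c \<bullet> b) *\<^sub>R D (coord_field M x c b) Y x)"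
    if Z: "Z \<in> vector_fields M" for Z
  proof -
    obtain f V where f': "(\<forall>b\<in>Basis. smooth_fun M (f b)) \<and>
      openin (manifold_topology M) V \<and> x \<in> V \<and> V \<subseteq> fst c \<and>
      (\<forall>b\<in>Basis. \<forall>y\<in>V. f b y = Z y c \<bullet> b) \<and>
      (\<forall>y\<in>V. Z y = (\<Sum>b\<in>Basis. f b y *\<^sub>R coord_field M x c b y))"
      using local_frame_expansion[OF M c Z] by (elim exE) (rule that)
    have f: "\<And>b. b \<in> Basis \<Longrightarrow> smooth_fun M (f b)"
      "openin (manifold_topology M) V" "x \<in> V" "V \<subseteq> fst c"
      "\<And>b y. b \<in> Basis \<Longrightarrow> y \<in> V \<Longrightarrow> f b y = Z y c \<bullet> b"
      "\<And>y. y \<in> V \<Longrightarrow> Z y = (\<Sum>b\<in>Basis. f b y *\<^sub>R coord_field M x c b y)"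
      using f' by blast+
    have S: "(\<lambda>y. f b y *\<^sub>R coord_field M x c b y) \<in> vector_fields M" if "b \<in> Basis" for b
      by (intro vector_field_scale A f(1) that coord_field_props(1)[OF M c])
    have "D Z Y x = D (\<Sum>b\<in>Basis. (\<lambda>y. f b y *\<^sub>R coord_field M x c b y)) Y x"
      by (rule connection_local_left[OF M D Z _ Y f(2,3)])
        (auto intro!: vector_field_sum[OF A] S simp: f(6) sum_fun_at)
    also have "\<dots> = (\<Sum>b\<in>Basis. (Z x c \<bullet> b) *\<^sub>R D (coord_field M x c b) Y x)"
      by (subst connection_sum(1)[OF A D Y])
        (auto intro!: S sum.cong simp: sum_fun_at connection_scale_left[OF D f(1) coord_field_props(1)[OF M c] Y]
          f(5)[OF _ f(3)])
    finally show ?thesis .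
  qed
  then show ?thesis using X eq by simp
next
  case False
  show ?thesis
    by (simp only: tangent_space_outside[OF False vector_fieldD(1)[OF connection_in[OF D X(1) Y]]]
        tangent_space_outside[OF False vector_fieldD(1)[OF connection_in[OF D X(2) Y]]])
qed

lemma cov_deriv_eq:
  assumes M: "smooth_manifold M" and D: "linear_connection M D"
    and X: "X \<in> vector_fields M" and Y: "Y \<in> vector_fields M" and eq: "X x = v"
  shows "cov_deriv M D x v Y = D X Y x"
proof -
  have "\<exists>Z. Z \<in> vector_fields M \<and> Z x = v" using X eq by blast
  from someI_ex[OF this] show ?thesis
    unfolding cov_deriv_def using connection_tensorial[OF M D _ X Y] eq by blast
qed

lemma cov_deriv_tangent:
  assumes M: "smooth_manifold M" and D: "linear_connection M D"
    and Y: "Y \<in> vector_fields M" and v: "v \<in> tangent_space M x"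
  shows "cov_deriv M D x v Y \<in> tangent_space M x"
proof -
  obtain X where X: "X \<in> vector_fields M" "X x = v" using vector_field_through[OF M v] by metis
  show ?thesis
    using cov_deriv_eq[OF M D X(1) Y X(2)] vector_fieldD(1)[OF connection_in[OF D X(1) Y]] by simp
qed

text \<open>
  The bilinear map \<open>\<Gamma>\<close> in the coordinate expression \<open>\<nabla>\<^sub>X Y = dY(X) + \<Gamma>(X, Y)\<close>.
\<close>

definition christoffel ::
  "('a, 'e::euclidean_space) atlas \<Rightarrow> ('a, 'e) connection \<Rightarrow> 'a \<Rightarrow> ('a, 'e) chart \<Rightarrow> 'e \<Rightarrow> 'e \<Rightarrow> 'e"
  where "christoffel M D x c v u =
    (\<Sum>b\<in>Basis. (u \<bullet> b) *\<^sub>R cov_deriv M D x (coord_vec M x c v) (coord_field M x c b) c)"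

lemma christoffel_linear_right: "linear (christoffel M D x c v)"
  by (rule linearI)
    (simp_all add: christoffel_def inner_add_left scaleR_add_left sum.distrib scaleR_sum_right)

lemma connection_in_coordinates:
  assumes M: "smooth_manifold M" and D: "linear_connection M D" and c: "c \<in> charts_at M x"
    and X: "X \<in> vector_fields M" and Y: "Y \<in> vector_fields M"
  shows "D X Y x c =
    frechet_derivative (\<lambda>p. Y (chart_inv c p) c) (at (snd c x)) (X x c) + christoffel M D x c (X x c) (Y x c)"
proof -
  note A = smooth_manifold_atlas[OF M]
  note cM = charts_atD[OF c]
  note E = coord_field_props(1)[OF M c]
  obtain f V where f': "(\<forall>b\<in>Basis. smooth_fun M (f b)) \<and>
      openin (manifold_topology M) V \<and> x \<in> V \<and> V \<subseteq> fst c \<and>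
      (\<forall>b\<in>Basis. \<forall>y\<in>V. f b y = Y y c \<bullet> b) \<and>
      (\<forall>y\<in>V. Y y = (\<Sum>b\<in>Basis. f b y *\<^sub>R coord_field M x c b y))"
    using local_frame_expansion[OF M c Y] by (elim exE) (rule that)
  have f: "\<And>b. b \<in> Basis \<Longrightarrow> smooth_fun M (f b)"
    "openin (manifold_topology M) V" "x \<in> V" "V \<subseteq> fst c"
    "\<And>b y. b \<in> Basis \<Longrightarrow> y \<in> V \<Longrightarrow> f b y = Y y c \<bullet> b"
    "\<And>y. y \<in> V \<Longrightarrow> Y y = (\<Sum>b\<in>Basis. f b y *\<^sub>R coord_field M x c b y)"
    using f' by blast+
  have S: "(\<lambda>y. f b y *\<^sub>R coord_field M x c b y) \<in> vector_fields M" if "b \<in> Basis" for b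
    by (intro vector_field_scale A f(1) that E)
  let ?Y = "\<lambda>p. Y (chart_inv c p) c"
  have dY: "(?Y has_derivative frechet_derivative ?Y (at (snd c x))) (at (snd c x))"
    by (rule smooth_on_has_derivative[OF vector_fieldD(2)[OF Y cM(1)]]) (use cM in auto)
  have df: "dir_deriv M (f b) x (X x) = frechet_derivative ?Y (at (snd c x)) (X x c) \<bullet> b"
    if b: "b \<in> Basis" for b
  proof (rule dir_deriv_eq[OF A c vector_fieldD(1)[OF X]])
    show "((\<lambda>p. f b (chart_inv c p)) has_derivative
        (\<lambda>v. frechet_derivative ?Y (at (snd c x)) v \<bullet> b)) (at (snd c x))"
      by (rule frechet_derivative_local[OF A c f(2,3,4) has_derivative_inner_left[OF dY]])
        (use f(4,5) b cM chart_inv_chart[OF A cM(1)] in auto)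
  qed
  have Ex: "coord_field M x c b x c = b" for b
    using coord_field_props(2)[OF M c] coord_vec_self[OF A c] by metis
  have X': "cov_deriv M D x (coord_vec M x c (X x c)) Z = D X Z x" if "Z \<in> vector_fields M" for Z
    using cov_deriv_eq[OF M D X that] coord_vec_eq[OF vector_fieldD(1)[OF X] c] by metis
  have "D X Y x = D X (\<Sum>b\<in>Basis. (\<lambda>y. f b y *\<^sub>R coord_field M x c b y)) x"
    by (rule connection_local_right[OF M D X Y _ f(2,3)])
      (auto intro!: vector_field_sum[OF A] S simp: f(6) sum_fun_at)
  also have "\<dots> = (\<Sum>b\<in>Basis. D X (\<lambda>y. f b y *\<^sub>R coord_field M x c b y) x)"
    by (subst connection_sum(2)[OF A D X]) (auto intro!: S simp: sum_fun_at)
  also have "\<dots> = (\<Sum>b\<in>Basis. dir_deriv M (f b) x (X x) *\<^sub>R coord_field M x c b x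
      + f b x *\<^sub>R D X (coord_field M x c b) x)"
    by (intro sum.cong refl connection_leibniz[OF D f(1) X E])
  finally have "D X Y x c = (\<Sum>b\<in>Basis. (frechet_derivative ?Y (at (snd c x)) (X x c) \<bullet> b) *\<^sub>R b
      + (Y x c \<bullet> b) *\<^sub>R D X (coord_field M x c b) x c)"
    by (simp add: sum_fun_at scaleR_fun_def df f(5)[OF _ f(3)] Ex)
  then show ?thesis
    by (simp add: sum.distrib euclidean_representation christoffel_def X'[OF E])
qed

lemma coord_field_local:
  assumes M: "smooth_manifold M" and c: "c \<in> charts_at M x"
  shows "coord_field M x c u x c = u"
    "((\<lambda>p. coord_field M x c u (chart_inv c p) c) has_derivative (\<lambda>v. 0)) (at (snd c x))"
proof -
  note A = smooth_manifold_atlas[OF M]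
  obtain W where W: "openin (manifold_topology M) W" "x \<in> W" "W \<subseteq> fst c"
      "\<forall>y\<in>W. coord_field M x c u y = coord_vec M y c u"
    using coord_field_props(2)[OF M c] by metis
  have eq: "coord_field M x c u y c = u" if "y \<in> W" for y
    using W(3,4) that coord_vec_self[OF A] charts_atD(1)[OF c] by (auto simp: charts_at_def subset_iff)
  show "coord_field M x c u x c = u" using eq W(2) .
  show "((\<lambda>p. coord_field M x c u (chart_inv c p) c) has_derivative (\<lambda>v. 0)) (at (snd c x))"
    using frechet_derivative_local[OF A c W(1-3) has_derivative_const, of "\<lambda>y. coord_field M x c u y c" u] eq
    by simp
qed

lemma connection_coord_field:
  assumes M: "smooth_manifold M" and D: "linear_connection M D" and c: "c \<in> charts_at M x"
    and X: "X \<in> vector_fields M"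
  shows "D X (coord_field M x c u) x c = christoffel M D x c (X x c) u"
  using connection_in_coordinates[OF M D c X coord_field_props(1)[OF M c], of u]
  by (simp add: coord_field_local(1)[OF M c] frechet_derivative_eq[OF coord_field_local(2)[OF M c]])

lemma christoffel_symmetric:
  assumes M: "smooth_manifold M" and D: "linear_connection M D" "torsion_free M D"
    and c: "c \<in> charts_at M x"
  shows "christoffel M D x c u v = christoffel M D x c v u"
proof -
  note E = coord_field_props(1)[OF M c]
  let ?X = "coord_field M x c u" and ?Y = "coord_field M x c v"
  have "D ?X ?Y - D ?Y ?X = lie_bracket M ?X ?Y" using D(2) E by (simp add: torsion_free_def)
  then have "D ?X ?Y x c - D ?Y ?X x c = lie_bracket M ?X ?Y x c"
    by (simp only: minus_apply flip: \<open>D ?X ?Y - D ?Y ?X = lie_bracket M ?X ?Y\<close>)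
  also have "\<dots> = 0"
    using c by (simp add: lie_bracket_def frechet_derivative_eq[OF coord_field_local(2)[OF M c]])
  finally show ?thesis
    by (simp add: connection_coord_field[OF M D(1) c E] coord_field_local(1)[OF M c])
qed

definition local_form ::
  "('a, 'e::euclidean_space) atlas \<Rightarrow> ('a, 'e) two_form \<Rightarrow> ('a, 'e) chart \<Rightarrow> 'e \<Rightarrow> 'e \<Rightarrow> 'e \<Rightarrow> real"
  where "local_form M \<omega> c p u v =
    \<omega> (chart_inv c p) (coord_vec M (chart_inv c p) c u) (coord_vec M (chart_inv c p) c v)"

text \<open>
  Differentiate \<open>\<omega>(Y, Z)\<close> for the coordinate fields \<open>Y\<close> and \<open>Z\<close> in directions \<open>u\<close> and \<open>v\<close>, for which
  the covariant derivative reduces to \<open>\<Gamma>\<close>.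
\<close>

lemma christoffel_compatible:
  assumes M: "smooth_manifold M" and D: "symplectic_connection M \<omega> D" and \<omega>: "smooth_two_form M \<omega>"
    and c: "c \<in> charts_at M x"
  shows "((\<lambda>p. local_form M \<omega> c p u v) has_derivative
    (\<lambda>w. local_form M \<omega> c (snd c x) (christoffel M D x c w u) v +
         local_form M \<omega> c (snd c x) u (christoffel M D x c w v))) (at (snd c x))"
proof -
  note A = smooth_manifold_atlas[OF M]
  note cM = charts_atD[OF c]
  note E = coord_field_props(1)[OF M c]
  have L: "linear_connection M D" using D by (simp add: symplectic_connection_def)
  have ci: "chart_inv c (snd c x) = x" by (rule chart_inv_chart[OF A cM])
  let ?Y = "coord_field M x c u" and ?Z = "coord_field M x c v"
  have sm: "smooth_on (snd c ` fst c) (\<lambda>p. local_form M \<omega> c p u v)"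
    using \<omega> cM by (auto simp: smooth_two_form_def local_form_def)
  have d: "((\<lambda>p. local_form M \<omega> c p u v) has_derivative
      frechet_derivative (\<lambda>p. local_form M \<omega> c p u v) (at (snd c x))) (at (snd c x))"
    by (rule smooth_on_has_derivative[OF sm]) (use cM in auto)
  obtain W1 where W1: "openin (manifold_topology M) W1" "x \<in> W1" "W1 \<subseteq> fst c"
      "\<forall>y\<in>W1. ?Y y = coord_vec M y c u"
    using coord_field_props(2)[OF M c] by metis
  obtain W2 where W2: "openin (manifold_topology M) W2" "x \<in> W2" "W2 \<subseteq> fst c"
      "\<forall>y\<in>W2. ?Z y = coord_vec M y c v"
    using coord_field_props(2)[OF M c] by metis
  have d2: "((\<lambda>p. \<omega> (chart_inv c p) (?Y (chart_inv c p)) (?Z (chart_inv c p))) has_derivative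
      frechet_derivative (\<lambda>p. local_form M \<omega> c p u v) (at (snd c x))) (at (snd c x))"
  proof (rule frechet_derivative_local[OF A c openin_Int[OF W1(1) W2(1)] _ _ d])
    show "\<omega> y (?Y y) (?Z y) = local_form M \<omega> c (snd c y) u v" if "y \<in> W1 \<inter> W2" for y
      using that W1 W2 by (auto simp: local_form_def chart_inv_chart[OF A cM(1)])
  qed (use W1 W2 in auto)
  have "frechet_derivative (\<lambda>p. local_form M \<omega> c p u v) (at (snd c x)) w =
      local_form M \<omega> c (snd c x) (christoffel M D x c w u) v +
      local_form M \<omega> c (snd c x) u (christoffel M D x c w v)" for w
  proof -
    obtain X where X: "X \<in> vector_fields M" "X x = coord_vec M x c w"
      using vector_field_through[OF M coord_vec_tangent[OF A c]] by metis
    have Xc: "X x c = w" using X(2) coord_vec_self[OF A c] by simp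
    have "dir_deriv M (\<lambda>y. \<omega> y (?Y y) (?Z y)) x (X x) =
        frechet_derivative (\<lambda>p. local_form M \<omega> c p u v) (at (snd c x)) (X x c)"
      by (rule dir_deriv_eq[OF A c vector_fieldD(1)[OF X(1)] d2])
    moreover have "dir_deriv M (\<lambda>y. \<omega> y (?Y y) (?Z y)) x (X x) =
        \<omega> x (D X ?Y x) (?Z x) + \<omega> x (?Y x) (D X ?Z x)"
      using D X(1) E charts_at_carrier[OF c] by (simp add: symplectic_connection_def)
    moreover have "D X (coord_field M x c t) x = coord_vec M x c (christoffel M D x c w t)" for t
      using connection_coord_field[OF M L c X(1)] Xc
        coord_vec_eq[OF vector_fieldD(1)[OF connection_in[OF L X(1) E]] c] by metis
    ultimately show ?thesis
      using W1(2,4) W2(2,4) Xc by (simp add: local_form_def ci)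
  qed
  then show ?thesis using d by (metis (no_types, lifting) ext)
qed

section \<open>The endomorphism bundle\<close>

lemma bounded_bilinear_matrix_mult:
  "bounded_bilinear ((**) :: real^'n^'m \<Rightarrow> real^'p^'n \<Rightarrow> real^'p^'m)"
proof -
  have "bilinear ((**) :: real^'n^'m \<Rightarrow> real^'p^'n \<Rightarrow> real^'p^'m)"
    unfolding bilinear_def
    by (intro conjI allI linearI)
      (simp_all add: matrix_matrix_mult_def vec_eq_iff sum.distrib sum_distrib_left algebra_simps)
  then show ?thesis by (simp add: bilinear_conv_bounded_bilinear)
qed

lemma bounded_bilinear_matrix_vector_mult:
  "bounded_bilinear ((*v) :: real^'n^'m \<Rightarrow> real^'n \<Rightarrow> real^'m)"
proof -
  have "bilinear ((*v) :: real^'n^'m \<Rightarrow> real^'n \<Rightarrow> real^'m)"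
    unfolding bilinear_def
    by (intro conjI allI linearI)
      (simp_all add: matrix_vector_mult_def vec_eq_iff sum.distrib sum_distrib_left algebra_simps)
  then show ?thesis by (simp add: bilinear_conv_bounded_bilinear)
qed

lemma has_derivative_compose_fst:
  assumes "(g has_derivative g') (at p)"
  shows "((\<lambda>q. g (fst q)) has_derivative (\<lambda>h. g' (fst h))) (at (p, A))"
proof -
  have "(fst has_derivative fst) (at (p, A))"
    by (rule bounded_linear.has_derivative[OF bounded_linear_fst has_derivative_ident])
  from has_derivative_compose[OF this, of g g'] assms show ?thesis by simp
qed

lemma linear_axis: "linear (axis i :: 'b::euclidean_space \<Rightarrow> 'b^'m)"
  by (intro linearI) (simp_all add: vec_eq_iff axis_def)

lemma smooth_on_vec:
  fixes f :: "'a::euclidean_space \<Rightarrow> 'b::euclidean_space^'m"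
  assumes "open S" "\<And>i. smooth_on S (\<lambda>p. f p $ i)"
  shows "smooth_on S f"
proof -
  have "smooth_on S (\<lambda>p. \<Sum>i\<in>UNIV. axis i (f p $ i))"
    by (intro smooth_on_sum assms smooth_on_linear[OF _ linear_axis])
  moreover have "(\<Sum>i\<in>UNIV. axis i (v $ i)) = v" for v :: "'b^'m"
    by (simp add: vec_eq_iff axis_def sum.delta)
  ultimately show ?thesis by simp
qed

lemma smooth_on_matrix:
  fixes L :: "'a::euclidean_space \<Rightarrow> real^'n \<Rightarrow> real^'m"
  assumes "open S" "\<And>u. smooth_on S (\<lambda>p. L p u)"
  shows "smooth_on S (\<lambda>p. matrix (L p))"
proof (intro smooth_on_vec assms(1))
  fix i j
  have "bounded_linear (\<lambda>v::real^'m. v $ i)" by (rule bounded_linear_vec_nth)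
  from smooth_on_bounded_linear[OF assms(1) this assms(2)[of "axis j 1"]]
  show "smooth_on S (\<lambda>p. matrix (L p) $ i $ j)" by (simp add: matrix_def)
qed

text \<open>
  The coordinate expression of the lift of a diffeomorphism \<open>f\<close> with inverse \<open>g\<close> to endomorphisms.
\<close>

definition conjugation_lift ::
  "(real^'m \<Rightarrow> real^'m) \<Rightarrow> (real^'m \<Rightarrow> real^'m) \<Rightarrow> (real^'m) \<times> (real^'m^'m) \<Rightarrow> (real^'m) \<times> (real^'m^'m)"
  where "conjugation_lift f g q = (f (fst q), matrix (\<lambda>u.
    frechet_derivative f (at (fst q)) (snd q *v frechet_derivative g (at (f (fst q))) u)))"

lemma smooth_on_conjugation_lift:
  assumes S: "open S" and T: "open T" and f: "smooth_on S f" "f ` S \<subseteq> T" and g: "smooth_on T g"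
  shows "smooth_on (S \<times> UNIV) (conjugation_lift f g)"
proof -
  let ?SU = "S \<times> (UNIV :: (real^'a^'a) set)"
  have o: "open ?SU" using S by (simp add: open_Times)
  have p1: "smooth_on ?SU (\<lambda>q. fst q)" "smooth_on ?SU (\<lambda>q. snd q)"
    by (auto intro!: smooth_on_bounded_linear[OF o bounded_linear_fst smooth_on_ident[OF o]]
        smooth_on_bounded_linear[OF o bounded_linear_snd smooth_on_ident[OF o]])
  have fq: "smooth_on ?SU (\<lambda>q. f (fst q))"
    by (rule smooth_on_compose[OF o S f(1) p1(1)]) auto
  have "smooth_on ?SU (\<lambda>q. frechet_derivative f (at (fst q))
      (snd q *v frechet_derivative g (at (f (fst q))) u))" for u
  proof (rule smooth_on_frechet_apply[OF o S f(1) p1(1)])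
    show "smooth_on ?SU (\<lambda>q. snd q *v frechet_derivative g (at (f (fst q))) u)"
      by (intro smooth_on_bilinear[OF o bounded_bilinear_matrix_vector_mult] p1
          smooth_on_frechet_apply[OF o T g fq] smooth_on_const) (use f(2) in auto)
  qed auto
  then have m: "smooth_on ?SU (\<lambda>q. matrix (\<lambda>u. frechet_derivative f (at (fst q))
      (snd q *v frechet_derivative g (at (f (fst q))) u)))"
    by (rule smooth_on_matrix[OF o])
  have "smooth_on ?SU (\<lambda>q. (f (fst q), matrix (\<lambda>u. frechet_derivative f (at (fst q))
      (snd q *v frechet_derivative g (at (f (fst q))) u))))"
    by (rule smooth_on_Pair[OF o fq m])
  then show ?thesis by (simp add: conjugation_lift_def[abs_def])
qed

definition mat_of ::
  "('a, real^'m) atlas \<Rightarrow> 'a \<Rightarrow> ('a, real^'m) chart \<Rightarrow> (('a, real^'m) tvec \<Rightarrow> ('a, real^'m) tvec) \<Rightarrow> real^'m^'m"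
  where "mat_of M x c j = matrix (\<lambda>u. j (coord_vec M x c u) c)"

text \<open>
  Extended by 0 outside the tangent space, like all elements of \<^const>\<open>End_at\<close>.
\<close>

definition end_of ::
  "('a, real^'m) atlas \<Rightarrow> 'a \<Rightarrow> ('a, real^'m) chart \<Rightarrow> real^'m^'m \<Rightarrow> ('a, real^'m) tvec \<Rightarrow> ('a, real^'m) tvec"
  where "end_of M x c A v = (if v \<in> tangent_space M x then coord_vec M x c (A *v v c) else 0)"

lemma End_atD:
  assumes "j \<in> End_at M x"
  shows "v \<in> tangent_space M x \<Longrightarrow> j v \<in> tangent_space M x"
    "v \<in> tangent_space M x \<Longrightarrow> w \<in> tangent_space M x \<Longrightarrow> j (v + w) = j v + j w"
    "v \<in> tangent_space M x \<Longrightarrow> j (a *\<^sub>R v) = a *\<^sub>R j v"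
    "v \<notin> tangent_space M x \<Longrightarrow> j v = 0"
  using assms unfolding End_at_def by blast+

lemma end_of_in:
  assumes M: "smooth_atlas M" and c: "c \<in> charts_at M x"
  shows "end_of M x c A \<in> End_at M x"
  unfolding End_at_def
proof (intro CollectI conjI allI ballI impI)
  note l = coord_vec_linear[OF M c]
  show "end_of M x c A v \<in> tangent_space M x" if "v \<in> tangent_space M x" for v
    using coord_vec_tangent[OF M c] that by (simp add: end_of_def)
  show "end_of M x c A (v + w) = end_of M x c A v + end_of M x c A w"
    if "v \<in> tangent_space M x" "w \<in> tangent_space M x" for v w
    using that tangent_add[OF M that]
    by (simp only: end_of_def if_True plus_fun_apply[of v w] matrix_vector_right_distrib linear_add[OF l])
  show "end_of M x c A (a *\<^sub>R v) = a *\<^sub>R end_of M x c A v" if "v \<in> tangent_space M x" for a v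
    using that tangent_scale[OF M that, of a]
    by (simp only: end_of_def if_True scaleR_fun_def[of a v] matrix_vector_mult_scaleR linear_cmul[OF l])
  show "end_of M x c A v = 0" if "v \<notin> tangent_space M x" for v using that by (simp add: end_of_def)
qed

lemma mat_of_end_of:
  assumes M: "smooth_atlas M" and c: "c \<in> charts_at M x"
  shows "mat_of M x c (end_of M x c A) = A"
  by (simp add: mat_of_def end_of_def coord_vec_tangent[OF M c] coord_vec_self[OF M c])

lemma End_at_linear:
  assumes M: "smooth_atlas M" and c: "c \<in> charts_at M x" and j: "j \<in> End_at M x"
  shows "linear (\<lambda>u. j (coord_vec M x c u) c)"
proof (rule linearI)
  note l = coord_vec_linear[OF M c] and t = coord_vec_tangent[OF M c]
  show "j (coord_vec M x c (u + v)) c = j (coord_vec M x c u) c + j (coord_vec M x c v) c" for u v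
    unfolding linear_add[OF l] End_atD(2)[OF j t t] by simp
  show "j (coord_vec M x c (r *\<^sub>R u)) c = r *\<^sub>R j (coord_vec M x c u) c" for r u
    unfolding linear_cmul[OF l] End_atD(3)[OF j t] by (simp add: scaleR_fun_def)
qed

lemma mat_of_apply:
  assumes M: "smooth_atlas M" and c: "c \<in> charts_at M x" and j: "j \<in> End_at M x"
    and v: "v \<in> tangent_space M x"
  shows "mat_of M x c j *v v c = j v c"
  using fun_cong[OF matrix_vector_mul(2)[OF End_at_linear[OF M c j]], of "v c"]
  by (simp add: mat_of_def coord_vec_eq[OF v c])

lemma end_of_mat_of:
  assumes M: "smooth_atlas M" and c: "c \<in> charts_at M x" and j: "j \<in> End_at M x"
  shows "end_of M x c (mat_of M x c j) = j"
proof
  fix v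
  show "end_of M x c (mat_of M x c j) v = j v"
    by (cases "v \<in> tangent_space M x")
      (simp_all add: end_of_def mat_of_apply[OF M c j] coord_vec_eq[OF End_atD(1)[OF j] c] End_atD(4)[OF j])
qed

lemma End_chart_simps:
  "fst (End_chart M c) = Sigma (fst c) (End_at M)"
  "snd (End_chart M c) (x, A) = (snd c x, mat_of M x c A)"
  by (simp_all add: End_chart_def mat_of_def)

lemma End_chart_inj:
  assumes M: "smooth_atlas M" and c: "c \<in> M"
  shows "inj_on (snd (End_chart M c)) (fst (End_chart M c))"
proof (rule inj_onI)
  fix z w assume zw: "z \<in> fst (End_chart M c)" "w \<in> fst (End_chart M c)"
    "snd (End_chart M c) z = snd (End_chart M c) w"
  obtain x A y B where z: "z = (x, A)" "w = (y, B)" by (metis surj_pair)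
  have xy: "x \<in> fst c" "y \<in> fst c" "A \<in> End_at M x" "B \<in> End_at M y"
    using zw(1,2) z by (auto simp: End_chart_simps)
  have "snd c x = snd c y" "mat_of M x c A = mat_of M y c B" using zw(3) z by (auto simp: End_chart_simps)
  moreover from this have "x = y" using xy atlas_inj[OF M c] by (auto dest: inj_onD)
  moreover have "c \<in> charts_at M x" using c xy by (simp add: charts_at_def)
  ultimately show "z = w" using z xy end_of_mat_of[OF M] by metis
qed

lemma End_chart_image:
  assumes M: "smooth_atlas M" and c: "c \<in> M" and S: "S \<subseteq> fst c"
  shows "snd (End_chart M c) ` Sigma S (End_at M) = (snd c ` S) \<times> UNIV"
proof (intro set_eqI iffI)
  fix q assume "q \<in> (snd c ` S) \<times> (UNIV :: (real^'b^'b) set)"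
  then obtain x A where x: "x \<in> S" "q = (snd c x, A)" by auto
  have "c \<in> charts_at M x" using c S x by (auto simp: charts_at_def)
  then have "q = snd (End_chart M c) (x, end_of M x c A)" "end_of M x c A \<in> End_at M x"
    using x by (simp_all add: End_chart_simps mat_of_end_of[OF M] end_of_in[OF M])
  then show "q \<in> snd (End_chart M c) ` Sigma S (End_at M)" using x by blast
qed (auto simp: End_chart_simps)

lemma End_chart_inv:
  assumes M: "smooth_atlas M" and c: "c \<in> M" and p: "p \<in> snd c ` fst c"
  shows "chart_inv (End_chart M c) (p, A) = (chart_inv c p, end_of M (chart_inv c p) c A)"
proof -
  have x: "chart_inv c p \<in> fst c" "snd c (chart_inv c p) = p"
    by (rule chart_inv_in[OF p order_refl atlas_inj[OF M c]], rule chart_chart_inv[OF p])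
  then have cx: "c \<in> charts_at M (chart_inv c p)" using c by (simp add: charts_at_def)
  let ?z = "(chart_inv c p, end_of M (chart_inv c p) c A)"
  have "?z \<in> fst (End_chart M c)" "snd (End_chart M c) ?z = (p, A)"
    using x end_of_in[OF M cx] mat_of_end_of[OF M cx] by (simp_all add: End_chart_simps)
  then show ?thesis
    unfolding chart_inv_def[of "End_chart M c"] using End_chart_inj[OF M c] by (metis inv_into_f_f)
qed

lemma mat_of_change_chart:
  assumes M: "smooth_atlas M" and c: "c \<in> charts_at M x" "c' \<in> charts_at M x"
  shows "mat_of M x c' (end_of M x c A) = matrix (\<lambda>u.
    frechet_derivative (snd c' \<circ> chart_inv c) (at (snd c x))
      (A *v frechet_derivative (snd c \<circ> chart_inv c') (at (snd c' x)) u))"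
  by (simp add: mat_of_def end_of_def coord_vec_tangent[OF M c(2)]) (simp add: coord_vec_def c)

text \<open>
  A coordinate change of the bundle is the lift of a coordinate change of \<open>M\<close>, acting on matrices by
  conjugation with its derivative; the inverse of the derivative is that of the inverse change.
\<close>

lemma smooth_atlas_End_bundle:
  assumes M: "smooth_atlas M"
  shows "smooth_atlas (End_bundle M)"
proof -
  have ov: "snd (End_chart M c) ` (fst (End_chart M c) \<inter> fst (End_chart M c')) =
      (snd c ` (fst c \<inter> fst c')) \<times> UNIV" if "c \<in> M" for c c'
  proof -
    have "fst (End_chart M c) \<inter> fst (End_chart M c') = Sigma (fst c \<inter> fst c') (End_at M)"
      by (auto simp: End_chart_simps)
    then show ?thesis using End_chart_image[OF M that, of "fst c \<inter> fst c'"] by simp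
  qed
  have tr: "smooth_on ((snd c ` (fst c \<inter> fst c')) \<times> UNIV)
      (snd (End_chart M c') \<circ> chart_inv (End_chart M c))" if c: "c \<in> M" "c' \<in> M" for c c'
  proof -
    let ?S = "snd c ` (fst c \<inter> fst c')" and ?T = "snd c' ` (fst c' \<inter> fst c)"
    have inS: "chart_inv c q \<in> fst c \<inter> fst c'" "snd c (chart_inv c q) = q" if "q \<in> ?S" for q
    proof -
      show "chart_inv c q \<in> fst c \<inter> fst c'"
        using that by (rule chart_inv_in) (auto intro: atlas_inj[OF M c(1)])
      show "snd c (chart_inv c q) = q" using that by (auto intro: chart_chart_inv)
    qed
    have im: "(\<lambda>p. snd c' (chart_inv c p)) ` ?S \<subseteq> ?T" using inS(1) by blast
    have "smooth_on (?S \<times> UNIV) (conjugation_lift (\<lambda>p. snd c' (chart_inv c p)) (\<lambda>p. snd c (chart_inv c' p)))"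
      by (rule smooth_on_conjugation_lift[OF atlas_open_overlap[OF M c] atlas_open_overlap[OF M c(2,1)]
          atlas_transition[OF M c] im atlas_transition[OF M c(2,1)]])
    moreover have "(snd (End_chart M c') \<circ> chart_inv (End_chart M c)) q =
        conjugation_lift (\<lambda>p. snd c' (chart_inv c p)) (\<lambda>p. snd c (chart_inv c' p)) q"
      if q: "q \<in> ?S \<times> UNIV" for q
    proof -
      obtain p A where pA: "q = (p, A)" "p \<in> ?S" using q by auto
      note i = inS[OF pA(2)]
      have ca: "c \<in> charts_at M (chart_inv c p)" "c' \<in> charts_at M (chart_inv c p)"
        using i c by (auto simp: charts_at_def)
      have p: "p \<in> snd c ` fst c" using pA by auto
      show ?thesis
        using mat_of_change_chart[OF M ca, of A]
        by (simp add: pA(1) End_chart_inv[OF M c(1) p] End_chart_simps conjugation_lift_def i(2) o_def)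
    qed
    ultimately show ?thesis
      by (subst smooth_on_cong) (auto intro: open_Times atlas_open_overlap[OF M c])
  qed
  show ?thesis
    unfolding smooth_atlas_def End_bundle_def
  proof (intro conjI ballI)
    fix k assume "k \<in> End_chart M ` M"
    then obtain c where c: "c \<in> M" "k = End_chart M c" by auto
    show "inj_on (snd k) (fst k)" using End_chart_inj[OF M c(1)] c(2) by simp
    have "snd k ` fst k = (snd c ` fst c) \<times> UNIV"
      using ov[OF c(1), of c] c(2) by simp
    then show "open (snd k ` fst k)" using atlas_open[OF M c(1)] by (simp add: open_Times)
    fix k' assume "k' \<in> End_chart M ` M"
    then obtain c' where c': "c' \<in> M" "k' = End_chart M c'" by auto
    show "open (snd k ` (fst k \<inter> fst k'))"
      using ov[OF c(1), of c'] c c' atlas_open_overlap[OF M c(1) c'(1)] by (simp add: open_Times)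
    show "smooth_on (snd k ` (fst k \<inter> fst k')) (snd k' \<circ> chart_inv k)"
      using ov[OF c(1), of c'] tr[OF c(1) c'(1)] c c' by simp
  qed
qed

lemma End_charts_at:
  assumes "c \<in> charts_at M x" "j \<in> End_at M x"
  shows "End_chart M c \<in> charts_at (End_bundle M) (x, j)"
  using assms by (auto simp: charts_at_def End_bundle_def End_chart_simps)

lemma End_projection_smooth:
  assumes M: "smooth_atlas M"
  shows "smooth_map (End_bundle M) M fst"
  unfolding smooth_map_def
proof (intro conjI ballI)
  show "fst ` carrier_of (End_bundle M) \<subseteq> carrier_of M"
    by (auto simp: carrier_of_def End_bundle_def End_chart_simps)
  fix k c' assume "k \<in> End_bundle M" and c': "c' \<in> M"
  then obtain c where c: "c \<in> M" "k = End_chart M c" by (auto simp: End_bundle_def)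
  let ?S = "snd c ` (fst c \<inter> fst c')"
  have "fst k \<inter> fst -` fst c' = Sigma (fst c \<inter> fst c') (End_at M)"
    using c by (auto simp: End_chart_simps)
  then have eq: "snd k ` (fst k \<inter> fst -` fst c') = ?S \<times> UNIV"
    using End_chart_image[OF M c(1), of "fst c \<inter> fst c'"] c(2) by simp
  note o = atlas_open_overlap[OF M c(1) c']
  then show o2: "open (snd k ` (fst k \<inter> fst -` fst c'))" by (simp add: eq open_Times)
  have oU: "open (?S \<times> (UNIV :: (real^'b^'b) set))" using o by (simp add: open_Times)
  have "smooth_on (?S \<times> (UNIV :: (real^'b^'b) set)) (\<lambda>q. snd c' (chart_inv c (fst q)))"
    by (rule smooth_on_compose[OF oU o atlas_transition[OF M c(1) c']])
      (auto intro: smooth_on_bounded_linear[OF oU bounded_linear_fst smooth_on_ident[OF oU]])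
  moreover have "(snd c' \<circ> fst \<circ> chart_inv k) q = snd c' (chart_inv c (fst q))" if "q \<in> ?S \<times> UNIV" for q
  proof -
    obtain p A where q: "q = (p, A)" by (cases q)
    then have "p \<in> snd c ` fst c" using that by auto
    then show ?thesis using End_chart_inv[OF M c(1)] c(2) q by simp
  qed
  ultimately show "smooth_on (snd k ` (fst k \<inter> fst -` fst c')) (snd c' \<circ> fst \<circ> chart_inv k)"
    unfolding eq by (subst smooth_on_cong[OF oU]) auto
qed

lemma d_pi_in_chart:
  assumes M: "smooth_atlas M" and c: "c \<in> charts_at M x" and j: "j \<in> End_at M x"
    and X: "X \<in> tangent_space (End_bundle M) (x, j)"
  shows "d_pi M (x, j) X = coord_vec M x c (fst (X (End_chart M c)))"
proof -
  note B = smooth_atlas_End_bundle[OF M]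
  note cM = charts_atD[OF c]
  note k = End_charts_at[OF c j]
  let ?q = "snd (End_chart M c) (x, j)"
  have "(fst has_derivative fst) (at ?q)" by (rule bounded_linear.has_derivative[OF bounded_linear_fst has_derivative_ident])
  then have "((\<lambda>p. snd c (fst (chart_inv (End_chart M c) p))) has_derivative fst) (at ?q)"
  proof (rule has_derivative_transform_within_open)
    show "open ((snd c ` fst c) \<times> (UNIV :: (real^'b^'b) set))" using atlas_open[OF M cM(1)] by (simp add: open_Times)
    show "?q \<in> (snd c ` fst c) \<times> UNIV" using cM by (simp add: End_chart_simps)
    fix q assume "q \<in> (snd c ` fst c) \<times> (UNIV :: (real^'b^'b) set)"
    then obtain p A where q: "q = (p, A)" "p \<in> snd c ` fst c" by auto
    then show "fst q = snd c (fst (chart_inv (End_chart M c) q))"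
      by (simp add: End_chart_inv[OF M cM(1)] chart_chart_inv)
  qed
  from frechet_derivative_eq[OF this]
  have "frechet_derivative (snd c \<circ> fst \<circ> chart_inv (End_chart M c)) (at ?q) (X (End_chart M c)) =
      fst (X (End_chart M c))" by (simp add: o_def)
  then show ?thesis
    using tangent_map_eq[OF B M End_projection_smooth[OF M] k _ X, of c] c by simp
qed

section \<open>Symplectic frames\<close>

lemma bilinear_expand:
  fixes B :: "'v::euclidean_space \<Rightarrow> 'v \<Rightarrow> real"
  assumes "bilinear B"
  shows "B a b = (\<Sum>i\<in>Basis. \<Sum>k\<in>Basis. (a \<bullet> i) * (b \<bullet> k) * B i k)"
proof -
  have l: "linear (\<lambda>a. B a b)" "linear (B a)" for a b using assms by (auto simp: bilinear_def)
  have "B a b = B (\<Sum>i\<in>Basis. (a \<bullet> i) *\<^sub>R i) b" by (simp only: euclidean_representation)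
  also have "\<dots> = (\<Sum>i\<in>Basis. (a \<bullet> i) * B i b)"
    by (simp only: linear_sum[OF l(1)] linear_cmul[OF l(1)] real_scaleR_def)
  also have "\<dots> = (\<Sum>i\<in>Basis. (a \<bullet> i) * B i (\<Sum>k\<in>Basis. (b \<bullet> k) *\<^sub>R k))"
    by (simp only: euclidean_representation)
  also have "\<dots> = (\<Sum>i\<in>Basis. \<Sum>k\<in>Basis. (a \<bullet> i) * (b \<bullet> k) * B i k)"
    by (simp only: linear_sum[OF l(2)] linear_cmul[OF l(2)] real_scaleR_def sum_distrib_left mult.assoc)
  finally show ?thesis .
qed

lemma smooth_on_bilinear_family:
  fixes B :: "'e::euclidean_space \<Rightarrow> 'v::euclidean_space \<Rightarrow> 'v \<Rightarrow> real"
  assumes S: "open S" and B: "\<And>q. q \<in> S \<Longrightarrow> bilinear (B q)" "\<And>u v. smooth_on S (\<lambda>q. B q u v)"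
    and a: "smooth_on S a" and b: "smooth_on S b"
  shows "smooth_on S (\<lambda>q. B q (a q) (b q))"
proof -
  have "smooth_on S (\<lambda>q. \<Sum>i\<in>Basis. \<Sum>k\<in>Basis. (a q \<bullet> i) * (b q \<bullet> k) * B q i k)"
    by (intro smooth_on_sum smooth_on_mult smooth_on_inner_const S B a b)
  then show ?thesis by (subst smooth_on_cong[OF S bilinear_expand[OF B(1)]])
qed

text \<open>
  The product rule for a bilinear form that depends on the point as well; used for a symplectic form
  along a curve or in a chart.
\<close>

lemma has_derivative_bilinear_family:
  fixes B :: "'e::euclidean_space \<Rightarrow> 'v::euclidean_space \<Rightarrow> 'v \<Rightarrow> real"
  assumes S: "open S" "x \<in> S" and B: "\<And>q. q \<in> S \<Longrightarrow> bilinear (B q)"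
    "\<And>u v. ((\<lambda>q. B q u v) has_derivative (\<lambda>h. B' h u v)) (at x)" "\<And>h. bilinear (B' h)"
    and a: "(a has_derivative a') (at x)" and b: "(b has_derivative b') (at x)"
  shows "((\<lambda>q. B q (a q) (b q)) has_derivative
    (\<lambda>h. B' h (a x) (b x) + B x (a' h) (b x) + B x (a x) (b' h))) (at x)"
proof -
  have "((\<lambda>q. \<Sum>i\<in>Basis. \<Sum>k\<in>Basis. ((a q \<bullet> i) * (b q \<bullet> k)) * B q i k) has_derivative
      (\<lambda>h. \<Sum>i\<in>Basis. \<Sum>k\<in>Basis. ((a x \<bullet> i) * (b x \<bullet> k)) * B' h i k +
        ((a x \<bullet> i) * (b' h \<bullet> k) + (a' h \<bullet> i) * (b x \<bullet> k)) * B x i k)) (at x)"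
    by (intro has_derivative_sum has_derivative_mult has_derivative_inner_left a b B)
  then have "((\<lambda>q. \<Sum>i\<in>Basis. \<Sum>k\<in>Basis. ((a q \<bullet> i) * (b q \<bullet> k)) * B q i k) has_derivative
      (\<lambda>h. B' h (a x) (b x) + B x (a' h) (b x) + B x (a x) (b' h))) (at x)"
    by (rule has_derivative_eq_rhs)
      (simp only: fun_eq_iff bilinear_expand[OF B(3), of _ "a x" "b x"] bilinear_expand[OF B(1)[OF S(2)], of _ "b x"]
        bilinear_expand[OF B(1)[OF S(2)], of "a x"] sum.distrib[symmetric], simp add: algebra_simps)
  then show ?thesis
    by (rule has_derivative_transform_within_open[OF _ S]) (rule bilinear_expand[OF B(1), symmetric])
qed

definition pairing_sign :: "bool \<Rightarrow> bool \<Rightarrow> real"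
  where "pairing_sign p q = (if p = q then 0 else if p then 1 else -1)"

text \<open>
  In the usual notation for symplectic bases, \<open>f i True\<close> and \<open>f i False\<close> are \<open>e\<^sub>i\<close> and \<open>f\<^sub>i\<close>.
\<close>

definition symplectic_frame :: "('v \<Rightarrow> 'v \<Rightarrow> real) \<Rightarrow> nat \<Rightarrow> (nat \<Rightarrow> bool \<Rightarrow> 'v) \<Rightarrow> bool"
  where "symplectic_frame B n f \<longleftrightarrow> (\<forall>i<n. \<forall>k<n. \<forall>p q.
    B (f i p) (f k q) = (if i = k then pairing_sign p q else 0))"

lemma symplectic_frameD:
  "symplectic_frame B n f \<Longrightarrow> i < n \<Longrightarrow> k < n \<Longrightarrow>
    B (f i p) (f k q) = (if i = k then pairing_sign p q else 0)"
  by (simp add: symplectic_frame_def)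

text \<open>
  The map that sends coordinates to the corresponding combination of the \<open>2n\<close> frame vectors is injective, since the
  pairing recovers the coordinates, and therefore bijective.
\<close>

lemma symplectic_frame_expand:
  fixes B :: "real^'m \<Rightarrow> real^'m \<Rightarrow> real"
  assumes B: "bilinear B" "\<And>u v. B u v = - B v u" and card: "CARD('m) = 2 * n"
    and f: "symplectic_frame B n f"
  shows "v = (\<Sum>i<n. B v (f i False) *\<^sub>R f i True - B v (f i True) *\<^sub>R f i False)"
proof -
  have l: "linear (\<lambda>a. B a b)" "linear (B a)" for a b using B(1) by (auto simp: bilinear_def)
  have "card (UNIV :: 'm set) = card ({..<n} \<times> (UNIV :: bool set))" using card by simp
  then obtain \<beta> :: "'m \<Rightarrow> nat \<times> bool" where \<beta>: "bij_betw \<beta> UNIV ({..<n} \<times> UNIV)"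
    using finite_same_card_bij[of "UNIV :: 'm set" "{..<n} \<times> (UNIV :: bool set)"] by auto
  define F where "F = (\<lambda>(i, p). f i p)"
  define G where "G x = (\<Sum>j\<in>UNIV. x $ j *\<^sub>R F (\<beta> j))" for x :: "real^'m"
  have lG: "linear G" unfolding G_def
    by (intro linearI) (simp_all add: scaleR_add_left sum.distrib scaleR_sum_right)
  have GS: "\<exists>y. G x = (\<Sum>k\<in>{..<n} \<times> UNIV. y k *\<^sub>R F k) \<and> (\<forall>j. x $ j = y (\<beta> j))" for x
  proof -
    define y where "y k = x $ the_inv_into UNIV \<beta> k" for k
    have y: "y (\<beta> j) = x $ j" for j using \<beta> by (simp add: y_def bij_betw_def the_inv_into_f_f)
    have "(\<Sum>k\<in>{..<n} \<times> UNIV. y k *\<^sub>R F k) = (\<Sum>j\<in>UNIV. y (\<beta> j) *\<^sub>R F (\<beta> j))"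
      by (rule sum.reindex_bij_betw[OF \<beta>, symmetric])
    then show ?thesis using y by (intro exI[of _ y]) (simp add: G_def)
  qed
  have coef: "B (\<Sum>k\<in>{..<n} \<times> UNIV. y k *\<^sub>R F k) (f i q) = pairing_sign (\<not> q) q * y (i, \<not> q)"
    if "i < n" for y i q
  proof -
    have "B (\<Sum>k\<in>{..<n} \<times> UNIV. y k *\<^sub>R F k) (f i q) =
        (\<Sum>k\<in>{..<n} \<times> UNIV. y k * B (F k) (f i q))"
      by (simp add: linear_sum[OF l(1)] linear_cmul[OF l(1)])
    also have "\<dots> = (\<Sum>k\<in>{..<n} \<times> UNIV. if k = (i, \<not> q) then pairing_sign (\<not> q) q * y (i, \<not> q) else 0)"
      by (intro sum.cong) (auto simp: F_def symplectic_frameD[OF f _ that] pairing_sign_def split: if_splits)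
    finally show ?thesis using that by simp
  qed
  have "inj G"
  proof (subst linear_injective_0[OF lG], intro allI impI)
    fix x assume x: "G x = 0"
    obtain y where y: "G x = (\<Sum>k\<in>{..<n} \<times> UNIV. y k *\<^sub>R F k)" "\<And>j. x $ j = y (\<beta> j)" using GS by metis
    have "y (i, p) = 0" if "i < n" for i p
      using coef[OF that, of y "\<not> p"] x y(1) linear_0[OF l(1)] by (auto simp: pairing_sign_def split: if_splits)
    moreover have "fst (\<beta> j) < n" for j using bij_betwE[OF \<beta>] by (auto simp: mem_Times_iff)
    ultimately have "y (\<beta> j) = 0" for j by (metis prod.collapse)
    then show "x = 0" using y(2) by (simp add: vec_eq_iff)
  qed
  then have "surj G" using linear_injective_imp_surjective[OF lG] by simp
  then obtain x where "v = G x" by (metis surjD)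
  then obtain y where v: "v = (\<Sum>k\<in>{..<n} \<times> UNIV. y k *\<^sub>R F k)" using GS by metis
  have "v = (\<Sum>i<n. \<Sum>p\<in>UNIV. y (i, p) *\<^sub>R f i p)"
    unfolding v by (simp add: sum.cartesian_product F_def split_def)
  also have "\<dots> = (\<Sum>i<n. B v (f i False) *\<^sub>R f i True - B v (f i True) *\<^sub>R f i False)"
    using coef unfolding v by (intro sum.cong refl) (simp add: UNIV_bool pairing_sign_def)
  finally show ?thesis .
qed

lemma linear_eq_on_frame:
  fixes B :: "real^'m \<Rightarrow> real^'m \<Rightarrow> real"
  assumes B: "bilinear B" "\<And>u v. B u v = - B v u" and card: "CARD('m) = 2 * n"
    and f: "symplectic_frame B n f" and g: "linear g" "linear h"
    and eq: "\<And>i p. i < n \<Longrightarrow> g (f i p) = h (f i p)"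
  shows "g v = h v"
  by (subst (1 2) symplectic_frame_expand[OF B card f, of v])
    (simp add: linear_sum[OF g(1)] linear_sum[OF g(2)] linear_diff[OF g(1)] linear_diff[OF g(2)]
      linear_cmul[OF g(1)] linear_cmul[OF g(2)] eq)

text \<open>
  A vector outside the span, minus its projection \<open>pr\<close> to the span, is a nonzero vector orthogonal to the
  frame. It pairs nontrivially with some vector, and that vector can be projected as well.
\<close>

lemma symplectic_frame_extend:
  fixes B :: "real^'m \<Rightarrow> real^'m \<Rightarrow> real"
  assumes B: "bilinear B" "\<And>u v. B u v = - B v u" and nd: "\<And>v. v \<noteq> 0 \<Longrightarrow> \<exists>w. B v w \<noteq> 0"
    and card: "CARD('m) = 2 * n" and k: "k < n" and f: "symplectic_frame B k f"
  shows "\<exists>g. symplectic_frame B (Suc k) g \<and> (\<forall>i<k. g i = f i)"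
proof -
  have l: "linear (\<lambda>a. B a b)" "linear (B a)" for a b using B(1) by (auto simp: bilinear_def)
  have B0: "B u u = 0" for u using B(2)[of u u] by simp
  define pr where "pr v = v - (\<Sum>i<k. B v (f i False) *\<^sub>R f i True - B v (f i True) *\<^sub>R f i False)" for v
  have orth: "B (pr v) (f i p) = 0" if "i < k" for v i p
  proof -
    have "B (\<Sum>i<k. B v (f i False) *\<^sub>R f i True - B v (f i True) *\<^sub>R f i False) (f i p) =
        (\<Sum>j<k. B v (f j False) * B (f j True) (f i p) - B v (f j True) * B (f j False) (f i p))"
      by (simp add: linear_sum[OF l(1)] linear_diff[OF l(1)] linear_cmul[OF l(1)])
    also have "\<dots> = (\<Sum>j<k. if j = i then B v (f i p) else 0)"
      by (intro sum.cong) (auto simp: symplectic_frameD[OF f _ that] pairing_sign_def)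
    finally show ?thesis using that by (simp add: pr_def linear_diff[OF l(1)])
  qed
  define S where "S = (\<lambda>(i, p). f i p) ` ({..<k} \<times> UNIV)"
  have "dim S \<le> card S" by (rule dim_le_card') (auto simp: S_def)
  also have "\<dots> \<le> 2 * k" unfolding S_def by (rule order_trans[OF card_image_le]) auto
  also have "\<dots> < CARD('m)" using k card by simp
  finally have "dim (span S) < CARD('m)" by simp
  moreover have "dim (UNIV :: (real^'m) set) = CARD('m)" by simp
  ultimately have "span S \<noteq> UNIV" by (metis less_irrefl)
  then obtain v where v: "v \<notin> span S" by auto
  have "(\<Sum>i<k. B v (f i False) *\<^sub>R f i True - B v (f i True) *\<^sub>R f i False) \<in> span S"
    by (intro span_sum span_diff span_scale span_base) (auto simp: S_def)
  then have "pr v \<noteq> 0" using v by (auto simp: pr_def)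
  then obtain w where w: "B (pr v) w \<noteq> 0" using nd by metis
  have "B (pr v) (\<Sum>i<k. B w (f i False) *\<^sub>R f i True - B w (f i True) *\<^sub>R f i False) = 0"
    by (simp add: linear_sum[OF l(2)] linear_diff[OF l(2)] linear_cmul[OF l(2)] orth)
  then have w': "B (pr v) (pr w) = B (pr v) w" by (simp add: pr_def[of w] linear_diff[OF l(2)])
  define g where "g i p = (if i = k then if p then pr v else (1 / B (pr v) w) *\<^sub>R pr w else f i p)" for i p
  have "B (g i p) (g j q) = (if i = j then pairing_sign p q else 0)" if ij: "i < Suc k" "j < Suc k" for i j p q
  proof -
    consider "i = k" "j = k" | "i = k" "j < k" | "i < k" "j = k" | "i < k" "j < k"
      using ij by (auto simp: less_Suc_eq)
    then show ?thesis
    proof cases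
      case 1
      then show ?thesis using w w' B0 B(2)[of "pr w" "pr v"]
        by (auto simp: g_def pairing_sign_def linear_cmul[OF l(1)] linear_cmul[OF l(2)])
    next
      case 2
      then show ?thesis using orth by (auto simp: g_def linear_cmul[OF l(1)])
    next
      case 3
      then show ?thesis using orth B(2)[of "f i p" "pr v"] B(2)[of "f i p" "pr w"]
        by (auto simp: g_def linear_cmul[OF l(2)])
    next
      case 4
      then show ?thesis using symplectic_frameD[OF f] by (simp add: g_def)
    qed
  qed
  then show ?thesis by (intro exI[of _ g]) (auto simp: symplectic_frame_def g_def fun_eq_iff)
qed

lemma symplectic_frame_through:
  fixes B :: "real^'m \<Rightarrow> real^'m \<Rightarrow> real"
  assumes B: "bilinear B" "\<And>u v. B u v = - B v u" and nd: "\<And>v. v \<noteq> 0 \<Longrightarrow> \<exists>w. B v w \<noteq> 0"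
    and card: "CARD('m) = 2 * n" and v: "v \<noteq> 0"
  shows "\<exists>f. symplectic_frame B n f \<and> f 0 True = v"
proof -
  have l: "linear (\<lambda>a. B a b)" "linear (B a)" for a b using B(1) by (auto simp: bilinear_def)
  have B0: "B u u = 0" for u using B(2)[of u u] by simp
  have "n > 0" using card zero_less_card_finite[where 'a = 'm] by simp
  have "\<exists>f. symplectic_frame B (Suc k) f \<and> f 0 True = v" if "k < n" for k
    using that
  proof (induction k)
    case 0
    obtain w where w: "B v w \<noteq> 0" using nd v by metis
    show ?case
      by (rule exI[of _ "\<lambda>i p. if p then v else (1 / B v w) *\<^sub>R w"])
        (use w B0 B(2)[of w v] in
          \<open>auto simp: symplectic_frame_def pairing_sign_def linear_cmul[OF l(1)] linear_cmul[OF l(2)]\<close>)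
  next
    case (Suc k)
    then obtain f where "symplectic_frame B (Suc k) f" "f 0 True = v" by auto
    then show ?case using symplectic_frame_extend[OF B nd card Suc.prems] by (metis zero_less_Suc)
  qed
  from this[of "n - 1"] show ?thesis using \<open>n > 0\<close> by simp
qed

lemma has_real_derivative_bilinear_family:
  fixes B :: "real \<Rightarrow> 'v::euclidean_space \<Rightarrow> 'v \<Rightarrow> real"
  assumes S: "open S" "x \<in> S" and B: "\<And>t. t \<in> S \<Longrightarrow> bilinear (B t)"
    "\<And>u v. ((\<lambda>t. B t u v) has_real_derivative B' u v) (at x)" "bilinear B'"
    and a: "(a has_vector_derivative a') (at x)" and b: "(b has_vector_derivative b') (at x)"
  shows "((\<lambda>t. B t (a t) (b t)) has_real_derivative
    (B' (a x) (b x) + B x a' (b x) + B x (a x) b')) (at x)"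
proof -
  have l: "linear (\<lambda>a. B x a b)" "linear (B x a)" for a b using B(1)[OF S(2)] by (auto simp: bilinear_def)
  have B'l: "bilinear (\<lambda>u v. B' u v * h)" for h
  proof -
    have l': "linear (\<lambda>u. B' u v)" "linear (B' u)" for u v using B(3) by (auto simp: bilinear_def)
    show ?thesis
      unfolding bilinear_def
      by (intro conjI allI linearI)
        (simp_all add: linear_add[OF l'(1)] linear_cmul[OF l'(1)] linear_add[OF l'(2)]
          linear_cmul[OF l'(2)] algebra_simps)
  qed
  have "((\<lambda>t. B t (a t) (b t)) has_derivative
    (\<lambda>h. B' (a x) (b x) * h + B x (h *\<^sub>R a') (b x) + B x (a x) (h *\<^sub>R b'))) (at x)"
    using B(2)
    by (intro has_derivative_bilinear_family[OF S B(1), where B' = "\<lambda>h u v. B' u v * h"] B'l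
        a[unfolded has_vector_derivative_def] b[unfolded has_vector_derivative_def])
      (auto simp: has_field_derivative_def)
  then show ?thesis
    unfolding has_field_derivative_def
    by (rule has_derivative_eq_rhs)
      (simp add: fun_eq_iff linear_cmul[OF l(1)] linear_cmul[OF l(2)] algebra_simps)
qed

section \<open>Smooth families of symplectic frames\<close>

text \<open>
  An intermediate stage of the Gram-Schmidt process: smooth curves of vectors with values \<open>f\<close> and
  velocities \<open>a\<close> at 0, of which the first \<open>m\<close> pairs already have the correct pairings with all others.
\<close>

definition frame_family ::
  "(real \<Rightarrow> 'v::euclidean_space \<Rightarrow> 'v \<Rightarrow> real) \<Rightarrow> nat \<Rightarrow> (nat \<Rightarrow> bool \<Rightarrow> 'v) \<Rightarrow> (nat \<Rightarrow> bool \<Rightarrow> 'v) \<Rightarrow>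
   nat \<Rightarrow> real \<Rightarrow> (nat \<Rightarrow> bool \<Rightarrow> real \<Rightarrow> 'v) \<Rightarrow> bool"
  where "frame_family \<omega> n f a m \<epsilon> F \<longleftrightarrow>
    (\<forall>i<n. \<forall>p. smooth_on {-\<epsilon><..<\<epsilon>} (F i p) \<and> F i p 0 = f i p \<and>
      (F i p has_vector_derivative a i p) (at 0)) \<and>
    (\<forall>t\<in>{-\<epsilon><..<\<epsilon>}. \<forall>i<m. \<forall>k<n. \<forall>p q.
      \<omega> t (F i p t) (F k q t) = (if i = k then pairing_sign p q else 0))"

text \<open>
  Normalise the pair with index \<open>m\<close> and make the later vectors orthogonal to it. By the
  hypothesis on \<open>a\<close>, all pairings agree with their final values up to second order at 0, so
  each coefficient used in the correction has derivative 0 there and the 1-jets do not change.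
\<close>

lemma smooth_gram_schmidt_step:
  fixes \<omega> :: "real \<Rightarrow> 'v::euclidean_space \<Rightarrow> 'v \<Rightarrow> real"
  assumes \<omega>: "\<And>t. t \<in> {-\<epsilon><..<\<epsilon>} \<Longrightarrow> bilinear (\<omega> t)"
      "\<And>t u v. t \<in> {-\<epsilon><..<\<epsilon>} \<Longrightarrow> \<omega> t u v = - \<omega> t v u"
      "\<And>u v. smooth_on {-\<epsilon><..<\<epsilon>} (\<lambda>t. \<omega> t u v)"
      "\<And>u v. ((\<lambda>t. \<omega> t u v) has_real_derivative \<omega>' u v) (at 0)" "bilinear \<omega>'"
    and f: "symplectic_frame (\<omega> 0) n f"
    and flat: "\<And>i k p q. i < n \<Longrightarrow> k < n \<Longrightarrow>
      \<omega>' (f i p) (f k q) + \<omega> 0 (a i p) (f k q) + \<omega> 0 (f i p) (a k q) = 0"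
    and \<epsilon>: "\<epsilon> > 0" and m: "m < n"
    and fam: "frame_family \<omega> n f a m \<epsilon> F"
  shows "\<exists>\<epsilon>' F'. 0 < \<epsilon>' \<and> \<epsilon>' \<le> \<epsilon> \<and> frame_family \<omega> n f a (Suc m) \<epsilon>' F'"
proof -
  have F: "smooth_on {-\<epsilon><..<\<epsilon>} (F i p) \<and> F i p 0 = f i p \<and> (F i p has_vector_derivative a i p) (at 0)"
    if "i < n" for i p using fam that by (simp add: frame_family_def)
  have Fm: "\<omega> t (F i p t) (F k q t) = (if i = k then pairing_sign p q else 0)"
    if "t \<in> {-\<epsilon><..<\<epsilon>}" "i < m" "k < n" for t i k p q
    using fam that unfolding frame_family_def by blast
  let ?I = "{-\<epsilon><..<\<epsilon>}"
  have I0: "open ?I" "0 \<in> ?I" using \<epsilon> by auto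
  have jet: "((\<lambda>t. \<omega> t (v t) (w t)) has_real_derivative 0) (at 0)"
    if "(v has_vector_derivative a i p) (at 0)" "v 0 = f i p"
      "(w has_vector_derivative a k q) (at 0)" "w 0 = f k q" "i < n" "k < n" for v w i k p q
    using has_real_derivative_bilinear_family[where B = \<omega> and B' = \<omega>', OF I0 \<omega>(1,4,5) that(1,3)]
    unfolding that(2,4) flat[OF that(5,6)] .
  define g where "g t = \<omega> t (F m True t) (F m False t)" for t
  have sg: "smooth_on ?I g" unfolding g_def
    by (rule smooth_on_bilinear_family[where B = \<omega>, OF I0(1) \<omega>(1,3)]) (use F[OF m] in auto)
  have g0: "g 0 = 1" using F[OF m] symplectic_frameD[OF f m m] by (simp add: g_def pairing_sign_def)
  have dg: "(g has_real_derivative 0) (at 0)" unfolding g_def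
    using F[OF m] by (intro jet[of _ m True _ m False]) (auto simp: m)
  have "isCont g 0" by (rule DERIV_isCont[OF dg])
  then have "\<exists>d>0. \<forall>t. \<bar>t\<bar> < d \<longrightarrow> \<bar>g t - 1\<bar> < 1"
    unfolding continuous_at_eps_delta using g0 by (force simp: dist_real_def dest: spec[of _ 1])
  then obtain d where d: "d > 0" "\<And>t. \<bar>t\<bar> < d \<Longrightarrow> \<bar>g t - 1\<bar> < 1" by auto
  define \<epsilon>' where "\<epsilon>' = min d \<epsilon>"
  let ?J = "{-\<epsilon>'<..<\<epsilon>'}"
  have J: "open ?J" "0 \<in> ?J" "?J \<subseteq> ?I" "\<epsilon>' > 0" "\<epsilon>' \<le> \<epsilon>" using d \<epsilon> by (auto simp: \<epsilon>'_def)
  have gpos: "g t > 0" if "t \<in> ?J" for t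
    using d(2)[of t] that by (auto simp: \<epsilon>'_def abs_less_iff)
  note \<omega>J = \<omega>(1)[OF subsetD[OF J(3)]] \<omega>(2)[OF subsetD[OF J(3)]]
  have sJ: "smooth_on ?J h" if "smooth_on ?I h" for h :: "real \<Rightarrow> real"
    using that J(3) by (rule smooth_on_subset)
  have sF: "smooth_on ?J (F i p)" if "i < n" for i p using F[OF that] J(3) smooth_on_subset by blast
  have s\<omega>: "smooth_on ?J (\<lambda>t. \<omega> t (v t) (w t))" if "smooth_on ?J v" "smooth_on ?J w" for v w
    by (rule smooth_on_bilinear_family[where B = \<omega>, OF J(1) \<omega>J(1) sJ[OF \<omega>(3)] that])
  define h where "h t = inverse (g t) *\<^sub>R F m False t" for t
  have sh: "smooth_on ?J h" unfolding h_def
    using gpos by (intro smooth_on_scaleR smooth_on_inverse J(1) sJ sg sF m) force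
  have h0: "h 0 = f m False" using F[OF m] g0 by (simp add: h_def)
  have dh: "(h has_vector_derivative a m False) (at 0)"
  proof -
    have "((\<lambda>t. inverse (g t)) has_real_derivative - (inverse (g 0) * 0 * inverse (g 0))) (at 0)"
      using DERIV_inverse'[OF dg] g0 by simp
    then have "((\<lambda>t. inverse (g t) *\<^sub>R F m False t) has_vector_derivative
        (inverse (g 0) *\<^sub>R a m False + 0 *\<^sub>R F m False 0)) (at 0)"
      using F[OF m] by (intro has_vector_derivative_scaleR) auto
    then show ?thesis using g0 by (simp add: h_def[abs_def])
  qed
  \<comment> \<open>subtract the projection to the span of the normalised pair\<close>
  define G where "G k q t = F k q t - \<omega> t (F k q t) (h t) *\<^sub>R F m True t + \<omega> t (F k q t) (F m True t) *\<^sub>R h t" for k q t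
  define F' where "F' k q = (if k < m then F k q else if k = m then if q then F m True else h else G k q)" for k q
  have G: "smooth_on ?J (G k q) \<and> G k q 0 = f k q \<and> (G k q has_vector_derivative a k q) (at 0)"
    if k: "k < n" "k \<noteq> m" for k q
  proof (intro conjI)
    show "smooth_on ?J (G k q)" unfolding G_def
      by (intro smooth_on_add smooth_on_diff smooth_on_scaleR s\<omega> J(1) sF sh k m)
    have z: "\<omega> 0 (F k q 0) (h 0) = 0" "\<omega> 0 (F k q 0) (F m True 0) = 0"
      using F[OF m] F[OF k(1)] h0 symplectic_frameD[OF f k(1) m] k(2) by simp_all
    show "G k q 0 = f k q" using F[OF k(1)] z by (simp add: G_def)
    have "((\<lambda>t. \<omega> t (F k q t) (h t)) has_real_derivative 0) (at 0)"
      using F[OF k(1)] dh h0 by (intro jet[of _ k q _ m False]) (auto simp: m k)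
    then have 1: "((\<lambda>t. \<omega> t (F k q t) (h t) *\<^sub>R F m True t) has_vector_derivative
        (\<omega> 0 (F k q 0) (h 0) *\<^sub>R a m True + 0 *\<^sub>R F m True 0)) (at 0)"
      using F[OF m] by (intro has_vector_derivative_scaleR) auto
    have "((\<lambda>t. \<omega> t (F k q t) (F m True t)) has_real_derivative 0) (at 0)"
      using F[OF k(1)] F[OF m] by (intro jet[of _ k q _ m True]) (auto simp: m k)
    then have 2: "((\<lambda>t. \<omega> t (F k q t) (F m True t) *\<^sub>R h t) has_vector_derivative
        (\<omega> 0 (F k q 0) (F m True 0) *\<^sub>R a m False + 0 *\<^sub>R h 0)) (at 0)"
      using dh by (intro has_vector_derivative_scaleR) auto
    have "(F k q has_vector_derivative a k q) (at 0)" using F[OF k(1)] by blast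
    from has_vector_derivative_add[OF has_vector_derivative_diff[OF this 1] 2]
    show "(G k q has_vector_derivative a k q) (at 0)" by (simp add: G_def[abs_def] z)
  qed
  have F': "smooth_on ?J (F' i p) \<and> F' i p 0 = f i p \<and> (F' i p has_vector_derivative a i p) (at 0)"
    if i: "i < n" for i p
    using F[OF i] sF[OF i] sh h0 dh G[OF i] by (auto simp: F'_def)
  have "\<omega> t (F' i p t) (F' k q t) = (if i = k then pairing_sign p q else 0)"
    if t: "t \<in> ?J" and i: "i < Suc m" and k: "k < n" for t i k p q
  proof -
    have tI: "t \<in> ?I" using t J(3) by blast
    note sk = \<omega>J(2)[OF t]
    have l: "linear (\<lambda>u. \<omega> t u v)" "linear (\<omega> t u)" for u v using \<omega>J(1)[OF t] by (auto simp: bilinear_def)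
    note ls = linear_add[OF l(1)] linear_diff[OF l(1)] linear_cmul[OF l(1)]
      linear_add[OF l(2)] linear_diff[OF l(2)] linear_cmul[OF l(2)]
    have s0: "\<omega> t u u = 0" for u using sk[of u u] by simp
    have eh: "\<omega> t (F m True t) (h t) = 1" using gpos[OF t] by (simp add: h_def ls g_def)
    have he: "\<omega> t (h t) (F m True t) = -1" using sk[of "h t"] eh by simp
    have om: "\<omega> t (F i p t) (F m q t) = 0" "\<omega> t (F i p t) (h t) = 0" if "i < m" for i p q
      using Fm[OF tI that m] that by (simp_all add: h_def ls)
    have lower: "\<omega> t (F i p t) (F' k q t) = (if i = k then pairing_sign p q else 0)" if "i < m" "k < n" for i p k q
      using Fm[OF tI that] om[OF that(1)] that by (auto simp: F'_def G_def ls)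
    show ?thesis
    proof (cases "i < m")
      case True
      then show ?thesis using lower[OF True k] by (simp add: F'_def)
    next
      case False
      then have im: "i = m" using i by simp
      consider "k < m" | "k = m" | "k > m" by linarith
      then show ?thesis
      proof cases
        case 1
        then show ?thesis using sk[of "F' i p t"] lower[OF 1 m, of q p] im by (simp add: F'_def)
      next
        case 2
        then show ?thesis using im eh he s0 by (auto simp: F'_def pairing_sign_def)
      next
        case 3
        have "\<omega> t (F m True t) (G k q t) = 0" "\<omega> t (h t) (G k q t) = 0"
          using sk[of "F m True t" "F k q t"] sk[of "h t" "F k q t"] eh he s0 by (simp_all add: G_def ls)
        then show ?thesis using 3 im by (auto simp: F'_def)
      qed
    qed
  qed
  then show ?thesis using F' J(4,5) unfolding frame_family_def by (intro exI[of _ \<epsilon>'] exI[of _ F']) blast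
qed

text \<open>
  Any velocities \<open>a\<close> that infinitesimally preserve the frame relations are realised by a smooth curve
  of true symplectic frames.
\<close>

lemma smooth_symplectic_frame:
  fixes \<omega> :: "real \<Rightarrow> 'v::euclidean_space \<Rightarrow> 'v \<Rightarrow> real"
  assumes \<delta>: "\<delta> > 0" and \<omega>: "\<And>t. t \<in> {-\<delta><..<\<delta>} \<Longrightarrow> bilinear (\<omega> t)"
      "\<And>t u v. t \<in> {-\<delta><..<\<delta>} \<Longrightarrow> \<omega> t u v = - \<omega> t v u"
      "\<And>u v. smooth_on {-\<delta><..<\<delta>} (\<lambda>t. \<omega> t u v)"
      "\<And>u v. ((\<lambda>t. \<omega> t u v) has_real_derivative \<omega>' u v) (at 0)" "bilinear \<omega>'"
    and f: "symplectic_frame (\<omega> 0) n f"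
    and flat: "\<And>i k p q. i < n \<Longrightarrow> k < n \<Longrightarrow>
      \<omega>' (f i p) (f k q) + \<omega> 0 (a i p) (f k q) + \<omega> 0 (f i p) (a k q) = 0"
  shows "\<exists>\<epsilon> F. 0 < \<epsilon> \<and> \<epsilon> \<le> \<delta> \<and>
    (\<forall>i<n. \<forall>p. smooth_on {-\<epsilon><..<\<epsilon>} (F i p) \<and> F i p 0 = f i p \<and>
      (F i p has_vector_derivative a i p) (at 0)) \<and>
    (\<forall>t\<in>{-\<epsilon><..<\<epsilon>}. symplectic_frame (\<omega> t) n (\<lambda>i p. F i p t))"
proof -
  have "\<exists>\<epsilon> F. 0 < \<epsilon> \<and> \<epsilon> \<le> \<delta> \<and> frame_family \<omega> n f a m \<epsilon> F" if "m \<le> n" for m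
    using that
  proof (induction m)
    case 0
    have o: "open {-\<delta><..<\<delta>}" by auto
    have "smooth_on {-\<delta><..<\<delta>} (\<lambda>t. f i p + t *\<^sub>R a i p)" for i p
      by (intro smooth_on_add smooth_on_scaleR smooth_on_const smooth_on_ident o)
    moreover have "((\<lambda>t. f i p + t *\<^sub>R a i p) has_vector_derivative a i p) (at 0)" for i p
      by (auto intro!: derivative_eq_intros)
    ultimately show ?case using \<delta> unfolding frame_family_def
      by (intro exI[of _ \<delta>] exI[of _ "\<lambda>i p t. f i p + t *\<^sub>R a i p"]) auto
  next
    case (Suc m)
    then obtain \<epsilon> F where F: "0 < \<epsilon>" "\<epsilon> \<le> \<delta>" "frame_family \<omega> n f a m \<epsilon> F" by auto
    have sub: "{-\<epsilon><..<\<epsilon>} \<subseteq> {-\<delta><..<\<delta>}" using F by auto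
    have "\<exists>\<epsilon>' F'. 0 < \<epsilon>' \<and> \<epsilon>' \<le> \<epsilon> \<and> frame_family \<omega> n f a (Suc m) \<epsilon>' F'"
    proof (rule smooth_gram_schmidt_step[OF _ _ _ \<omega>(4,5) f flat F(1) _ F(3)])
      show "bilinear (\<omega> t)" if "t \<in> {-\<epsilon><..<\<epsilon>}" for t using \<omega>(1) sub that by blast
      show "\<omega> t u v = - \<omega> t v u" if "t \<in> {-\<epsilon><..<\<epsilon>}" for t u v using \<omega>(2) sub that by blast
      show "smooth_on {-\<epsilon><..<\<epsilon>} (\<lambda>t. \<omega> t u v)" for u v using \<omega>(3) sub by (rule smooth_on_subset)
      show "m < n" using Suc.prems by simp
    qed
    then show ?case using F(2) order_trans by blast
  qed
  from this[of n] show ?thesis unfolding symplectic_frame_def frame_family_def by simp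
qed

section \<open>Complex structures adapted to a symplectic frame\<close>

text \<open>
  The sign of \<open>\<omega>(\<cdot>, j\<cdot>)\<close> on the plane of the pair with index \<open>i\<close>.
\<close>

definition twist_sign :: "nat \<Rightarrow> nat \<Rightarrow> real"
  where "twist_sign l i = (if i < l then -1 else 1)"

text \<open>
  The complex structure \<open>A\<close> rotates each plane of the frame, in the direction given by the sign.
\<close>

definition adapted_frame ::
  "(real^'m \<Rightarrow> real^'m \<Rightarrow> real) \<Rightarrow> nat \<Rightarrow> nat \<Rightarrow> (nat \<Rightarrow> bool \<Rightarrow> real^'m) \<Rightarrow> real^'m^'m \<Rightarrow> bool"
  where "adapted_frame B n l f A \<longleftrightarrow> symplectic_frame B n f \<and>
    (\<forall>i<n. \<forall>p. A *v f i p = (if p then twist_sign l i else - twist_sign l i) *\<^sub>R f i (\<not> p))"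

definition frame_structure ::
  "(real^'m \<Rightarrow> real^'m \<Rightarrow> real) \<Rightarrow> nat \<Rightarrow> nat \<Rightarrow> (nat \<Rightarrow> bool \<Rightarrow> real^'m) \<Rightarrow> real^'m^'m"
  where "frame_structure B n l f = matrix (\<lambda>v. \<Sum>i<n. twist_sign l i *\<^sub>R
    (B v (f i False) *\<^sub>R f i False + B v (f i True) *\<^sub>R f i True))"

lemma twist_sign_square: "twist_sign l i * twist_sign l i = 1"
  by (simp add: twist_sign_def)

lemma adapted_frame_structure:
  assumes B: "bilinear B" and f: "symplectic_frame B n f"
  shows "adapted_frame B n l f (frame_structure B n l f)"
  unfolding adapted_frame_def
proof (intro conjI allI impI f)
  fix i p assume i: "i < n"
  have l: "linear (\<lambda>a. B a b)" for b using B by (auto simp: bilinear_def)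
  let ?g = "\<lambda>v. \<Sum>i<n. twist_sign l i *\<^sub>R (B v (f i False) *\<^sub>R f i False + B v (f i True) *\<^sub>R f i True)"
  have lin: "linear ?g"
    by (intro linear_compose_sum ballI linearI)
      (simp_all add: linear_add[OF l] linear_cmul[OF l] algebra_simps)
  have "frame_structure B n l f *v f i p = ?g (f i p)"
    using fun_cong[OF matrix_vector_mul(2)[OF lin], of "f i p"] by (simp add: frame_structure_def)
  also have "\<dots> = (\<Sum>k<n. if k = i then (if p then twist_sign l i else - twist_sign l i) *\<^sub>R f i (\<not> p) else 0)"
    by (intro sum.cong refl) (auto simp: symplectic_frameD[OF f i] pairing_sign_def)
  finally show "frame_structure B n l f *v f i p = (if p then twist_sign l i else - twist_sign l i) *\<^sub>R f i (\<not> p)"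
    using i by simp
qed

lemma matrix_eq_on_frame:
  fixes B :: "real^'m \<Rightarrow> real^'m \<Rightarrow> real"
  assumes B: "bilinear B" "\<And>u v. B u v = - B v u" and card: "CARD('m) = 2 * n"
    and f: "symplectic_frame B n f"
    and eq: "\<And>i p. i < n \<Longrightarrow> (A::real^'m^'m) *v f i p = A' *v f i p"
  shows "A = A'"
  unfolding matrix_eq
  using linear_eq_on_frame[OF B card f matrix_vector_mul_linear matrix_vector_mul_linear eq] by blast

lemma adapted_frame_square:
  fixes B :: "real^'m \<Rightarrow> real^'m \<Rightarrow> real"
  assumes B: "bilinear B" "\<And>u v. B u v = - B v u" and card: "CARD('m) = 2 * n"
    and f: "adapted_frame B n l f A"
  shows "A *v (A *v v) = - v"
proof -
  have "A ** A = - mat 1"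
  proof (rule matrix_eq_on_frame[OF B card])
    show "symplectic_frame B n f" using f by (simp add: adapted_frame_def)
    fix i p assume "i < n"
    then have A: "A *v f i q = (if q then twist_sign l i else - twist_sign l i) *\<^sub>R f i (\<not> q)" for q
      using f by (simp add: adapted_frame_def)
    have "(- mat 1 :: real^'m^'m) *v f i p = - f i p"
      using matrix_vector_mult_diff_rdistrib[of 0 "mat 1 :: real^'m^'m" "f i p"] by simp
    then show "(A ** A) *v f i p = - mat 1 *v f i p"
      by (simp add: matrix_vector_mul_assoc[symmetric] A matrix_vector_mult_scaleR twist_sign_square)
  qed
  then have "A *v (A *v v) = (- mat 1 :: real^'m^'m) *v v" by (simp add: matrix_vector_mul_assoc)
  also have "\<dots> = - v" using matrix_vector_mult_diff_rdistrib[of 0 "mat 1 :: real^'m^'m" v] by simp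
  finally show ?thesis .
qed

lemma adapted_frame_values:
  assumes B: "bilinear B" and f: "adapted_frame B n l f A" and ik: "i < n" "k < n"
  shows "B (f i p) (A *v f k q) = (if i = k \<and> p = q then twist_sign l i else 0)"
    "B (A *v f i p) (A *v f k q) = B (f i p) (f k q)"
proof -
  have l: "linear (\<lambda>a. B a b)" "linear (B a)" for a b using B by (auto simp: bilinear_def)
  have A: "A *v f i q = (if q then twist_sign l i else - twist_sign l i) *\<^sub>R f i (\<not> q)" if "i < n" for i q
    using f that by (simp add: adapted_frame_def)
  have s: "symplectic_frame B n f" using f by (simp add: adapted_frame_def)
  show "B (f i p) (A *v f k q) = (if i = k \<and> p = q then twist_sign l i else 0)"
    using symplectic_frameD[OF s ik]
    by (auto simp: A ik linear_cmul[OF l(2)] linear_neg[OF l(2)] pairing_sign_def)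
  show "B (A *v f i p) (A *v f k q) = B (f i p) (f k q)"
    using symplectic_frameD[OF s ik] twist_sign_square[of l i]
    by (auto simp: A ik linear_cmul[OF l(2)] linear_neg[OF l(2)] linear_cmul[OF l(1)] linear_neg[OF l(1)] pairing_sign_def)
qed

lemma adapted_frame_preserves:
  fixes B :: "real^'m \<Rightarrow> real^'m \<Rightarrow> real"
  assumes B: "bilinear B" "\<And>u v. B u v = - B v u" and card: "CARD('m) = 2 * n"
    and f: "adapted_frame B n l f A"
  shows "B (A *v v) (A *v w) = B v w"
proof -
  have l: "linear (\<lambda>a. B a b)" "linear (B a)" for a b using B(1) by (auto simp: bilinear_def)
  have lA: "linear (\<lambda>a. B (A *v a) b)" "linear (\<lambda>a. B b (A *v a))" for b
    using linear_compose[OF matrix_vector_mul_linear l(1)] linear_compose[OF matrix_vector_mul_linear l(2)]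
    by (auto simp: o_def)
  have s: "symplectic_frame B n f" using f by (simp add: adapted_frame_def)
  have 1: "B (A *v f i p) (A *v w) = B (f i p) w" if "i < n" for i p w
    by (rule linear_eq_on_frame[OF B card s lA(2) l(2)]) (rule adapted_frame_values(2)[OF B(1) f that])
  show ?thesis
    by (rule linear_eq_on_frame[OF B card s lA(1) l(1)]) (rule 1)
qed

lemma local_form_eq:
  assumes M: "smooth_atlas M" and c: "c \<in> charts_at M x"
    and v: "v \<in> tangent_space M x" and w: "w \<in> tangent_space M x"
  shows "\<omega> x v w = local_form M \<omega> c (snd c x) (v c) (w c)"
  by (simp add: local_form_def chart_inv_chart[OF M charts_atD[OF c]] coord_vec_eq[OF v c] coord_vec_eq[OF w c])

lemma local_form_skew:
  assumes M: "smooth_atlas M" and c: "c \<in> charts_at M x" and \<omega>: "smooth_two_form M \<omega>"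
  shows "local_form M \<omega> c (snd c x) u v = - local_form M \<omega> c (snd c x) v u"
  using \<omega> coord_vec_tangent[OF M c] charts_at_carrier[OF c]
  unfolding smooth_two_form_def local_form_def chart_inv_chart[OF M charts_atD[OF c]] by blast

lemma local_form_bilinear:
  assumes M: "smooth_atlas M" and c: "c \<in> charts_at M x" and \<omega>: "smooth_two_form M \<omega>"
  shows "bilinear (local_form M \<omega> c (snd c x))"
proof -
  let ?B = "local_form M \<omega> c (snd c x)"
  have t: "coord_vec M x c u \<in> tangent_space M x" for u by (rule coord_vec_tangent[OF M c])
  have w: "\<forall>u\<in>tangent_space M x. \<forall>v\<in>tangent_space M x. \<forall>w\<in>tangent_space M x. \<forall>a.
        \<omega> x (u + v) w = \<omega> x u w + \<omega> x v w \<and> \<omega> x (a *\<^sub>R v) w = a * \<omega> x v w"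
    using \<omega> charts_at_carrier[OF c] unfolding smooth_two_form_def by blast
  have l: "linear (\<lambda>u. ?B u v)" for v
  proof (rule linearI)
    show "?B (u + u') v = ?B u v + ?B u' v" for u u'
      using w t unfolding local_form_def chart_inv_chart[OF M charts_atD[OF c]] linear_add[OF coord_vec_linear[OF M c]]
      by blast
    show "?B (r *\<^sub>R u) v = r *\<^sub>R ?B u v" for r u
      using w t unfolding local_form_def chart_inv_chart[OF M charts_atD[OF c]] linear_cmul[OF coord_vec_linear[OF M c]]
        real_scaleR_def by blast
  qed
  have "linear (\<lambda>v. - ?B v u)" for u
    by (rule linear_compose_neg[OF l])
  then have "linear (?B u)" for u
    using local_form_skew[OF M c \<omega>, of u] by (metis (no_types, lifting) ext)
  then show ?thesis using l by (simp add: bilinear_def)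
qed

lemma symplectic_manifoldD:
  "symplectic_manifold M \<omega> \<Longrightarrow> smooth_manifold M" "symplectic_manifold M \<omega> \<Longrightarrow> smooth_atlas M"
  "symplectic_manifold M \<omega> \<Longrightarrow> smooth_two_form M \<omega>"
  by (auto simp: symplectic_manifold_def smooth_manifold_def)

lemma local_form_nondegenerate:
  assumes M: "symplectic_manifold M \<omega>" and c: "c \<in> charts_at M x" and v: "v \<noteq> 0"
  shows "\<exists>w. local_form M \<omega> c (snd c x) v w \<noteq> 0"
proof (rule ccontr)
  note A = symplectic_manifoldD(2)[OF M]
  assume "\<not> ?thesis"
  then have "\<forall>w\<in>tangent_space M x. \<omega> x (coord_vec M x c v) w = 0"
    using local_form_eq[OF A c coord_vec_tangent[OF A c]] coord_vec_self[OF A c] by metis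
  then have "coord_vec M x c v = 0"
    using M charts_at_carrier[OF c] coord_vec_tangent[OF A c] unfolding symplectic_manifold_def by blast
  then have "coord_vec M x c v c = 0" by simp
  then show False using v coord_vec_self[OF A c] by simp
qed

text \<open>
  The frame vectors diagonalise \<open>\<omega>(\<cdot>, j\<cdot>)\<close>, with \<open>2l\<close> negative entries.
\<close>

lemma adapted_frame_in_twistor_space:
  fixes M :: "('a, real^'m) atlas"
  assumes M: "symplectic_manifold M \<omega>" and c: "c \<in> charts_at M x"
    and card: "CARD('m) = 2 * n" and l: "l \<le> n"
    and f: "adapted_frame (local_form M \<omega> c (snd c x)) n l f A"
  shows "(x, end_of M x c A) \<in> twistor_space M \<omega> n l"
proof -
  note A = symplectic_manifoldD(2)[OF M] and \<omega> = symplectic_manifoldD(3)[OF M]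
  let ?B = "local_form M \<omega> c (snd c x)" and ?j = "end_of M x c A" and ?e = "coord_vec M x c"
  note B = local_form_bilinear[OF A c \<omega>] local_form_skew[OF A c \<omega>]
  note t = coord_vec_tangent[OF A c] and s = coord_vec_self[OF A c]
  have jE: "?j \<in> End_at M x" by (rule end_of_in[OF A c])
  have jv: "?j v = ?e (A *v v c)" if "v \<in> tangent_space M x" for v using that by (simp add: end_of_def)
  have sf: "symplectic_frame ?B n f" using f by (simp add: adapted_frame_def)
  have "?j (?j v) = - v" if v: "v \<in> tangent_space M x" for v
  proof -
    have "?j (?j v) = ?e (A *v (A *v v c))" using v by (simp add: jv t s)
    also have "\<dots> = - ?e (v c)"
      by (simp add: adapted_frame_square[OF B card f] linear_neg[OF coord_vec_linear[OF A c]])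
    finally show ?thesis by (simp add: coord_vec_eq[OF v c])
  qed
  moreover have "\<omega> x (?j v) (?j w) = \<omega> x v w"
    if v: "v \<in> tangent_space M x" "w \<in> tangent_space M x" for v w
    using that by (simp add: local_form_eq[OF A c, of _ _ \<omega>] End_atD(1)[OF jE])
      (simp add: jv s adapted_frame_preserves[OF B card f])
  moreover have "has_signature (tangent_space M x) (\<lambda>v w. \<omega> x v (?j w)) (2 * n - 2 * l) (2 * l)"
  proof -
    let ?F = "\<lambda>(i, p). f i p" and ?I = "{..<n} \<times> (UNIV :: bool set)"
    let ?g = "\<lambda>k. ?e (?F k)"
    have \<omega>e: "\<omega> x (?e u) (?j (?e w)) = ?B u (A *v w)" for u w
      by (simp add: jv[OF t] s local_form_eq[OF A c t t, of \<omega>])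
    have val: "\<omega> x (?g k) (?j (?g k')) = (if k = k' then twist_sign l (fst k) else 0)"
      if "k \<in> ?I" "k' \<in> ?I" for k k'
      using adapted_frame_values(1)[OF B(1) f, of "fst k" "fst k'" "snd k" "snd k'"] that
      by (simp add: \<omega>e split_def mem_Times_iff prod_eq_iff)
    have ts: "twist_sign l i \<noteq> 0" for i by (simp add: twist_sign_def)
    have inj: "inj_on ?g ?I"
    proof (rule inj_onI, rule ccontr)
      fix k k' assume k: "k \<in> ?I" "k' \<in> ?I" "?g k = ?g k'" "k \<noteq> k'"
      have "\<omega> x (?g k) (?j (?g k)) = \<omega> x (?g k) (?j (?g k'))" using k(3) by simp
      then show False using val[OF k(1,1)] val[OF k(1,2)] k(4) ts by simp
    qed
    have injF: "inj_on ?F ?I" by (rule inj_on_imageI2[of ?e]) (use inj in \<open>simp only: o_def\<close>)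
    have spF: "span (?F ` ?I) = UNIV"
    proof -
      have "v \<in> span (?F ` ?I)" for v
        by (subst symplectic_frame_expand[OF B card sf, of v])
          (intro span_sum span_diff span_scale span_base, auto)
      then show ?thesis by auto
    qed
    have "card (?F ` ?I) = 2 * n" using card_image[OF injF] by (simp add: card_cartesian_product)
    then have "dim (UNIV :: (real^'m) set) \<ge> card (?F ` ?I)" using card by simp
    then have "independent (?F ` ?I)"
      by (intro card_le_dim_spanning[of _ UNIV]) (use spF in auto)
    then have ind: "independent (?e ` ?F ` ?I)"
      by (rule linear_independent_injective_image[OF coord_vec_linear[OF A c]]) (metis inj_onI s)
    have spn: "span (?e ` ?F ` ?I) = tangent_space M x"
    proof -
      have "span (?e ` ?F ` ?I) = range ?e"
        using linear_span_image[OF coord_vec_linear[OF A c], of "?F ` ?I"] spF by simp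
      also have "\<dots> = tangent_space M x" using t coord_vec_eq[OF _ c] by (auto simp: image_iff) metis
      finally show ?thesis .
    qed
    have un: "?e ` ?F ` ?I = ?g ` ({l..<n} \<times> UNIV) \<union> ?g ` ({..<l} \<times> UNIV)"
    proof -
      have "?I = ({l..<n} \<times> UNIV) \<union> ({..<l} \<times> UNIV)" using l by auto
      then show ?thesis by (simp only: image_Un image_image)
    qed
    have sub: "{l..<n} \<times> (UNIV :: bool set) \<subseteq> ?I" "{..<l} \<times> (UNIV :: bool set) \<subseteq> ?I" using l by auto
    have crd: "card (?g ` ({l..<n} \<times> UNIV)) = 2 * n - 2 * l" "card (?g ` ({..<l} \<times> UNIV)) = 2 * l"
      using card_image[OF inj_on_subset[OF inj sub(1)]] card_image[OF inj_on_subset[OF inj sub(2)]]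
      by (simp_all add: card_cartesian_product diff_mult_distrib2)
    have disj: "?g ` ({l..<n} \<times> UNIV) \<inter> ?g ` ({..<l} \<times> UNIV) = {}"
    proof -
      have "({l..<n} \<times> (UNIV :: bool set)) \<inter> ({..<l} \<times> UNIV) = {}" by auto
      then show ?thesis by (simp only: inj_on_image_Int[OF inj sub, symmetric] image_empty)
    qed
    have pos: "\<omega> x (?g k) (?j (?g k)) > 0" if "k \<in> {l..<n} \<times> UNIV" for k
      using val[of k k] that by (auto simp: twist_sign_def)
    have neg: "\<omega> x (?g k) (?j (?g k)) < 0" if "k \<in> {..<l} \<times> UNIV" for k
      using val[of k k] that l by (auto simp: twist_sign_def)
    have orth: "\<omega> x v (?j w) = 0" if vw: "v \<in> ?e ` ?F ` ?I" "w \<in> ?e ` ?F ` ?I" "v \<noteq> w" for v w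
    proof -
      obtain k k' where "k \<in> ?I" "v = ?g k" "k' \<in> ?I" "w = ?g k'" using vw(1,2) by blast
      then show ?thesis using val vw(3) by metis
    qed
    show ?thesis
      unfolding has_signature_def
    proof (intro exI conjI ballI impI)
      show "finite (?g ` ({l..<n} \<times> (UNIV :: bool set)))" "finite (?g ` ({..<l} \<times> (UNIV :: bool set)))"
        by (intro finite_imageI finite_cartesian_product; simp)+
      show "\<omega> x v (?j v) > 0" if "v \<in> ?g ` ({l..<n} \<times> UNIV)" for v using that pos by blast
      show "\<omega> x v (?j v) < 0" if "v \<in> ?g ` ({..<l} \<times> UNIV)" for v using that neg by blast
    qed (fact crd disj ind[unfolded un] spn[unfolded un] orth[unfolded un])+
  qed
  ultimately show ?thesis
    using jE charts_at_carrier[OF c] unfolding twistor_space_def by auto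
qed

section \<open>Tangent vectors of the twistor space\<close>

lemma chart_inv_id: "t \<in> I \<Longrightarrow> chart_inv (I, id) t = t"
  by (simp add: chart_inv_def inv_into_f_f[of id, simplified])

lemma velocity_in_tangent_space:
  fixes N :: "('a, 'e::euclidean_space) atlas"
  assumes N: "smooth_atlas N" and e: "e > 0" and \<gamma>: "smooth_map {({-e<..<e}, id)} N \<gamma>"
  shows "velocity N \<gamma> 0 \<in> tangent_space N (\<gamma> 0)"
proof (rule tangent_spaceI)
  let ?I = "{-e<..<e::real}"
  have vd: "((\<lambda>t. snd c (\<gamma> t)) has_vector_derivative velocity N \<gamma> 0 c) (at 0)"
    "open (?I \<inter> \<gamma> -` fst c)" "0 \<in> ?I \<inter> \<gamma> -` fst c"
    if c: "c \<in> charts_at N (\<gamma> 0)" for c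
  proof -
    let ?U = "?I \<inter> \<gamma> -` fst c"
    have *: "open (id ` ?U)" "smooth_on (id ` ?U) (snd c \<circ> \<gamma> \<circ> chart_inv (?I, id))"
      using \<gamma> charts_atD[OF c] by (auto simp: smooth_map_def)
    then show o: "open ?U" by simp
    show 0: "0 \<in> ?U" using e charts_atD[OF c] by simp
    have "smooth_on ?U (\<lambda>t. snd c (\<gamma> t))"
      using * by (subst smooth_on_cong[OF o, of _ "snd c \<circ> \<gamma> \<circ> chart_inv (?I, id)"]) (auto simp: chart_inv_id)
    from smooth_on_has_derivative[OF this 0] have "(\<lambda>t. snd c (\<gamma> t)) differentiable (at 0)"
      by (auto simp: differentiable_def)
    then show "((\<lambda>t. snd c (\<gamma> t)) has_vector_derivative velocity N \<gamma> 0 c) (at 0)"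
      using c by (simp add: velocity_def vector_derivative_works o_def)
  qed
  fix c c' assume c: "c \<in> charts_at N (\<gamma> 0)" "c' \<in> charts_at N (\<gamma> 0)"
  let ?D = "frechet_derivative (snd c' \<circ> chart_inv c) (at (snd c (\<gamma> 0)))"
  have "((\<lambda>p. snd c' (chart_inv c p)) has_derivative ?D) (at (snd c (\<gamma> 0)))"
    by (rule transition_has_derivative[OF N c])
  then have "((\<lambda>t. snd c' (chart_inv c (snd c (\<gamma> t)))) has_vector_derivative ?D (velocity N \<gamma> 0 c)) (at 0)"
    using vector_derivative_diff_chain_within[of "\<lambda>t. snd c (\<gamma> t)" "velocity N \<gamma> 0 c" 0 UNIV
        "\<lambda>p. snd c' (chart_inv c p)" ?D] vd(1)[OF c(1)] by (auto simp: o_def intro: has_derivative_at_withinI)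
  then have "((\<lambda>t. snd c' (\<gamma> t)) has_vector_derivative ?D (velocity N \<gamma> 0 c)) (at 0)"
    by (rule has_vector_derivative_transform_within_open[OF _ vd(2,3)[OF c(1)]])
      (auto simp: chart_inv_chart[OF N charts_atD(1)[OF c(1)]])
  then show "velocity N \<gamma> 0 c' = ?D (velocity N \<gamma> 0 c)"
    using vd(1)[OF c(2)] vector_derivative_at by metis
qed (simp add: velocity_def)

lemma submanifold_tangent_space_subset:
  "smooth_atlas N \<Longrightarrow> submanifold_tangent_space N S z \<subseteq> tangent_space N z"
  unfolding submanifold_tangent_space_def using velocity_in_tangent_space by blast

text \<open>
  Any other chart sees the curve through a smooth coordinate change.
\<close>

lemma smooth_curve_in_chart:
  fixes N :: "('a, 'e::euclidean_space) atlas"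
  assumes N: "smooth_atlas N" and k: "k \<in> N" and e: "e > 0"
    and h: "smooth_on {-e<..<e} h" "h ` {-e<..<e} \<subseteq> snd k ` fst k"
    and \<gamma>: "\<And>t. t \<in> {-e<..<e} \<Longrightarrow> \<gamma> t = chart_inv k (h t)"
    and h': "(h has_vector_derivative h') (at 0)"
  shows "smooth_map {({-e<..<e}, id)} N \<gamma>" "velocity N \<gamma> 0 k = h'"
proof -
  let ?I = "{-e<..<e}"
  have ink: "\<gamma> t \<in> fst k" "snd k (\<gamma> t) = h t" if "t \<in> ?I" for t
  proof -
    have q: "h t \<in> snd k ` fst k" using h(2) that by auto
    show "\<gamma> t \<in> fst k" "snd k (\<gamma> t) = h t"
      using chart_inv_in[OF q order_refl atlas_inj[OF N k]] chart_chart_inv[OF q] \<gamma>[OF that] by simp_all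
  qed
  show "smooth_map {(?I, id)} N \<gamma>" unfolding smooth_map_def
  proof (intro conjI ballI)
    show "\<gamma> ` carrier_of {(?I, id)} \<subseteq> carrier_of N" using ink(1) k by (auto simp: carrier_of_def)
    fix c :: "(real, real) chart" and k' assume c: "c \<in> {(?I, id)}" and k': "k' \<in> N"
    let ?S = "snd k ` (fst k \<inter> fst k')"
    note oS = atlas_open_overlap[OF N k k']
    have U: "?I \<inter> \<gamma> -` fst k' = ?I \<inter> h -` ?S"
    proof (intro set_eqI iffI)
      fix t assume "t \<in> ?I \<inter> \<gamma> -` fst k'"
      then show "t \<in> ?I \<inter> h -` ?S" using ink[of t] by (metis IntD1 IntD2 IntI imageI vimage_eq)
    next
      fix t assume t: "t \<in> ?I \<inter> h -` ?S"
      then have "chart_inv k (h t) \<in> fst k \<inter> fst k'"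
        by (intro chart_inv_in[OF _ _ atlas_inj[OF N k]]) auto
      then show "t \<in> ?I \<inter> \<gamma> -` fst k'" using t \<gamma>[of t] by auto
    qed
    have oU: "open (?I \<inter> \<gamma> -` fst k')" unfolding U
      by (rule continuous_open_preimage[OF smooth_on_continuous[OF h(1)] _ oS]) auto
    then show "open (snd c ` (fst c \<inter> \<gamma> -` fst k'))" using c by simp
    have "smooth_on (?I \<inter> \<gamma> -` fst k') (\<lambda>t. snd k' (chart_inv k (h t)))"
      by (rule smooth_on_compose[OF oU oS atlas_transition[OF N k k']])
        (use U smooth_on_subset[OF h(1)] in auto)
    then have "smooth_on (?I \<inter> \<gamma> -` fst k') (snd k' \<circ> \<gamma> \<circ> chart_inv (?I, id))"
      by (subst smooth_on_cong[OF oU]) (auto simp: chart_inv_id \<gamma>)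
    then show "smooth_on (snd c ` (fst c \<inter> \<gamma> -` fst k')) (snd k' \<circ> \<gamma> \<circ> chart_inv c)"
      using c by simp
  qed
  have "((\<lambda>t. snd k (\<gamma> t)) has_vector_derivative h') (at 0)"
    by (rule has_vector_derivative_transform_within_open[OF h', of ?I]) (use e ink(2) in auto)
  moreover have "k \<in> charts_at N (\<gamma> 0)" using ink(1)[of 0] e k by (simp add: charts_at_def)
  ultimately show "velocity N \<gamma> 0 k = h'"
    by (simp add: velocity_def o_def vector_derivative_at)
qed

text \<open>
  The hypothesis on \<open>G\<close> says that moving with velocity \<open>\<xi>\<close> while transforming vectors by \<open>-G\<close> preserves
  \<open>\<omega>\<close> to first order. So there is a curve of symplectic frames over the line with direction \<open>\<xi>\<close>, with initial
  velocities \<open>- G f\<^sub>i\<close>, and the structures adapted to these frames form a curve in the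
  twistor space whose matrix part has velocity \<open>A G - G A\<close>. With \<open>G = \<Gamma>(\<xi>)\<close> this is a horizontal
  vector, with \<open>\<xi> = 0\<close> a vertical one.
\<close>

lemma twistor_tangent_vector:
  fixes M :: "('a, real^'m) atlas"
  assumes M: "symplectic_manifold M \<omega>" and c: "c \<in> charts_at M x"
    and card: "CARD('m) = 2 * n" and l: "l \<le> n"
    and f: "adapted_frame (local_form M \<omega> c (snd c x)) n l f A"
    and G: "\<And>u v. frechet_derivative (\<lambda>p. local_form M \<omega> c p u v) (at (snd c x)) \<xi> =
      local_form M \<omega> c (snd c x) (G *v u) v + local_form M \<omega> c (snd c x) u (G *v v)"
  shows "\<exists>X \<in> submanifold_tangent_space (End_bundle M) (twistor_space M \<omega> n l) (x, end_of M x c A).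
    X (End_chart M c) = (\<xi>, A ** G - G ** A)"
proof -
  note A = symplectic_manifoldD(2)[OF M] and \<omega> = symplectic_manifoldD(3)[OF M]
  note cM = charts_atD[OF c]
  let ?p = "snd c x"
  let ?B = "local_form M \<omega> c ?p"
  note B = local_form_bilinear[OF A c \<omega>] local_form_skew[OF A c \<omega>]
  have lB: "linear (\<lambda>a. ?B a b)" "linear (?B a)" for a b using B(1) by (auto simp: bilinear_def)
  have oc: "open (snd c ` fst c)" and pc: "?p \<in> snd c ` fst c" using atlas_open[OF A cM(1)] cM by auto
  have smB: "smooth_on (snd c ` fst c) (\<lambda>p. local_form M \<omega> c p u v)" for u v
    using \<omega> cM by (auto simp: smooth_two_form_def local_form_def)
  obtain r where r: "r > 0" "ball ?p r \<subseteq> snd c ` fst c" using oc pc open_contains_ball by metis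
  \<comment> \<open>small enough for the line to stay inside the chart; the summand 1 allows \<open>\<xi> = 0\<close>\<close>
  define \<delta> where "\<delta> = r / (norm \<xi> + 1)"
  have \<delta>: "\<delta> > 0" using r by (simp add: \<delta>_def add_nonneg_pos)
  let ?I = "{-\<delta><..<\<delta>}"
  define pt where "pt t = ?p + t *\<^sub>R \<xi>" for t
  have pt: "pt t \<in> snd c ` fst c" if "t \<in> ?I" for t
  proof -
    have "\<bar>t\<bar> * norm \<xi> \<le> \<bar>t\<bar> * (norm \<xi> + 1)" by (simp add: mult_left_mono)
    also have "\<dots> < \<delta> * (norm \<xi> + 1)"
      using that by (intro mult_strict_right_mono) (auto simp: add_nonneg_pos)
    also have "\<dots> = r"
    proof -
      have "norm \<xi> + 1 \<noteq> 0" using norm_ge_zero[of \<xi>] by linarith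
      then show ?thesis by (simp add: \<delta>_def)
    qed
    finally have "pt t \<in> ball ?p r" by (simp add: pt_def dist_norm)
    then show ?thesis using r(2) by blast
  qed
  have smpt: "smooth_on S pt" if "open S" for S
    unfolding pt_def[abs_def] using that by (intro smooth_on_add smooth_on_const smooth_on_scaleR smooth_on_ident)
  have dpt: "(pt has_vector_derivative \<xi>) (at 0)"
    unfolding pt_def[abs_def] by (auto intro!: derivative_eq_intros)
  have cpt: "c \<in> charts_at M (chart_inv c (pt t))" "snd c (chart_inv c (pt t)) = pt t" if "t \<in> ?I" for t
    using chart_inv_in[OF pt[OF that] order_refl atlas_inj[OF A cM(1)]] chart_chart_inv[OF pt[OF that]] cM(1)
    by (auto simp: charts_at_def)
  \<comment> \<open>the symplectic form along the line\<close>
  define om where "om t = local_form M \<omega> c (pt t)" for t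
  have om0: "om 0 = ?B" by (simp add: om_def pt_def)
  have omb: "bilinear (om t)" "om t u v = - om t v u" if "t \<in> ?I" for t u v
    using local_form_bilinear[OF A cpt(1)[OF that] \<omega>] local_form_skew[OF A cpt(1)[OF that] \<omega>, of u v]
    by (simp_all add: om_def cpt(2)[OF that])
  have sI: "smooth_on ?I (\<lambda>t. om t u v)" for u v
    unfolding om_def by (rule smooth_on_compose[OF _ oc smB smpt]) (use pt in auto)
  define om' where "om' u v = ?B (G *v u) v + ?B u (G *v v)" for u v
  have dom: "((\<lambda>t. om t u v) has_real_derivative om' u v) (at 0)" for u v
    using has_real_derivative_along_line[OF smB[of u v], of ?p 0 \<xi>] pc G[of u v]
    by (simp add: om_def om'_def pt_def)
  have bom': "bilinear om'"
    unfolding bilinear_def om'_def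
    by (intro conjI allI linearI)
      (simp_all add: linear_add[OF lB(1)] linear_add[OF lB(2)] linear_cmul[OF lB(1)] linear_cmul[OF lB(2)]
        matrix_vector_right_distrib matrix_vector_mult_scaleR algebra_simps)
  have sf: "symplectic_frame (om 0) n f" using f by (simp add: adapted_frame_def om0)
  let ?a = "\<lambda>i p. - (G *v f i p)"
  have "\<exists>\<epsilon> F. 0 < \<epsilon> \<and> \<epsilon> \<le> \<delta> \<and>
    (\<forall>i<n. \<forall>p. smooth_on {-\<epsilon><..<\<epsilon>} (F i p) \<and> F i p 0 = f i p \<and>
      (F i p has_vector_derivative ?a i p) (at 0)) \<and>
    (\<forall>t\<in>{-\<epsilon><..<\<epsilon>}. symplectic_frame (om t) n (\<lambda>i p. F i p t))"
  proof (rule smooth_symplectic_frame[OF \<delta> omb sI dom bom' sf])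
    show "om' (f i p) (f k q) + om 0 (?a i p) (f k q) + om 0 (f i p) (?a k q) = 0" for i k p q
      by (simp add: om0 om'_def linear_neg[OF lB(1)] linear_neg[OF lB(2)])
  qed
  then obtain e F where F': "0 < e \<and> e \<le> \<delta> \<and>
    (\<forall>i<n. \<forall>p. smooth_on {-e<..<e} (F i p) \<and> F i p 0 = f i p \<and>
      (F i p has_vector_derivative ?a i p) (at 0)) \<and>
    (\<forall>t\<in>{-e<..<e}. symplectic_frame (om t) n (\<lambda>i p. F i p t))"
    by (elim exE) (rule that)
  then have e: "e > 0" "e \<le> \<delta>" by auto
  have F: "smooth_on {-e<..<e} (F i p)" "F i p 0 = f i p" "(F i p has_vector_derivative ?a i p) (at 0)"
    if "i < n" for i p using F' that by auto
  let ?J = "{-e<..<e}"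
  have J: "open ?J" "0 \<in> ?J" "?J \<subseteq> ?I" using e by auto
  define At where "At t = frame_structure (om t) n l (\<lambda>i p. F i p t)" for t
  have At: "adapted_frame (om t) n l (\<lambda>i p. F i p t) (At t)" if "t \<in> ?J" for t
    unfolding At_def using F' that J(3) by (intro adapted_frame_structure omb(1)) auto
  have smA: "smooth_on ?J At" unfolding At_def frame_structure_def
  proof (rule smooth_on_matrix[OF J(1)], intro smooth_on_sum J(1) smooth_on_scaleR smooth_on_const smooth_on_add)
    fix u i assume i: "i \<in> {..<n}"
    have "smooth_on ?J (\<lambda>t. om t u (F i p t))" for p
      by (rule smooth_on_bilinear_family[where B = om, OF J(1) omb(1)[OF subsetD[OF J(3)]]
            smooth_on_subset[OF sI J(3)] smooth_on_const]) (use F(1) i in auto)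
    then show "smooth_on ?J (\<lambda>t. om t u (F i False t))" "smooth_on ?J (\<lambda>t. om t u (F i True t))" by blast+
  qed (use F(1) in auto)
  have A0: "At 0 = A"
  proof (rule matrix_eq_on_frame[OF B card])
    show "symplectic_frame ?B n f" using f by (simp add: adapted_frame_def)
    show "At 0 *v f i p = A *v f i p" if i: "i < n" for i p
    proof -
      have "At 0 *v F i p 0 = (if p then twist_sign l i else - twist_sign l i) *\<^sub>R F i (\<not> p) 0"
        using At[OF J(2)] i by (simp only: adapted_frame_def)
      moreover have "A *v f i p = (if p then twist_sign l i else - twist_sign l i) *\<^sub>R f i (\<not> p)"
        using f i by (simp only: adapted_frame_def)
      ultimately show ?thesis by (simp only: F(2)[OF i])
    qed
  qed
  obtain A' where A': "(At has_vector_derivative A') (at 0)"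
    using smooth_on_has_derivative[OF smA J(2)] vector_derivative_works differentiable_def by blast
  have "A' = A ** G - G ** A"
  proof (rule matrix_eq_on_frame[OF B card])
    show "symplectic_frame ?B n f" using f by (simp add: adapted_frame_def)
    fix i p assume i: "i < n"
    define s where "s = (if p then twist_sign l i else - twist_sign l i)"
    have 1: "((\<lambda>t. At t *v F i p t) has_vector_derivative At 0 *v ?a i p + A' *v F i p 0) (at 0)"
      by (rule bounded_bilinear.has_vector_derivative[OF bounded_bilinear_matrix_vector_mult A' F(3)[OF i]])
    have 2: "((\<lambda>t. s *\<^sub>R F i (\<not> p) t) has_vector_derivative s *\<^sub>R ?a i (\<not> p)) (at 0)"
      using has_vector_derivative_scaleR[OF DERIV_const F(3)[OF i, of "\<not> p"], of s] by simp
    have "((\<lambda>t. At t *v F i p t) has_vector_derivative s *\<^sub>R ?a i (\<not> p)) (at 0)"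
      by (rule has_vector_derivative_transform_within_open[OF 2 J(1,2)])
        (use At i in \<open>auto simp: adapted_frame_def s_def\<close>)
    from vector_derivative_unique_at[OF 1 this]
    have "A' *v f i p = s *\<^sub>R ?a i (\<not> p) - A *v ?a i p"
      by (simp add: F(2)[OF i] A0 algebra_simps)
    also have "s *\<^sub>R ?a i (\<not> p) = - (G *v (A *v f i p))"
      using f i by (simp add: adapted_frame_def s_def matrix_vector_mult_scaleR)
    finally show "A' *v f i p = (A ** G - G ** A) *v f i p"
      using matrix_vector_mult_diff_distrib[of A 0 "G *v f i p"]
      by (simp add: matrix_vector_mult_diff_rdistrib matrix_vector_mul_assoc[symmetric])
  qed
  let ?h = "\<lambda>t. (pt t, At t)"
  have h: "smooth_on ?J ?h" by (intro smooth_on_Pair J smpt smA)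
  have h': "(?h has_vector_derivative (\<xi>, A')) (at 0)"
    by (rule has_vector_derivative_Pair[OF dpt A'])
  let ?k = "End_chart M c"
  define \<gamma> where "\<gamma> t = chart_inv ?k (?h t)" for t
  have k: "?k \<in> End_bundle M" using cM by (simp add: End_bundle_def)
  have him: "?h ` ?J \<subseteq> snd ?k ` fst ?k"
    using pt J(3) End_chart_image[OF A cM(1) order_refl] by (auto simp: End_chart_simps)
  have \<gamma>_eq: "\<gamma> t = (chart_inv c (pt t), end_of M (chart_inv c (pt t)) c (At t))" if "t \<in> ?J" for t
    unfolding \<gamma>_def using End_chart_inv[OF A cM(1) pt] J(3) that by blast
  have "\<gamma> ` ?J \<subseteq> twistor_space M \<omega> n l"
  proof (rule image_subsetI)
    fix t assume t: "t \<in> ?J"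
    then have tI: "t \<in> ?I" using J(3) by blast
    have "adapted_frame (local_form M \<omega> c (snd c (chart_inv c (pt t)))) n l (\<lambda>i p. F i p t) (At t)"
      using At[OF t] by (simp add: om_def cpt(2)[OF tI])
    from adapted_frame_in_twistor_space[OF M cpt(1)[OF tI] card l this]
    show "\<gamma> t \<in> twistor_space M \<omega> n l" by (simp add: \<gamma>_eq[OF t])
  qed
  moreover have "\<gamma> 0 = (x, end_of M x c A)"
    using \<gamma>_eq[OF J(2)] A0 chart_inv_chart[OF A cM] by (simp add: pt_def)
  moreover have "smooth_map {(?J, id)} (End_bundle M) \<gamma>" "velocity (End_bundle M) \<gamma> 0 ?k = (\<xi>, A')"
    using smooth_curve_in_chart[OF smooth_atlas_End_bundle[OF A] k e(1) h him _ h'] by (auto simp: \<gamma>_def)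
  ultimately show ?thesis
    using e(1) \<open>A' = A ** G - G ** A\<close> unfolding submanifold_tangent_space_def by blast
qed

section \<open>The almost complex structure in coordinates\<close>

lemma vertical_lift_in_chart:
  assumes M: "smooth_atlas M" and c: "c \<in> charts_at M x" and j: "j \<in> End_at M x" and B: "B \<in> End_at M x"
  shows "vertical_lift M (x, j) B \<in> tangent_space (End_bundle M) (x, j)"
    "vertical_lift M (x, j) B (End_chart M c) = (0, mat_of M x c B)"
proof -
  note cM = charts_atD[OF c]
  let ?h = "\<lambda>t::real. (snd c x, mat_of M x c j + t *\<^sub>R mat_of M x c B)"
  let ?\<gamma> = "\<lambda>t::real. (x, j + t *\<^sub>R B)"
  have E: "end_of M x c (mat_of M x c j + t *\<^sub>R mat_of M x c B) = j + t *\<^sub>R B" for t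
  proof
    fix v
    note l = coord_vec_linear[OF M c]
    have "end_of M x c (mat_of M x c j + t *\<^sub>R mat_of M x c B) v =
        end_of M x c (mat_of M x c j) v + t *\<^sub>R end_of M x c (mat_of M x c B) v"
    proof (cases "v \<in> tangent_space M x")
      case True
      then show ?thesis
        by (simp only: end_of_def if_True matrix_vector_mult_add_rdistrib linear_add[OF l]
            scaleR_matrix_vector_assoc[symmetric] linear_cmul[OF l])
    qed (simp add: end_of_def)
    then show "end_of M x c (mat_of M x c j + t *\<^sub>R mat_of M x c B) v = (j + t *\<^sub>R B) v"
      unfolding end_of_mat_of[OF M c j] end_of_mat_of[OF M c B] by (simp add: scaleR_fun_def)
  qed
  have \<gamma>: "?\<gamma> t = chart_inv (End_chart M c) (?h t)" for t
    using End_chart_inv[OF M cM(1), of "snd c x"] E cM(2) chart_inv_chart[OF M cM] by simp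
  have k: "End_chart M c \<in> End_bundle M" using cM by (simp add: End_bundle_def)
  have h: "smooth_on {-1<..<1} ?h"
    by (intro smooth_on_Pair smooth_on_const smooth_on_add smooth_on_scaleR smooth_on_ident) auto
  have him: "?h ` {-1<..<1} \<subseteq> snd (End_chart M c) ` fst (End_chart M c)"
    using End_chart_image[OF M cM(1) order_refl] cM(2) by (auto simp: End_chart_simps)
  have h': "(?h has_vector_derivative (0, mat_of M x c B)) (at 0)"
    by (auto intro!: derivative_eq_intros has_vector_derivative_Pair)
  note cv = smooth_curve_in_chart[OF smooth_atlas_End_bundle[OF M] k zero_less_one h him \<gamma> h']
  show "vertical_lift M (x, j) B \<in> tangent_space (End_bundle M) (x, j)"
    using velocity_in_tangent_space[OF smooth_atlas_End_bundle[OF M] zero_less_one cv(1)]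
    by (simp add: vertical_lift_def)
  show "vertical_lift M (x, j) B (End_chart M c) = (0, mat_of M x c B)"
    using cv(2) by (simp add: vertical_lift_def)
qed

lemma pullback_connection_in_chart:
  fixes M :: "('a, real^'m) atlas"
  assumes M: "smooth_manifold M" and D: "linear_connection M D" and x: "x \<in> carrier_of M"
    and c_def: "c = some_chart M x" and j: "j \<in> End_at M x"
    and X: "X \<in> tangent_space (End_bundle M) (x, j)"
    and S: "((\<lambda>q. S (chart_inv (End_chart M c) q) c) has_derivative S') (at (snd (End_chart M c) (x, j)))"
  shows "pullback_connection (End_bundle M) M fst D (x, j) X S \<in> tangent_space M x"
    "pullback_connection (End_bundle M) M fst D (x, j) X S c =
      S' (X (End_chart M c)) + christoffel M D x c (fst (X (End_chart M c))) (S (x, j) c)"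
proof -
  note A = smooth_manifold_atlas[OF M]
  have c: "c \<in> charts_at M x" using some_chart_in[OF x] by (simp add: c_def)
  let ?\<xi> = "fst (X (End_chart M c))"
  let ?cov = "\<lambda>b. cov_deriv M D x (coord_vec M x c ?\<xi>) (coord_field M x c b)"
  have dd: "dir_deriv (End_bundle M) (\<lambda>w. S w c \<bullet> b) (x, j) X = S' (X (End_chart M c)) \<bullet> b" for b
    by (rule dir_deriv_eq[OF smooth_atlas_End_bundle[OF A] End_charts_at[OF c j] X
          has_derivative_inner_left[OF S]])
  have eq: "pullback_connection (End_bundle M) M fst D (x, j) X S =
      (\<Sum>b\<in>Basis. (S' (X (End_chart M c)) \<bullet> b) *\<^sub>R coord_vec M x c b + (S (x, j) c \<bullet> b) *\<^sub>R ?cov b)"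
    by (simp only: pullback_connection_def Let_def fst_conv c_def[symmetric] dd d_pi_in_chart[OF A c j X])
  show "pullback_connection (End_bundle M) M fst D (x, j) X S \<in> tangent_space M x"
    unfolding eq
    by (intro subspace_sum[OF tangent_subspace[OF A]] tangent_add[OF A] tangent_scale[OF A]
        coord_vec_tangent[OF A c] cov_deriv_tangent[OF M D coord_field_props(1)[OF M c]])
  show "pullback_connection (End_bundle M) M fst D (x, j) X S c =
      S' (X (End_chart M c)) + christoffel M D x c (fst (X (End_chart M c))) (S (x, j) c)"
    unfolding eq sum_fun_at
    by (simp add: scaleR_fun_def coord_vec_self[OF A c] sum.distrib euclidean_representation christoffel_def)
qed

lemma End_chart_fun_has_derivative:
  fixes M :: "('a, real^'m) atlas"
  assumes M: "smooth_atlas M" and c: "c \<in> charts_at M x" and j: "j \<in> End_at M x"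
    and g: "(g has_derivative g') (at (snd (End_chart M c) (x, j)))"
    and S: "\<And>y A. y \<in> fst c \<Longrightarrow> S (y, end_of M y c A) = g (snd c y, A)"
  shows "((\<lambda>q. S (chart_inv (End_chart M c) q)) has_derivative g') (at (snd (End_chart M c) (x, j)))"
proof (rule has_derivative_transform_within_open[OF g])
  note cM = charts_atD[OF c]
  let ?U = "(snd c ` fst c) \<times> (UNIV :: (real^'m^'m) set)"
  show "open ?U" using atlas_open[OF M cM(1)] by (simp add: open_Times)
  show "snd (End_chart M c) (x, j) \<in> ?U" using cM by (simp add: End_chart_simps)
  fix q assume "q \<in> ?U"
  then obtain p A where q: "q = (p, A)" and p: "p \<in> snd c ` fst c" by (cases q) auto
  show "g q = S (chart_inv (End_chart M c) q)"
    using S[OF chart_inv_in[OF p order_refl atlas_inj[OF M cM(1)]], of A]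
    by (simp add: q End_chart_inv[OF M cM(1) p] chart_chart_inv[OF p])
qed

text \<open>
  The familiar formula \<open>\<nabla>j = dj + [\<Gamma>, j]\<close>.
\<close>

lemma tautological_derivative_in_chart:
  fixes M :: "('a, real^'m) atlas"
  assumes M: "smooth_manifold M" and D: "linear_connection M D" and x: "x \<in> carrier_of M"
    and c_def: "c = some_chart M x" and j: "j \<in> End_at M x"
    and X: "X \<in> tangent_space (End_bundle M) (x, j)" "X (End_chart M c) = (\<xi>, B)"
    and v: "v \<in> tangent_space M x"
  shows "pullback_connection_End (End_bundle M) M fst D (x, j) X snd v \<in> tangent_space M x"
    "pullback_connection_End (End_bundle M) M fst D (x, j) X snd v c =
      B *v v c + christoffel M D x c \<xi> (mat_of M x c j *v v c) - mat_of M x c j *v christoffel M D x c \<xi> (v c)"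
proof -
  note A = smooth_manifold_atlas[OF M]
  have c: "c \<in> charts_at M x" using some_chart_in[OF x] by (simp add: c_def)
  have cy: "c \<in> charts_at M y" if "y \<in> fst c" for y using that charts_atD(1)[OF c] by (simp add: charts_at_def)
  let ?s = "\<lambda>w :: ('a, real^'m) tendo. coord_vec M (fst w) c (v c)"
  let ?P = "pullback_connection (End_bundle M) M fst D (x, j) X"
  have d1: "((\<lambda>q. snd (chart_inv (End_chart M c) q) (?s (chart_inv (End_chart M c) q)) c) has_derivative
      (\<lambda>q. snd q *v v c)) (at (snd (End_chart M c) (x, j)))"
  proof (rule End_chart_fun_has_derivative[OF A c j])
    show "((\<lambda>q. snd q *v v c) has_derivative (\<lambda>q. snd q *v v c)) (at (snd (End_chart M c) (x, j)))"
      by (rule bounded_linear.has_derivative[OF bounded_linear_compose[OF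
            bounded_bilinear.bounded_linear_left[OF bounded_bilinear_matrix_vector_mult] bounded_linear_snd]
            has_derivative_ident, simplified o_def])
    show "snd (y, end_of M y c A') (?s (y, end_of M y c A')) c = snd (snd c y, A') *v v c"
      if "y \<in> fst c" for y A'
      by (simp add: end_of_def coord_vec_tangent[OF A cy[OF that]] coord_vec_self[OF A cy[OF that]])
  qed
  have d2: "((\<lambda>q. ?s (chart_inv (End_chart M c) q) c) has_derivative (\<lambda>q. 0)) (at (snd (End_chart M c) (x, j)))"
    by (rule End_chart_fun_has_derivative[OF A c j has_derivative_const[of "v c"]])
      (simp add: coord_vec_self[OF A cy])
  note p1 = pullback_connection_in_chart[OF M D x c_def j X(1), of "\<lambda>w. snd w (?s w)", OF d1]
  note p2 = pullback_connection_in_chart[OF M D x c_def j X(1), of ?s, OF d2]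
  have eq: "pullback_connection_End (End_bundle M) M fst D (x, j) X snd v = ?P (\<lambda>w. snd w (?s w)) - j (?P ?s)"
    using v by (simp only: pullback_connection_End_def Let_def fst_conv snd_conv if_True c_def[symmetric])
  have jp: "j (?P ?s) c = mat_of M x c j *v (?P ?s c)" by (rule mat_of_apply[OF A c j p2(1), symmetric])
  show "pullback_connection_End (End_bundle M) M fst D (x, j) X snd v \<in> tangent_space M x"
    unfolding eq by (intro subspace_diff[OF tangent_subspace[OF A]] p1(1) End_atD(1)[OF j] p2(1))
  show "pullback_connection_End (End_bundle M) M fst D (x, j) X snd v c =
      B *v v c + christoffel M D x c \<xi> (mat_of M x c j *v v c) - mat_of M x c j *v christoffel M D x c \<xi> (v c)"
    unfolding eq minus_apply jp p1(2) p2(2)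
    by (simp add: X(2) coord_vec_self[OF A c] coord_vec_eq[OF v c] mat_of_apply[OF A c j v])
qed

lemma horizontal_in_chart:
  fixes M :: "('a, real^'m) atlas"
  assumes M: "smooth_manifold M" and D: "linear_connection M D" and x: "x \<in> carrier_of M"
    and c_def: "c = some_chart M x" and j: "j \<in> End_at M x"
    and X: "X \<in> submanifold_tangent_space (End_bundle M) Z (x, j)" "X (End_chart M c) = (\<xi>, B)"
  shows "X \<in> horizontal M Z D (x, j) \<longleftrightarrow> (\<forall>u. B *v u + christoffel M D x c \<xi> (mat_of M x c j *v u) -
    mat_of M x c j *v christoffel M D x c \<xi> u = 0)"
proof -
  note A = smooth_manifold_atlas[OF M]
  have c: "c \<in> charts_at M x" using some_chart_in[OF x] by (simp add: c_def)
  have XT: "X \<in> tangent_space (End_bundle M) (x, j)"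
    using submanifold_tangent_space_subset[OF smooth_atlas_End_bundle[OF A]] X(1) by blast
  let ?P = "pullback_connection_End (End_bundle M) M fst D (x, j) X snd"
  note t = tautological_derivative_in_chart[OF M D x c_def j XT X(2)]
  have "?P = 0 \<longleftrightarrow> (\<forall>v\<in>tangent_space M x. ?P v c = 0)"
  proof
    assume *: "\<forall>v\<in>tangent_space M x. ?P v c = 0"
    show "?P = 0"
    proof
      fix v show "?P v = 0 v"
      proof (cases "v \<in> tangent_space M x")
        case True
        have "?P v = 0"
          by (rule tangent_vec_eqI[OF t(1)[OF True] tangent_zero[OF A] c]) (use * True in simp)
        then show ?thesis by simp
      qed (simp add: pullback_connection_End_def)
    qed
  qed simp
  also have "\<dots> \<longleftrightarrow> (\<forall>u. B *v u + christoffel M D x c \<xi> (mat_of M x c j *v u) -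
    mat_of M x c j *v christoffel M D x c \<xi> u = 0)"
  proof
    assume *: "\<forall>v\<in>tangent_space M x. ?P v c = 0"
    show "\<forall>u. B *v u + christoffel M D x c \<xi> (mat_of M x c j *v u) - mat_of M x c j *v christoffel M D x c \<xi> u = 0"
    proof
      fix u
      show "B *v u + christoffel M D x c \<xi> (mat_of M x c j *v u) - mat_of M x c j *v christoffel M D x c \<xi> u = 0"
        using * t(2)[OF coord_vec_tangent[OF A c, of u]] coord_vec_tangent[OF A c, of u]
        by (simp add: coord_vec_self[OF A c])
    qed
  qed (simp add: t(2))
  finally show ?thesis using X(1) by (simp add: horizontal_def)
qed

text \<open>
  A horizontal vector is determined by its projection, so the vectors that occur in the definition are unique
  as soon as they exist. Their existence is what \<open>H\<close>, \<open>V\<close> and \<open>W\<close> provide.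
\<close>

lemma twistor_J_in_chart:
  fixes M :: "('a, real^'m) atlas" and Z D x j
  defines "T \<equiv> submanifold_tangent_space (End_bundle M) Z (x, j)"
  assumes M: "smooth_manifold M" and D: "linear_connection M D" and x: "x \<in> carrier_of M"
    and c_def: "c = some_chart M x" and j: "j \<in> End_at M x" and A_def: "A = mat_of M x c j"
 and X: "X \<in> tangent_space (End_bundle M) (x, j)" "X (End_chart M c) = (\<xi>, B)"
    and H: "H \<in> horizontal M Z D (x, j)" "H (End_chart M c) = (\<xi>, BH)"
    and V: "V \<in> T" "V (End_chart M c) = (0, B - BH)"
    and W: "W \<in> horizontal M Z D (x, j)" "W (End_chart M c) = (A *v \<xi>, BW)"
  shows "twistor_J M Z D (x, j) X (End_chart M c) = (A *v \<xi>, BW + A ** (B - BH))"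
    "twistor_J M Z D (x, j) X \<in> tangent_space (End_bundle M) (x, j)"
proof -
  note At = smooth_manifold_atlas[OF M]
  note EA = smooth_atlas_End_bundle[OF At]
  have c: "c \<in> charts_at M x" using some_chart_in[OF x] by (simp add: c_def)
  note k = End_charts_at[OF c j]
  let ?k = "End_chart M c"
  have TT: "Y \<in> tangent_space (End_bundle M) (x, j)" if "Y \<in> T" for Y
    using that submanifold_tangent_space_subset[OF EA] unfolding T_def by blast
  have hT: "Y \<in> T" if "Y \<in> horizontal M Z D (x, j)" for Y
    using that by (simp add: horizontal_def T_def)
  have hor_unique: "Y = Y'" if Y: "Y \<in> horizontal M Z D (x, j)" "Y' \<in> horizontal M Z D (x, j)"
    "fst (Y ?k) = fst (Y' ?k)" for Y Y'
  proof (rule tangent_vec_eqI[OF TT[OF hT[OF Y(1)]] TT[OF hT[OF Y(2)]] k])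
    obtain \<eta> C C' where e: "Y ?k = (\<eta>, C)" "Y' ?k = (\<eta>, C')" using Y(3) by (metis prod.collapse)
    have "C *v u + christoffel M D x c \<eta> (mat_of M x c j *v u) - mat_of M x c j *v christoffel M D x c \<eta> u = 0"
      "C' *v u + christoffel M D x c \<eta> (mat_of M x c j *v u) - mat_of M x c j *v christoffel M D x c \<eta> u = 0" for u
      using horizontal_in_chart[OF M D x c_def j hT[OF Y(1), unfolded T_def] e(1)] Y(1)
        horizontal_in_chart[OF M D x c_def j hT[OF Y(2), unfolded T_def] e(2)] Y(2) by blast+
    moreover have "a = a'" if "a + b - d = 0" "a' + b - d = 0" for a a' b d :: "real^'m"
      using that by (metis add_right_cancel eq_iff_diff_eq_0)
    ultimately have "C *v u = C' *v u" for u by blast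
    then have "C = C'" by (simp add: matrix_eq)
    then show "Y ?k = Y' ?k" using e by simp
  qed
  have dpi: "d_pi M (x, j) Y = coord_vec M x c (fst (Y ?k))" if "Y \<in> tangent_space (End_bundle M) (x, j)" for Y
    by (rule d_pi_in_chart[OF At c j that])
  have cv_inj: "coord_vec M x c u = coord_vec M x c w \<Longrightarrow> u = w" for u w
    using coord_vec_self[OF At c] by metis
  have HX: "X - H = V"
  proof (rule tangent_vec_eqI[OF subspace_diff[OF tangent_subspace[OF EA] X(1) TT[OF hT[OF H(1)]]] TT[OF V(1)] k])
    show "(X - H) ?k = V ?k" unfolding minus_apply by (simp add: X(2) H(2) V(2))
  qed
  have Vv: "V \<in> vertical M Z (x, j)"
    using V(1) dpi[OF TT[OF V(1)]] V(2) linear_0[OF coord_vec_linear[OF At c]]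
    by (simp add: vertical_def T_def)
  have "(THE H. H \<in> horizontal M Z D (x, j) \<and> X - H \<in> vertical M Z (x, j)) = H"
  proof (rule the_equality)
    show "H \<in> horizontal M Z D (x, j) \<and> X - H \<in> vertical M Z (x, j)" using H(1) Vv by (simp only: HX)
    fix H' assume H': "H' \<in> horizontal M Z D (x, j) \<and> X - H' \<in> vertical M Z (x, j)"
    have d: "X - H' \<in> tangent_space (End_bundle M) (x, j)"
      by (rule subspace_diff[OF tangent_subspace[OF EA] X(1) TT[OF hT]]) (use H' in blast)
    have "d_pi M (x, j) (X - H') = 0" using H' by (simp only: vertical_def mem_Collect_eq)
    then have "coord_vec M x c (fst ((X - H') ?k)) = coord_vec M x c 0"
      by (simp only: dpi[OF d] linear_0[OF coord_vec_linear[OF At c]])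
    then have "fst ((X - H') ?k) = 0" by (rule cv_inj)
    then have "fst (H' ?k) = fst (H ?k)" unfolding minus_apply by (simp add: X(2) H(2))
    then show "H' = H" using hor_unique H(1) H' by blast
  qed
  moreover have "J_horizontal M Z D (x, j) H = W"
    unfolding J_horizontal_def
  proof (rule the_equality)
    have "coord_vec M x c (A *v \<xi>) = j (coord_vec M x c \<xi>)"
    proof -
      note t = coord_vec_tangent[OF At c, of \<xi>]
      have "j (coord_vec M x c \<xi>) c = A *v \<xi>"
        using mat_of_apply[OF At c j t] by (simp add: A_def coord_vec_self[OF At c])
      then show ?thesis using coord_vec_eq[OF End_atD(1)[OF j t] c] by simp
    qed
    then have eq: "snd (x, j) (d_pi M (x, j) H) = coord_vec M x c (A *v \<xi>)"
      using dpi[OF TT[OF hT[OF H(1)]]] H(2) by simp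
    show "W \<in> horizontal M Z D (x, j) \<and> d_pi M (x, j) W = snd (x, j) (d_pi M (x, j) H)"
      using W(1) dpi[OF TT[OF hT[OF W(1)]]] W(2) eq by simp
    fix W' assume W': "W' \<in> horizontal M Z D (x, j) \<and> d_pi M (x, j) W' = snd (x, j) (d_pi M (x, j) H)"
    then have "coord_vec M x c (fst (W' ?k)) = coord_vec M x c (A *v \<xi>)"
      using dpi[OF TT[OF hT]] eq by metis
    then have "fst (W' ?k) = fst (W ?k)" using cv_inj W(2) by simp
    then show "W' = W" using hor_unique W(1) W' by blast
  qed
  moreover have Jv: "J_vertical M (x, j) V ?k = (0, A ** (B - BH))"
    "J_vertical M (x, j) V \<in> tangent_space (End_bundle M) (x, j)"
  proof -
    let ?C = "end_of M x c (B - BH)"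
    have C: "?C \<in> End_at M x" by (rule end_of_in[OF At c])
    have "(THE B'. B' \<in> End_at M (fst (x, j)) \<and> vertical_lift M (x, j) B' = V) = ?C"
    proof (rule the_equality)
      have "vertical_lift M (x, j) ?C = V"
        by (rule tangent_vec_eqI[OF vertical_lift_in_chart(1)[OF At c j C] TT[OF V(1)] k])
          (simp add: vertical_lift_in_chart(2)[OF At c j C] V(2) mat_of_end_of[OF At c])
      then show "?C \<in> End_at M (fst (x, j)) \<and> vertical_lift M (x, j) ?C = V" using C by simp
      fix B' assume B': "B' \<in> End_at M (fst (x, j)) \<and> vertical_lift M (x, j) B' = V"
      then have "mat_of M x c B' = B - BH"
        using vertical_lift_in_chart(2)[OF At c j, of B'] V(2) by simp
      then show "B' = ?C" using end_of_mat_of[OF At c, of B'] B' by simp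
    qed
    then have eq: "J_vertical M (x, j) V = vertical_lift M (x, j) (j \<circ> ?C)"
      by (simp only: J_vertical_def snd_conv)
    have jl: "j 0 = 0"
      using End_atD(3)[OF j tangent_zero[OF At], of 0] by simp
    \<comment> \<open>the composition is again 0 outside the tangent space because \<open>j\<close> maps 0 to 0\<close>
    have comp: "j \<circ> ?C = end_of M x c (A ** (B - BH))"
    proof
      fix v
      show "(j \<circ> ?C) v = end_of M x c (A ** (B - BH)) v"
      proof (cases "v \<in> tangent_space M x")
        case True
        note t = coord_vec_tangent[OF At c, of "(B - BH) *v v c"]
        have "j (?C v) c = A *v ((B - BH) *v v c)"
          using mat_of_apply[OF At c j t] True
          by (simp add: A_def coord_vec_self[OF At c] end_of_def)
        then have "j (?C v) = coord_vec M x c (A *v ((B - BH) *v v c))"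
          using coord_vec_eq[OF End_atD(1)[OF j End_atD(1)[OF C True]] c] by simp
        then show ?thesis using True by (simp add: end_of_def[of M x c "A ** _"] matrix_vector_mul_assoc)
      next
        case False
        then have "?C v = 0" "end_of M x c (A ** (B - BH)) v = 0" by (simp_all add: end_of_def)
        then show ?thesis using jl by (simp only: o_apply)
      qed
    qed
    show "J_vertical M (x, j) V ?k = (0, A ** (B - BH))"
      unfolding eq comp vertical_lift_in_chart(2)[OF At c j end_of_in[OF At c]] mat_of_end_of[OF At c] ..
    show "J_vertical M (x, j) V \<in> tangent_space (End_bundle M) (x, j)"
      unfolding eq comp by (rule vertical_lift_in_chart(1)[OF At c j end_of_in[OF At c]])
  qed
  ultimately have J: "twistor_J M Z D (x, j) X = W + J_vertical M (x, j) V"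
    unfolding twistor_J_def Let_def by (simp only: HX)
  show "twistor_J M Z D (x, j) X (End_chart M c) = (A *v \<xi>, BW + A ** (B - BH))"
    unfolding J plus_fun_apply[of W] by (simp add: W(2) Jv(1))
  show "twistor_J M Z D (x, j) X \<in> tangent_space (End_bundle M) (x, j)"
    unfolding J by (rule tangent_add[OF EA TT[OF hT[OF W(1)]] Jv(2)])
qed

section \<open>The symmetric cubic form of a difference tensor\<close>

text \<open>
  The hypothesis yields \<open>T(\<xi>, \<xi>, \<xi>) = 3 T(A\<xi>, A\<xi>, \<xi>)\<close> for the symmetric cubic form
  \<open>T(u, v, w) = B(S(u)v, w)\<close>. Two structures \<open>A\<close> for which \<open>A v\<close> differs by a factor other than
  \<open>\<plusminus> 1\<close> then give \<open>T(v, v, v) = 0\<close>.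
\<close>

lemma cubic_form_vanishes:
  fixes B :: "real^'m \<Rightarrow> real^'m \<Rightarrow> real" and S :: "real^'m \<Rightarrow> real^'m \<Rightarrow> real^'m"
  assumes B: "bilinear B" "\<And>u v. B u v = - B v u" and nd: "\<And>v. v \<noteq> 0 \<Longrightarrow> \<exists>w. B v w \<noteq> 0"
    and card: "CARD('m) = 2 * n"
    and S: "\<And>u. linear (S u)" "\<And>u v. S u v = S v u" "\<And>u v w. B (S u v) w + B v (S u w) = 0"
    and eq: "\<And>f A \<xi> u. adapted_frame B n l f A \<Longrightarrow>
      A *v S (A *v \<xi>) u - S (A *v \<xi>) (A *v u) = A *v (A *v S \<xi> u - S \<xi> (A *v u))"
  shows "S u v = 0"
proof -
  have lB: "linear (\<lambda>a. B a b)" "linear (B a)" for a b using B(1) by (auto simp: bilinear_def)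
  define T where "T u v w = B (S u v) w" for u v w
  have T12: "T u v w = T v u w" for u v w by (simp add: T_def S(2)[of u v])
  have T23: "T u v w = T u w v" for u v w
    using S(3)[of u v w] B(2)[of v "S u w"] by (simp add: T_def)
  have Ta: "T u v (w + w') = T u v w + T u v w'" "T u v (r *\<^sub>R w) = r * T u v w" for u v w w' r
    by (simp_all add: T_def linear_add[OF lB(2)] linear_cmul[OF lB(2)])
  have Ta2: "T u (w + w') v = T u w v + T u w' v" "T u (r *\<^sub>R w) v = r * T u w v" for u v w w' r
    by (simp_all add: T23[of u _ v] Ta)
  have Ta1: "T (w + w') u v = T w u v + T w' u v" "T (r *\<^sub>R w) u v = r * T w u v" for u v w w' r
    by (simp_all add: T12[of _ u v] Ta2)
  have three: "T \<xi> \<xi> \<xi> = 3 * T (A *v \<xi>) (A *v \<xi>) \<xi>" if f: "adapted_frame B n l f A" for f A \<xi>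
  proof -
    have BA: "B (A *v a) b = - B a (A *v b)" for a b
      using adapted_frame_preserves[OF B card f, of "A *v a" b] adapted_frame_square[OF B card f, of a]
      by (simp add: linear_neg[OF lB(1)])
    have "B (A *v S (A *v \<xi>) \<xi> - S (A *v \<xi>) (A *v \<xi>)) \<xi> = B (A *v (A *v S \<xi> \<xi> - S \<xi> (A *v \<xi>))) \<xi>"
      by (simp only: eq[OF f])
    then have "- T (A *v \<xi>) \<xi> (A *v \<xi>) - T (A *v \<xi>) (A *v \<xi>) \<xi> = - T \<xi> \<xi> \<xi> + T \<xi> (A *v \<xi>) (A *v \<xi>)"
      by (simp add: matrix_vector_mult_diff_distrib adapted_frame_square[OF B card f] linear_diff[OF lB(1)]
          linear_neg[OF lB(1)] BA T_def)
    moreover have "T (A *v \<xi>) \<xi> (A *v \<xi>) = T (A *v \<xi>) (A *v \<xi>) \<xi>" by (rule T23)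
    moreover have "T \<xi> (A *v \<xi>) (A *v \<xi>) = T (A *v \<xi>) (A *v \<xi>) \<xi>" using T12 T23 by metis
    ultimately show ?thesis by linarith
  qed
  have n: "0 < n" using card zero_less_card_finite[where 'a = 'm] by simp
  have cube: "T v v v = 0" for v
  proof (cases "v = 0")
    case True
    then show ?thesis using Ta(2)[of v v 0 v] by simp
  next
    case False
    then obtain f where f: "symplectic_frame B n f" "f 0 True = v"
      using symplectic_frame_through[OF B nd card False] by metis
    \<comment> \<open>rescaling the first pair gives a second structure in the same fibre\<close>
    define f' where "f' i p = (if i = 0 then if p then 2 *\<^sub>R f i p else (1/2) *\<^sub>R f i p else f i p)" for i p
    have f': "symplectic_frame B n f'"
      using symplectic_frameD[OF f(1)]
      by (simp add: symplectic_frame_def f'_def linear_cmul[OF lB(1)] linear_cmul[OF lB(2)] pairing_sign_def)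
    have A_0: "A *v h 0 True = twist_sign l 0 *\<^sub>R h 0 False" if "adapted_frame B n l h A" for h A
    proof -
      have "\<forall>i<n. \<forall>p. A *v h i p = (if p then twist_sign l i else - twist_sign l i) *\<^sub>R h i (\<not> p)"
        using that unfolding adapted_frame_def by (rule conjunct2)
      from this[rule_format, OF n, of True] show ?thesis by (simp only: if_True not_True_eq_False)
    qed
    have v_A: "A *v v = twist_sign l 0 *\<^sub>R f 0 False" if "adapted_frame B n l f A" for A
      using A_0[OF that] by (simp only: f(2))
    have v_A': "A *v (2 *\<^sub>R v) = twist_sign l 0 *\<^sub>R (1/2) *\<^sub>R f 0 False" if "adapted_frame B n l f' A" for A
      using A_0[OF that] by (simp add: f'_def f(2))
    note 1 = three[OF adapted_frame_structure[OF B(1) f(1)], of v]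
    note 2 = three[OF adapted_frame_structure[OF B(1) f'], of "2 *\<^sub>R v"]
    have "T v v v = 3 * (twist_sign l 0 * twist_sign l 0) * T (f 0 False) (f 0 False) v"
      using 1 unfolding v_A[OF adapted_frame_structure[OF B(1) f(1)]] by (simp add: Ta Ta1 Ta2)
    moreover have "16 * T v v v = 3 * (twist_sign l 0 * twist_sign l 0) * T (f 0 False) (f 0 False) v"
      using 2 unfolding v_A'[OF adapted_frame_structure[OF B(1) f']] by (simp add: Ta Ta1 Ta2)
    ultimately show ?thesis by simp
  qed
  have Tm: "T u u (- w) = - T u u w" "T u (- w) v = - T u w v" "T (- w) u v = - T w u v" for u v w
    using Ta(2)[of u u "-1" w] Ta2(2)[of u "-1" w v] Ta1(2)[of "-1" w u v] by simp_all
  have sq: "T u u v = 0" for u v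
  proof -
    have "T v u u = T u u v" "T u v u = T u u v" "T v u v = T u v v" "T v v u = T u v v"
      using T12 T23 by metis+
    moreover have "T (u + v) (u + v) (u + v) = 0" "T (u + - v) (u + - v) (u + - v) = 0"
      by (rule cube)+
    ultimately show ?thesis using cube[of u] cube[of v]
      by (simp only: Ta Ta1 Ta2 Tm)
  qed
  have "T u v w = 0" for w
    using sq[of "u + v" w] sq[of u w] sq[of v w] T12[of u v w] by (simp add: Ta1 Ta2)
  then show ?thesis using nd[of "S u v"] unfolding T_def by blast
qed


section \<open>A diffeomorphism in charts\<close>

text \<open>
  The coordinate expression \<open>\<phi>\<close> of a diffeomorphism, its inverse \<open>\<psi>\<close>, and the Jacobian matrices
  \<open>J\<close> of \<open>\<phi>\<close> and \<open>K = J\<^sup>-\<^sup>1\<close>, both as functions on the domain of \<open>\<phi>\<close>.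
\<close>

locale diffeomorphism_in_charts =
  fixes M :: "('a, real^'m) atlas" and N :: "('b, real^'m) atlas" and \<sigma> :: "'a \<Rightarrow> 'b"
    and c :: "('a, real^'m) chart" and k :: "('b, real^'m) chart"
  assumes M: "smooth_atlas M" and N: "smooth_atlas N" and \<sigma>: "diffeomorphism M N \<sigma>"
    and c: "c \<in> M" and k: "k \<in> N"
begin

abbreviation "\<tau> \<equiv> inv_into (carrier_of M) \<sigma>"

definition "source = snd c ` (fst c \<inter> \<sigma> -` fst k)"
definition "target = snd k ` (fst k \<inter> \<tau> -` fst c)"
definition "\<phi> p = snd k (\<sigma> (chart_inv c p))"
definition "\<psi> q = snd c (\<tau> (chart_inv k q))"

lemma \<sigma>_smooth: "smooth_map M N \<sigma>" and \<tau>_smooth: "smooth_map N M \<tau>"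
  using \<sigma> by (simp_all add: diffeomorphism_def)

lemma \<tau>_\<sigma>: "x \<in> carrier_of M \<Longrightarrow> \<tau> (\<sigma> x) = x"
  using \<sigma> by (auto simp: diffeomorphism_def bij_betw_def)

lemma \<sigma>_\<tau>: "y \<in> carrier_of N \<Longrightarrow> \<sigma> (\<tau> y) = y"
  using \<sigma> by (auto simp: diffeomorphism_def bij_betw_def f_inv_into_f)

lemma c_carrier: "x \<in> fst c \<Longrightarrow> x \<in> carrier_of M" and k_carrier: "y \<in> fst k \<Longrightarrow> y \<in> carrier_of N"
  using c k by (auto simp: carrier_of_def)

lemma source_point:
  assumes "p \<in> source"
  obtains x where "x \<in> fst c" "\<sigma> x \<in> fst k" "p = snd c x" "chart_inv c p = x"
  using assms chart_inv_chart[OF M c] by (auto simp: source_def)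

lemma target_point:
  assumes "q \<in> target"
  obtains y where "y \<in> fst k" "\<tau> y \<in> fst c" "q = snd k y" "chart_inv k q = y"
  using assms chart_inv_chart[OF N k] by (auto simp: target_def)

lemma open_source: "open source" and open_target: "open target"
  using \<sigma>_smooth \<tau>_smooth c k by (auto simp: smooth_map_def source_def target_def)

lemma smooth_\<phi>: "smooth_on source \<phi>" and smooth_\<psi>: "smooth_on target \<psi>"
  using \<sigma>_smooth \<tau>_smooth c k
  by (auto simp: smooth_map_def source_def target_def \<phi>_def[abs_def] \<psi>_def[abs_def] o_def)

lemma \<phi>_target: "p \<in> source \<Longrightarrow> \<phi> p \<in> target"
  by (erule source_point) (auto simp: \<phi>_def target_def \<tau>_\<sigma> c_carrier)

lemma \<psi>_\<phi>: "p \<in> source \<Longrightarrow> \<psi> (\<phi> p) = p"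
  by (erule source_point) (auto simp: \<phi>_def \<psi>_def chart_inv_chart[OF N k] \<tau>_\<sigma> c_carrier)

lemma \<phi>_\<psi>: "q \<in> target \<Longrightarrow> \<phi> (\<psi> q) = q"
  by (erule target_point) (auto simp: \<phi>_def \<psi>_def chart_inv_chart[OF M c] \<sigma>_\<tau> k_carrier)

definition "D\<phi> p = frechet_derivative \<phi> (at p)"
definition "D\<psi> q = frechet_derivative \<psi> (at q)"

lemma \<phi>_derivative: "p \<in> source \<Longrightarrow> (\<phi> has_derivative D\<phi> p) (at p)"
  unfolding D\<phi>_def by (rule smooth_on_has_derivative[OF smooth_\<phi>])

lemma \<psi>_derivative: "q \<in> target \<Longrightarrow> (\<psi> has_derivative D\<psi> q) (at q)"
  unfolding D\<psi>_def by (rule smooth_on_has_derivative[OF smooth_\<psi>])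

lemma linear_D\<phi>: "p \<in> source \<Longrightarrow> linear (D\<phi> p)" and linear_D\<psi>: "q \<in> target \<Longrightarrow> linear (D\<psi> q)"
  by (auto intro: has_derivative_linear[OF \<phi>_derivative] has_derivative_linear[OF \<psi>_derivative])

lemma D\<psi>_D\<phi>:
  assumes p: "p \<in> source"
  shows "D\<psi> (\<phi> p) (D\<phi> p u) = u"
proof -
  have "((\<lambda>p. \<psi> (\<phi> p)) has_derivative (\<lambda>u. D\<psi> (\<phi> p) (D\<phi> p u))) (at p)"
    using diff_chain_at[OF \<phi>_derivative[OF p] \<psi>_derivative[OF \<phi>_target[OF p]]] by (simp add: o_def)
  then have "((\<lambda>p. p) has_derivative (\<lambda>u. D\<psi> (\<phi> p) (D\<phi> p u))) (at p)"
    by (rule has_derivative_transform_within_open[OF _ open_source p]) (rule \<psi>_\<phi>)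
  from has_derivative_unique[OF this has_derivative_ident] show ?thesis by (rule fun_cong)
qed

lemma D\<phi>_D\<psi>:
  assumes p: "p \<in> source"
  shows "D\<phi> p (D\<psi> (\<phi> p) u) = u"
proof -
  note q = \<phi>_target[OF p]
  have "(\<phi> has_derivative D\<phi> p) (at (\<psi> (\<phi> p)))" using \<phi>_derivative[OF p] by (simp add: \<psi>_\<phi>[OF p])
  from diff_chain_at[OF \<psi>_derivative[OF q] this]
  have "((\<lambda>q. \<phi> (\<psi> q)) has_derivative (\<lambda>u. D\<phi> p (D\<psi> (\<phi> p) u))) (at (\<phi> p))"
    by (simp add: o_def)
  then have "((\<lambda>p. p) has_derivative (\<lambda>u. D\<phi> p (D\<psi> (\<phi> p) u))) (at (\<phi> p))"
    by (rule has_derivative_transform_within_open[OF _ open_target q]) (rule \<phi>_\<psi>)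
  from has_derivative_unique[OF this has_derivative_ident] show ?thesis by (rule fun_cong)
qed

lemma charts_at_point: "x \<in> fst c \<Longrightarrow> c \<in> charts_at M x" "y \<in> fst k \<Longrightarrow> k \<in> charts_at N y"
  using c k by (auto simp: charts_at_def)

lemma source_point_in: "x \<in> fst c \<Longrightarrow> \<sigma> x \<in> fst k \<Longrightarrow> snd c x \<in> source"
  by (auto simp: source_def)

lemma \<phi>_chart: "x \<in> fst c \<Longrightarrow> \<phi> (snd c x) = snd k (\<sigma> x)"
  by (simp add: \<phi>_def chart_inv_chart[OF M c])

lemma tangent_map_\<sigma>:
  assumes "x \<in> fst c" "\<sigma> x \<in> fst k" "v \<in> tangent_space M x"
  shows "tangent_map M N \<sigma> x v = coord_vec N (\<sigma> x) k (D\<phi> (snd c x) (v c))"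
  using tangent_map_eq[OF M N \<sigma>_smooth charts_at_point(1)[OF assms(1)] charts_at_point(2)[OF assms(2)] assms(3)]
  by (simp add: D\<phi>_def o_def \<phi>_def[abs_def])

lemma tangent_map_\<tau>:
  assumes "x \<in> fst c" "\<sigma> x \<in> fst k" "w \<in> tangent_space N (\<sigma> x)"
  shows "tangent_map N M \<tau> (\<sigma> x) w = coord_vec M x c (D\<psi> (\<phi> (snd c x)) (w k))"
  using tangent_map_eq[OF N M \<tau>_smooth charts_at_point(2)[OF assms(2)] _ assms(3), of c]
    charts_at_point(1)[OF assms(1)]
  by (simp add: D\<psi>_def o_def \<psi>_def[abs_def] \<tau>_\<sigma>[OF c_carrier[OF assms(1)]] \<phi>_chart[OF assms(1)])

definition "J p = matrix (D\<phi> p)"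
definition "K p = matrix (D\<psi> (\<phi> p))"

lemma J_apply: "p \<in> source \<Longrightarrow> J p *v u = D\<phi> p u"
  unfolding J_def using fun_cong[OF matrix_vector_mul(2)[OF linear_D\<phi>]] by blast

lemma K_apply: "p \<in> source \<Longrightarrow> K p *v u = D\<psi> (\<phi> p) u"
  unfolding K_def using fun_cong[OF matrix_vector_mul(2)[OF linear_D\<psi>[OF \<phi>_target]]] by blast

lemma K_J: "p \<in> source \<Longrightarrow> K p *v (J p *v u) = u"
  by (simp add: J_apply K_apply D\<psi>_D\<phi>)

lemma J_K: "p \<in> source \<Longrightarrow> J p *v (K p *v u) = u"
  by (simp add: J_apply K_apply D\<phi>_D\<psi>)

lemma smooth_J: "smooth_on source J"
  unfolding J_def D\<phi>_def by (rule smooth_on_matrix[OF open_source smooth_on_frechet[OF smooth_\<phi>]])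

lemma smooth_K: "smooth_on source K"
  unfolding K_def[abs_def] D\<psi>_def
  by (intro smooth_on_matrix[OF open_source] smooth_on_compose[OF open_source open_target
        smooth_on_frechet[OF smooth_\<psi>] smooth_\<phi>]) (auto intro: \<phi>_target)

text \<open>
  In matrix form: \<open>J' p \<xi> u\<close> is the second derivative of \<open>\<phi>\<close> at \<open>p\<close> in directions \<open>\<xi>\<close> and \<open>u\<close>.
\<close>

definition "J' p \<xi> = frechet_derivative J (at p) \<xi>"

lemma J_derivative: "p \<in> source \<Longrightarrow> (J has_derivative J' p) (at p)"
  unfolding J'_def[abs_def] using smooth_on_has_derivative[OF smooth_J] by (simp add: eta_contract_eq)

lemma J_apply_derivative:
  "p \<in> source \<Longrightarrow> ((\<lambda>p. J p *v u) has_derivative (\<lambda>\<xi>. J' p \<xi> *v u)) (at p)"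
  using bounded_bilinear.FDERIV[OF bounded_bilinear_matrix_vector_mult J_derivative has_derivative_const[of u]]
  by simp

lemma J'_symmetric:
  assumes p: "p \<in> source"
  shows "J' p \<xi> *v u = J' p u *v \<xi>"
proof -
  have "J' p \<xi> *v u = frechet_derivative (\<lambda>y. frechet_derivative \<phi> (at y) u) (at p) \<xi>" for \<xi> u
  proof -
    have "((\<lambda>y. frechet_derivative \<phi> (at y) u) has_derivative (\<lambda>\<xi>. J' p \<xi> *v u)) (at p)"
      by (rule has_derivative_transform_within_open[OF J_apply_derivative[OF p] open_source p])
        (simp add: J_apply D\<phi>_def)
    from frechet_derivative_eq[OF this] show ?thesis by simp
  qed
  then show ?thesis using second_derivative_symmetric[OF smooth_\<phi> open_source p] by simp
qed

end

section \<open>The almost complex structure at adapted points\<close>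

lemma symplectic_connectionD:
  "symplectic_connection M \<omega> D \<Longrightarrow> linear_connection M D"
  "symplectic_connection M \<omega> D \<Longrightarrow> torsion_free M D"
  by (auto simp: symplectic_connection_def)

lemma christoffel_matrix:
  fixes M :: "('a, real^'m) atlas"
  shows "matrix (christoffel M D x c v) *v u = christoffel M D x c v u"
  by (rule fun_cong[OF matrix_vector_mul(2)[OF christoffel_linear_right]])

lemma adapted_horizontal_lift:
  fixes M :: "('a, real^'m) atlas"
  assumes M: "symplectic_manifold M \<omega>" and D: "symplectic_connection M \<omega> D" and x: "x \<in> carrier_of M"
    and c_def: "c = some_chart M x" and card: "CARD('m) = 2 * n" and l: "l \<le> n"
    and f: "adapted_frame (local_form M \<omega> c (snd c x)) n l f A"
    and \<Gamma>_def: "\<Gamma> = matrix (christoffel M D x c \<xi>)"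
  shows "\<exists>H \<in> horizontal M (twistor_space M \<omega> n l) D (x, end_of M x c A).
    H (End_chart M c) = (\<xi>, A ** \<Gamma> - \<Gamma> ** A)"
proof -
  note Mm = symplectic_manifoldD(1)[OF M] and At = symplectic_manifoldD(2)[OF M]
  have c: "c \<in> charts_at M x" using some_chart_in[OF x] by (simp add: c_def)
  have "frechet_derivative (\<lambda>p. local_form M \<omega> c p u v) (at (snd c x)) \<xi> =
      local_form M \<omega> c (snd c x) (\<Gamma> *v u) v + local_form M \<omega> c (snd c x) u (\<Gamma> *v v)" for u v
    using frechet_derivative_eq[OF christoffel_compatible[OF Mm D symplectic_manifoldD(3)[OF M] c]]
    by (simp add: \<Gamma>_def christoffel_matrix)
  from twistor_tangent_vector[OF M c card l f this]
  obtain H where H: "H \<in> submanifold_tangent_space (End_bundle M) (twistor_space M \<omega> n l) (x, end_of M x c A)"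
    "H (End_chart M c) = (\<xi>, A ** \<Gamma> - \<Gamma> ** A)" by blast
  have "(A ** \<Gamma> - \<Gamma> ** A) *v u + christoffel M D x c \<xi> (A *v u) - A *v christoffel M D x c \<xi> u = 0" for u
    by (simp add: matrix_vector_mult_diff_rdistrib matrix_vector_mul_assoc[symmetric] \<Gamma>_def christoffel_matrix)
  then have "H \<in> horizontal M (twistor_space M \<omega> n l) D (x, end_of M x c A)"
    using horizontal_in_chart[OF Mm symplectic_connectionD(1)[OF D] x c_def end_of_in[OF At c] H]
    by (simp add: mat_of_end_of[OF At c])
  then show ?thesis using H(2) by blast
qed

text \<open>
  The base point stays fixed, and the frame moves with velocity in the symplectic Lie algebra.
\<close>

lemma adapted_vertical_vector:
  fixes M :: "('a, real^'m) atlas"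
  assumes M: "symplectic_manifold M \<omega>" and c: "c \<in> charts_at M x"
    and card: "CARD('m) = 2 * n" and l: "l \<le> n"
    and f: "adapted_frame (local_form M \<omega> c (snd c x)) n l f A"
    and G: "\<And>u v. local_form M \<omega> c (snd c x) (G *v u) v + local_form M \<omega> c (snd c x) u (G *v v) = 0"
  shows "\<exists>V \<in> submanifold_tangent_space (End_bundle M) (twistor_space M \<omega> n l) (x, end_of M x c A).
    V (End_chart M c) = (0, A ** G - G ** A)"
proof (rule twistor_tangent_vector[OF M c card l f])
  note cM = charts_atD[OF c]
  have sm: "smooth_on (snd c ` fst c) (\<lambda>p. local_form M \<omega> c p u v)" for u v
    using symplectic_manifoldD(3)[OF M] cM by (auto simp: smooth_two_form_def local_form_def)
  have "linear (frechet_derivative (\<lambda>p. local_form M \<omega> c p u v) (at (snd c x)))" for u v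
    by (rule has_derivative_linear[OF smooth_on_has_derivative[OF sm]]) (use cM in auto)
  then show "frechet_derivative (\<lambda>p. local_form M \<omega> c p u v) (at (snd c x)) 0 =
      local_form M \<omega> c (snd c x) (G *v u) v + local_form M \<omega> c (snd c x) u (G *v v)" for u v
    using G by (simp add: linear_0)
qed

lemma twistor_J_adapted:
  fixes M :: "('a, real^'m) atlas"
  assumes M: "symplectic_manifold M \<omega>" and D: "symplectic_connection M \<omega> D" and x: "x \<in> carrier_of M"
    and c_def: "c = some_chart M x" and card: "CARD('m) = 2 * n" and l: "l \<le> n"
    and f: "adapted_frame (local_form M \<omega> c (snd c x)) n l f A"
    and \<Gamma>_def: "\<And>v. \<Gamma> v = matrix (christoffel M D x c v)"
    and G: "\<And>u v. local_form M \<omega> c (snd c x) (G *v u) v + local_form M \<omega> c (snd c x) u (G *v v) = 0"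
    and X: "X \<in> tangent_space (End_bundle M) (x, end_of M x c A)"
      "X (End_chart M c) = (\<xi>, (A ** \<Gamma> \<xi> - \<Gamma> \<xi> ** A) + (A ** G - G ** A))"
  shows "twistor_J M (twistor_space M \<omega> n l) D (x, end_of M x c A) X (End_chart M c) =
      (A *v \<xi>, (A ** \<Gamma> (A *v \<xi>) - \<Gamma> (A *v \<xi>) ** A) + A ** (A ** G - G ** A))"
    "twistor_J M (twistor_space M \<omega> n l) D (x, end_of M x c A) X \<in> tangent_space (End_bundle M) (x, end_of M x c A)"
proof -
  note Mm = symplectic_manifoldD(1)[OF M] and At = symplectic_manifoldD(2)[OF M]
  have c: "c \<in> charts_at M x" using some_chart_in[OF x] by (simp add: c_def)
  obtain H where H: "H \<in> horizontal M (twistor_space M \<omega> n l) D (x, end_of M x c A)"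
    "H (End_chart M c) = (\<xi>, A ** \<Gamma> \<xi> - \<Gamma> \<xi> ** A)"
    using adapted_horizontal_lift[OF M D x c_def card l f \<Gamma>_def] by blast
  obtain W where W: "W \<in> horizontal M (twistor_space M \<omega> n l) D (x, end_of M x c A)"
    "W (End_chart M c) = (A *v \<xi>, A ** \<Gamma> (A *v \<xi>) - \<Gamma> (A *v \<xi>) ** A)"
    using adapted_horizontal_lift[OF M D x c_def card l f \<Gamma>_def] by blast
  obtain V where V: "V \<in> submanifold_tangent_space (End_bundle M) (twistor_space M \<omega> n l) (x, end_of M x c A)"
    "V (End_chart M c) = (0, A ** G - G ** A)"
    using adapted_vertical_vector[OF M c card l f G] by blast
  have e: "(A ** \<Gamma> \<xi> - \<Gamma> \<xi> ** A) + (A ** G - G ** A) - (A ** \<Gamma> \<xi> - \<Gamma> \<xi> ** A) = A ** G - G ** A" by simp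
  have V2: "V (End_chart M c) = (0, (A ** \<Gamma> \<xi> - \<Gamma> \<xi> ** A) + (A ** G - G ** A) - (A ** \<Gamma> \<xi> - \<Gamma> \<xi> ** A))"
    by (simp only: V(2) e)
  note * = twistor_J_in_chart[OF Mm symplectic_connectionD(1)[OF D] x c_def end_of_in[OF At c]
      mat_of_end_of[OF At c, symmetric] X H V(1) V2 W]
  show "twistor_J M (twistor_space M \<omega> n l) D (x, end_of M x c A) X (End_chart M c) =
      (A *v \<xi>, (A ** \<Gamma> (A *v \<xi>) - \<Gamma> (A *v \<xi>) ** A) + A ** (A ** G - G ** A))"
    using *(1) by (simp only: e)
  show "twistor_J M (twistor_space M \<omega> n l) D (x, end_of M x c A) X \<in> tangent_space (End_bundle M) (x, end_of M x c A)"
    by (rule *(2))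
qed


section \<open>Lifts of diffeomorphisms in charts\<close>

context diffeomorphism_in_charts
begin

lemma twistor_lift_in_chart:
  assumes x: "x \<in> fst c" "\<sigma> x \<in> fst k"
  shows "twistor_lift M N \<sigma> (x, end_of M x c A) =
    (\<sigma> x, end_of N (\<sigma> x) k (J (snd c x) ** A ** K (snd c x)))"
proof -
  note p = source_point_in[OF x]
  note cx = charts_at_point(1)[OF x(1)] and ky = charts_at_point(2)[OF x(2)]
  have "tangent_map M N \<sigma> x (end_of M x c A (tangent_map N M \<tau> (\<sigma> x) v)) =
      coord_vec N (\<sigma> x) k ((J (snd c x) ** A ** K (snd c x)) *v v k)" if v: "v \<in> tangent_space N (\<sigma> x)" for v
  proof -
    have "end_of M x c A (tangent_map N M \<tau> (\<sigma> x) v) = coord_vec M x c (A *v D\<psi> (\<phi> (snd c x)) (v k))"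
      by (simp add: tangent_map_\<tau>[OF x v] end_of_def coord_vec_tangent[OF M cx] coord_vec_self[OF M cx])
    then show ?thesis
      by (simp add: tangent_map_\<sigma>[OF x coord_vec_tangent[OF M cx]] coord_vec_self[OF M cx]
          matrix_vector_mul_assoc[symmetric] J_apply[OF p] K_apply[OF p])
  qed
  then show ?thesis by (auto simp: twistor_lift_def end_of_def fun_eq_iff)
qed

text \<open>
  In charts the lift sends \<open>(p, A)\<close> to \<open>(\<phi> p, Q)\<close> with \<open>Q J = J A\<close>. Differentiating this relation
  avoids derivatives of the inverse of \<open>J\<close>.
\<close>

lemma twistor_lift_derivative:
  assumes L: "smooth_map (End_bundle M) (End_bundle N) (twistor_lift M N \<sigma>)"
    and x: "x \<in> fst c" "\<sigma> x \<in> fst k" and p_def: "p = snd c x" and Q_def: "Q = J p ** A ** K p"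
    and X: "X \<in> tangent_space (End_bundle M) (x, end_of M x c A)" "X (End_chart M c) = (\<xi>, B)"
  shows "tangent_map (End_bundle M) (End_bundle N) (twistor_lift M N \<sigma>) (x, end_of M x c A) X \<in>
      tangent_space (End_bundle N) (\<sigma> x, end_of N (\<sigma> x) k Q)"
    "\<exists>Q'. tangent_map (End_bundle M) (End_bundle N) (twistor_lift M N \<sigma>) (x, end_of M x c A) X (End_chart N k) =
      (J p *v \<xi>, Q') \<and>
      (\<forall>u. Q' *v (J p *v u) = J' p \<xi> *v (A *v u) + J p *v (B *v u) - Q *v (J' p \<xi> *v u))"
proof -
  have p: "p \<in> source" using source_point_in[OF x] p_def by simp
  note cx = charts_at_point(1)[OF x(1)] and ky = charts_at_point(2)[OF x(2)]
  note jx = end_of_in[OF M cx] and jy = end_of_in[OF N ky]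
  let ?z = "(x, end_of M x c A)" and ?c = "End_chart M c" and ?k = "End_chart N k"
  let ?tm = "tangent_map (End_bundle M) (End_bundle N) (twistor_lift M N \<sigma>) ?z X"
  have Lz: "twistor_lift M N \<sigma> ?z = (\<sigma> x, end_of N (\<sigma> x) k Q)"
    using twistor_lift_in_chart[OF x] by (simp add: Q_def p_def)
  have zc: "snd ?c ?z = (p, A)" by (simp add: End_chart_simps mat_of_end_of[OF M cx] p_def)
  have kz: "?k \<in> charts_at (End_bundle N) (twistor_lift M N \<sigma> ?z)"
    unfolding Lz by (rule End_charts_at[OF ky jy])
  let ?F = "frechet_derivative (snd ?k \<circ> twistor_lift M N \<sigma> \<circ> chart_inv ?c) (at (snd ?c ?z))"
  have tm: "?tm = coord_vec (End_bundle N) (twistor_lift M N \<sigma> ?z) ?k (?F (X ?c))"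
    by (rule tangent_map_eq[OF smooth_atlas_End_bundle[OF M] smooth_atlas_End_bundle[OF N] L
          End_charts_at[OF cx jx] kz X(1)])
  show "?tm \<in> tangent_space (End_bundle N) (\<sigma> x, end_of N (\<sigma> x) k Q)"
    unfolding tm using coord_vec_tangent[OF smooth_atlas_End_bundle[OF N] kz] by (simp add: Lz)
  have tmk: "?tm ?k = ?F (X ?c)"
    unfolding tm by (rule coord_vec_self[OF smooth_atlas_End_bundle[OF N] kz])
  let ?U = "source \<times> (UNIV :: (real^'m^'m) set)"
  have oU: "open ?U" using open_source by (simp add: open_Times)
  have dJ: "((\<lambda>q. J (fst q)) has_derivative (\<lambda>h. J' p (fst h))) (at (p, A))"
    by (rule has_derivative_compose_fst[OF J_derivative[OF p]])
  have dK: "((\<lambda>q. K (fst q)) has_derivative (\<lambda>h. frechet_derivative K (at p) (fst h))) (at (p, A))"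
    by (rule has_derivative_compose_fst[OF smooth_on_has_derivative[OF smooth_K p]])
  have dA: "((\<lambda>q. snd q) has_derivative (\<lambda>h. snd h)) (at (p, A))"
    by (rule bounded_linear.has_derivative[OF bounded_linear_snd has_derivative_ident])
  note FD = bounded_bilinear.FDERIV[OF bounded_bilinear_matrix_mult]
  obtain R where R: "((\<lambda>q. J (fst q) ** snd q ** K (fst q)) has_derivative R) (at (p, A))"
    using FD[OF FD[OF dJ dA] dK] by blast
  have d\<phi>: "((\<lambda>q. \<phi> (fst q)) has_derivative (\<lambda>h. D\<phi> p (fst h))) (at (p, A))"
    by (rule has_derivative_compose_fst[OF \<phi>_derivative[OF p]])
  have "((\<lambda>q. snd ?k (twistor_lift M N \<sigma> (chart_inv ?c q))) has_derivative
      (\<lambda>h. (D\<phi> p (fst h), R h))) (at (p, A))"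
  proof (rule has_derivative_transform_within_open[OF has_derivative_Pair[OF d\<phi> R] oU])
    show "(p, A) \<in> ?U" using p by simp
    fix q assume "q \<in> ?U"
    then obtain p' A' where q: "q = (p', A')" and p': "p' \<in> source" by (cases q) auto
    obtain x' where x': "x' \<in> fst c" "\<sigma> x' \<in> fst k" "p' = snd c x'" "chart_inv c p' = x'"
      using source_point[OF p'] by blast
    have "chart_inv ?c q = (x', end_of M x' c A')"
      using End_chart_inv[OF M c, of p'] x' by (simp add: q)
    then show "(\<phi> (fst q), J (fst q) ** snd q ** K (fst q)) = snd ?k (twistor_lift M N \<sigma> (chart_inv ?c q))"
      using x'(3) mat_of_end_of[OF N charts_at_point(2)[OF x'(2)]]
      by (simp add: twistor_lift_in_chart[OF x'(1,2)] End_chart_simps q \<phi>_chart[OF x'(1)])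
  qed
  from frechet_derivative_eq[OF this, of "(\<xi>, B)"]
  have F: "?tm ?k = (J p *v \<xi>, R (\<xi>, B))"
    by (simp add: tmk X(2) zc o_def J_apply[OF p])
  have 1: "((\<lambda>q. (J (fst q) ** snd q ** K (fst q)) ** J (fst q)) has_derivative
      (\<lambda>h. (J p ** A ** K p) ** J' p (fst h) + R h ** J p)) (at (p, A))"
    using FD[OF R dJ] by simp
  have 2: "((\<lambda>q. J (fst q) ** snd q) has_derivative (\<lambda>h. J p ** snd h + J' p (fst h) ** A)) (at (p, A))"
    using FD[OF dJ dA] by simp
  have "((\<lambda>q. (J (fst q) ** snd q ** K (fst q)) ** J (fst q)) has_derivative
      (\<lambda>h. J p ** snd h + J' p (fst h) ** A)) (at (p, A))"
  proof (rule has_derivative_transform_within_open[OF 2 oU])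
    show "(p, A) \<in> ?U" using p by simp
    fix q assume "q \<in> ?U"
    then have "fst q \<in> source" by auto
    then show "J (fst q) ** snd q = (J (fst q) ** snd q ** K (fst q)) ** J (fst q)"
      by (simp add: matrix_eq matrix_vector_mul_assoc[symmetric] K_J)
  qed
  from fun_cong[OF has_derivative_unique[OF 1 this], of "(\<xi>, B)"]
  have rel: "Q ** J' p \<xi> + R (\<xi>, B) ** J p = J p ** B + J' p \<xi> ** A" by (simp add: Q_def)
  have "R (\<xi>, B) *v (J p *v u) = J' p \<xi> *v (A *v u) + J p *v (B *v u) - Q *v (J' p \<xi> *v u)" for u
  proof -
    have "(Q ** J' p \<xi> + R (\<xi>, B) ** J p) *v u = (J p ** B + J' p \<xi> ** A) *v u" by (simp only: rel)
    then show ?thesis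
      by (simp add: matrix_vector_mult_add_rdistrib matrix_vector_mul_assoc[symmetric] algebra_simps)
  qed
  then show "\<exists>Q'. ?tm ?k = (J p *v \<xi>, Q') \<and>
      (\<forall>u. Q' *v (J p *v u) = J' p \<xi> *v (A *v u) + J p *v (B *v u) - Q *v (J' p \<xi> *v u))"
    using F by blast
qed

end

section \<open>The difference tensor of the two connections\<close>

context diffeomorphism_in_charts
begin

lemma local_form_pull_back:
  assumes \<sigma>s: "symplectomorphism M \<omega> N \<omega>\<^sub>1 \<sigma>" and p: "p \<in> source"
  shows "local_form N \<omega>\<^sub>1 k (\<phi> p) (J p *v u) (J p *v v) = local_form M \<omega> c p u v"
proof -
  obtain x where x: "x \<in> fst c" "\<sigma> x \<in> fst k" "p = snd c x" "chart_inv c p = x"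
    using source_point[OF p] by blast
  note cx = charts_at_point(1)[OF x(1)]
  note t = coord_vec_tangent[OF M cx]
  have "chart_inv k (\<phi> p) = \<sigma> x" using chart_inv_chart[OF N k x(2)] by (simp add: x(3) \<phi>_chart[OF x(1)])
  then have "local_form N \<omega>\<^sub>1 k (\<phi> p) (J p *v u) (J p *v v) =
      \<omega>\<^sub>1 (\<sigma> x) (tangent_map M N \<sigma> x (coord_vec M x c u)) (tangent_map M N \<sigma> x (coord_vec M x c v))"
    by (simp add: local_form_def tangent_map_\<sigma>[OF x(1,2) t] coord_vec_self[OF M cx]
        J_apply[OF source_point_in[OF x(1,2)]] x(3))
  also have "\<dots> = \<omega> x (coord_vec M x c u) (coord_vec M x c v)"
    using \<sigma>s t c_carrier[OF x(1)] by (simp add: symplectomorphism_def)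
  finally show ?thesis by (simp add: local_form_def x(4))
qed

text \<open>
  The map \<open>G\<close> is the Christoffel map of the transported connection in the chart of \<open>M\<close>. That it is
  compatible with \<open>\<omega>\<close> follows by differentiating \<open>\<omega>\<^sub>1(J u, J v) = \<omega>(u, v)\<close>.
\<close>

lemma local_form_pull_back_derivative:
  assumes SN: "symplectic_manifold N \<omega>\<^sub>1" and \<sigma>s: "symplectomorphism M \<omega> N \<omega>\<^sub>1 \<sigma>"
    and D2: "symplectic_connection N \<omega>\<^sub>1 D\<^sub>2"
    and x: "x \<in> fst c" "\<sigma> x \<in> fst k" and p_def: "p = snd c x"
    and G_def: "\<And>u. G u = K p *v (christoffel N D\<^sub>2 (\<sigma> x) k (J p *v \<xi>) (J p *v u) + J' p \<xi> *v u)"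
  shows "frechet_derivative (\<lambda>p. local_form M \<omega> c p u v) (at p) \<xi> =
    local_form M \<omega> c p (G u) v + local_form M \<omega> c p u (G v)"
proof -
  have p: "p \<in> source" using source_point_in[OF x] p_def by simp
  have ky: "k \<in> charts_at N (\<sigma> x)" by (rule charts_at_point(2)[OF x(2)])
  have \<phi>p: "\<phi> p = snd k (\<sigma> x)" by (simp add: p_def \<phi>_chart[OF x(1)])
  let ?\<Gamma> = "christoffel N D\<^sub>2 (\<sigma> x) k" and ?B = "local_form N \<omega>\<^sub>1 k (\<phi> p)"
  note bil = local_form_bilinear[OF N _ symplectic_manifoldD(3)[OF SN]]
  have bilin: "bilinear (local_form N \<omega>\<^sub>1 k (\<phi> p'))" if p': "p' \<in> source" for p'
  proof -
    obtain x' where x': "x' \<in> fst c" "\<sigma> x' \<in> fst k" "p' = snd c x'" using source_point[OF p'] by blast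
    show ?thesis using bil[OF charts_at_point(2)[OF x'(2)]] by (simp add: x'(3) \<phi>_chart[OF x'(1)])
  qed
  have lB: "linear (\<lambda>a. ?B a b)" "linear (?B a)" for a b using bilin[OF p] by (auto simp: bilinear_def)
  let ?B' = "\<lambda>h u v. ?B (?\<Gamma> (D\<phi> p h) u) v + ?B u (?\<Gamma> (D\<phi> p h) v)"
  have dB: "((\<lambda>p. local_form N \<omega>\<^sub>1 k (\<phi> p) u v) has_derivative (\<lambda>h. ?B' h u v)) (at p)" for u v
    using diff_chain_at[OF \<phi>_derivative[OF p], of "\<lambda>q. local_form N \<omega>\<^sub>1 k q u v"]
      christoffel_compatible[OF symplectic_manifoldD(1)[OF SN] D2 symplectic_manifoldD(3)[OF SN] ky, of u v]
    by (simp add: \<phi>p o_def)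
  have bB': "bilinear (?B' h)" for h
    unfolding bilinear_def
    by (intro conjI allI linearI)
      (simp_all add: linear_add[OF lB(1)] linear_add[OF lB(2)] linear_cmul[OF lB(1)] linear_cmul[OF lB(2)]
        linear_add[OF christoffel_linear_right] linear_cmul[OF christoffel_linear_right] algebra_simps)
  have "((\<lambda>p. local_form N \<omega>\<^sub>1 k (\<phi> p) (J p *v u) (J p *v v)) has_derivative
      (\<lambda>h. ?B' h (J p *v u) (J p *v v) + ?B (J' p h *v u) (J p *v v) + ?B (J p *v u) (J' p h *v v))) (at p)"
    by (rule has_derivative_bilinear_family[where B = "\<lambda>p. local_form N \<omega>\<^sub>1 k (\<phi> p)",
          OF open_source p bilin dB bB' J_apply_derivative[OF p] J_apply_derivative[OF p]])
  then have "((\<lambda>p. local_form M \<omega> c p u v) has_derivative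
      (\<lambda>h. ?B' h (J p *v u) (J p *v v) + ?B (J' p h *v u) (J p *v v) + ?B (J p *v u) (J' p h *v v))) (at p)"
    by (rule has_derivative_transform_within_open[OF _ open_source p])
      (rule local_form_pull_back[OF \<sigma>s])
  from frechet_derivative_eq[OF this, of \<xi>]
  have "frechet_derivative (\<lambda>p. local_form M \<omega> c p u v) (at p) \<xi> =
      ?B (?\<Gamma> (J p *v \<xi>) (J p *v u) + J' p \<xi> *v u) (J p *v v) +
      ?B (J p *v u) (?\<Gamma> (J p *v \<xi>) (J p *v v) + J' p \<xi> *v v)"
    by (simp add: linear_add[OF lB(1)] linear_add[OF lB(2)] J_apply[OF p])
  moreover have "?B a (J p *v v) = local_form M \<omega> c p (K p *v a) v"
    "?B (J p *v v) a = local_form M \<omega> c p v (K p *v a)" for a v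
    using local_form_pull_back[OF \<sigma>s p, of "K p *v a" v] local_form_pull_back[OF \<sigma>s p, of v "K p *v a"]
    by (simp_all add: J_K[OF p])
  ultimately show ?thesis by (simp add: G_def)
qed

text \<open>
  Compare the two sides of the holomorphy condition on the vector \<open>H\<close> that is horizontal for the connection of
  \<open>M\<close>. The image of \<open>H\<close> differs from a horizontal vector for the connection of \<open>N\<close> by the vertical
  vector \<open>[Q, G]\<close> with \<open>G = - J S(\<xi>) K\<close>.
\<close>

lemma difference_tensor_commutator:
  assumes SM: "symplectic_manifold M \<omega>" and SN: "symplectic_manifold N \<omega>\<^sub>1"
    and \<sigma>s: "symplectomorphism M \<omega> N \<omega>\<^sub>1 \<sigma>"
    and D: "symplectic_connection M \<omega> D" and D2: "symplectic_connection N \<omega>\<^sub>1 D\<^sub>2"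
    and card: "CARD('m) = 2 * n" and l: "l \<le> n"
    and hol: "pseudo_holomorphic (End_bundle M) (twistor_space M \<omega> n l) (twistor_J M (twistor_space M \<omega> n l) D)
      (End_bundle N) (twistor_space N \<omega>\<^sub>1 n l) (twistor_J N (twistor_space N \<omega>\<^sub>1 n l) D\<^sub>2) (twistor_lift M N \<sigma>)"
    and x: "x \<in> fst c" "\<sigma> x \<in> fst k" and p_def: "p = snd c x"
    and c_def: "c = some_chart M x" and k_def: "k = some_chart N (\<sigma> x)"
    and S_def: "\<And>\<xi> u. S \<xi> u = K p *v (christoffel N D\<^sub>2 (\<sigma> x) k (J p *v \<xi>) (J p *v u) + J' p \<xi> *v u)
      - christoffel M D x c \<xi> u"
    and S_lin: "\<And>\<xi>. linear (S \<xi>)"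
    and S_sp: "\<And>\<xi> u v. local_form M \<omega> c p (S \<xi> u) v + local_form M \<omega> c p u (S \<xi> v) = 0"
    and f: "adapted_frame (local_form M \<omega> c p) n l f A"
  shows "A *v S (A *v \<xi>) u - S (A *v \<xi>) (A *v u) = A *v (A *v S \<xi> u - S \<xi> (A *v u))"
proof -
  have p: "p \<in> source" using source_point_in[OF x] p_def by simp
  have \<phi>p: "\<phi> p = snd k (\<sigma> x)" by (simp add: p_def \<phi>_chart[OF x(1)])
  note cx = charts_at_point(1)[OF x(1)] and ky = charts_at_point(2)[OF x(2)]
  note xM = c_carrier[OF x(1)] and yN = k_carrier[OF x(2)]
  define Q where "Q = J p ** A ** K p"
  have QJ: "Q *v (J p *v a) = J p *v (A *v a)" for a
    by (simp add: Q_def matrix_vector_mul_assoc[symmetric] K_J[OF p])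
  define \<Gamma> where "\<Gamma> v = matrix (christoffel M D x c v)" for v
  define \<Gamma>\<^sub>2 where "\<Gamma>\<^sub>2 v = matrix (christoffel N D\<^sub>2 (\<sigma> x) k v)" for v
  let ?B = "local_form M \<omega> c p" and ?B1 = "local_form N \<omega>\<^sub>1 k (snd k (\<sigma> x))"
  have B1: "?B1 (J p *v a) (J p *v b) = ?B a b" for a b
    using local_form_pull_back[OF \<sigma>s p] by (simp add: \<phi>p)
  have bil: "bilinear ?B" using local_form_bilinear[OF M cx symplectic_manifoldD(3)[OF SM]] by (simp add: p_def)
  have bil1: "bilinear ?B1" by (rule local_form_bilinear[OF N ky symplectic_manifoldD(3)[OF SN]])
  have f1: "adapted_frame ?B1 n l (\<lambda>i q. J p *v f i q) Q"
    using f by (simp add: adapted_frame_def symplectic_frame_def B1 QJ matrix_vector_mult_scaleR linear_neg[OF matrix_vector_mul_linear])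
  have f0: "adapted_frame (local_form M \<omega> c (snd c x)) n l f A" using f by (simp add: p_def)
  let ?Z = "twistor_space M \<omega> n l" and ?Z1 = "twistor_space N \<omega>\<^sub>1 n l"
  let ?z = "(x, end_of M x c A)" and ?z1 = "(\<sigma> x, end_of N (\<sigma> x) k Q)"
  let ?JM = "twistor_J M ?Z D" and ?JN = "twistor_J N ?Z1 D\<^sub>2"
  let ?\<Sigma> = "tangent_map (End_bundle M) (End_bundle N) (twistor_lift M N \<sigma>) ?z"
  have L: "smooth_map (End_bundle M) (End_bundle N) (twistor_lift M N \<sigma>)"
    using hol by (simp add: pseudo_holomorphic_def)
  have Lz: "twistor_lift M N \<sigma> ?z = ?z1" using twistor_lift_in_chart[OF x] by (simp add: Q_def p_def)
  obtain H where H: "H \<in> horizontal M ?Z D ?z" "H (End_chart M c) = (\<xi>, A ** \<Gamma> \<xi> - \<Gamma> \<xi> ** A)"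
    using adapted_horizontal_lift[OF SM D xM c_def card l f0 \<Gamma>_def] by blast
  have HT: "H \<in> submanifold_tangent_space (End_bundle M) ?Z ?z" using H(1) by (simp add: horizontal_def)
  have Ht: "H \<in> tangent_space (End_bundle M) ?z"
    using HT submanifold_tangent_space_subset[OF smooth_atlas_End_bundle[OF M]] by blast
  have zZ: "?z \<in> ?Z" by (rule adapted_frame_in_twistor_space[OF SM cx card l f0])
  have J_eq: "?\<Sigma> (?JM ?z H) = ?JN ?z1 (?\<Sigma> H)"
    using hol zZ HT unfolding pseudo_holomorphic_def Lz[symmetric] by blast
  \<comment> \<open>the case \<open>G = 0\<close>, as \<open>H\<close> has no vertical part\<close>
  have "local_form M \<omega> c (snd c x) (0 *v a) b + local_form M \<omega> c (snd c x) a (0 *v b) = 0" for a b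
    using linear_0[of "\<lambda>a. ?B a b"] linear_0[of "?B a"] bil by (simp add: bilinear_def p_def)
  note JM = twistor_J_adapted[OF SM D xM c_def card l f0 \<Gamma>_def this Ht]
  have H2: "H (End_chart M c) = (\<xi>, (A ** \<Gamma> \<xi> - \<Gamma> \<xi> ** A) + (A ** 0 - 0 ** A))"
    by (simp add: H(2))
  have JMH: "?JM ?z H (End_chart M c) = (A *v \<xi>, A ** \<Gamma> (A *v \<xi>) - \<Gamma> (A *v \<xi>) ** A)"
    using JM(1)[OF H2] by simp
  obtain Q1 where Q1: "?\<Sigma> (?JM ?z H) (End_chart N k) = (J p *v (A *v \<xi>), Q1)"
    "\<And>u. Q1 *v (J p *v u) = J' p (A *v \<xi>) *v (A *v u) +
      J p *v ((A ** \<Gamma> (A *v \<xi>) - \<Gamma> (A *v \<xi>) ** A) *v u) - Q *v (J' p (A *v \<xi>) *v u)"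
    using twistor_lift_derivative(2)[OF L x p_def Q_def JM(2)[OF H2] JMH] by blast
  obtain Q2 where Q2: "?\<Sigma> H (End_chart N k) = (J p *v \<xi>, Q2)"
    "\<And>u. Q2 *v (J p *v u) = J' p \<xi> *v (A *v u) +
      J p *v ((A ** \<Gamma> \<xi> - \<Gamma> \<xi> ** A) *v u) - Q *v (J' p \<xi> *v u)"
    using twistor_lift_derivative(2)[OF L x p_def Q_def Ht H(2)] by blast
  \<comment> \<open>the vertical part of the image of \<open>H\<close> is the commutator of \<open>Q\<close> with this matrix\<close>
  define G where "G = - (J p ** matrix (S \<xi>) ** K p)"
  have negm: "(- X) *v a = - (X *v a)" for X :: "real^'m^'m" and a
    using matrix_vector_mult_diff_rdistrib[of 0 X a] by simp
  have negv: "X *v (- a) = - (X *v a)" for X :: "real^'m^'m" and a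
    by (rule linear_neg[OF matrix_vector_mul_linear])
  have GJ: "G *v (J p *v a) = - (J p *v S \<xi> a)" for a
    using fun_cong[OF matrix_vector_mul(2)[OF S_lin[of \<xi>]], of a]
    by (simp add: G_def negm matrix_vector_mul_assoc[symmetric] K_J[OF p])
  have G_sp: "?B1 (G *v a) b + ?B1 a (G *v b) = 0" for a b
  proof -
    have l1: "linear (\<lambda>a. ?B1 a b)" "linear (?B1 a)" for a b using bil1 by (auto simp: bilinear_def)
    have "?B1 (G *v (J p *v a)) (J p *v b) + ?B1 (J p *v a) (G *v (J p *v b)) = 0" for a b
      using S_sp[of \<xi> a b] by (simp add: GJ linear_neg[OF l1(1)] linear_neg[OF l1(2)] B1)
    from this[of "K p *v a" "K p *v b"] show ?thesis by (simp add: J_K[OF p])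
  qed
  have JS: "J p *v S \<xi> a = \<Gamma>\<^sub>2 (J p *v \<xi>) *v (J p *v a) + J' p \<xi> *v a - J p *v (\<Gamma> \<xi> *v a)" for \<xi> a
    by (simp add: S_def matrix_vector_mult_diff_distrib J_K[OF p] \<Gamma>_def \<Gamma>\<^sub>2_def christoffel_matrix)
  have "Q2 = (Q ** \<Gamma>\<^sub>2 (J p *v \<xi>) - \<Gamma>\<^sub>2 (J p *v \<xi>) ** Q) + (Q ** G - G ** Q)"
    unfolding matrix_eq
  proof
    fix a
    define u where "u = K p *v a"
    have a: "a = J p *v u" by (simp add: u_def J_K[OF p])
    have "Q *v (J p *v S \<xi> u) = Q *v (\<Gamma>\<^sub>2 (J p *v \<xi>) *v (J p *v u)) + Q *v (J' p \<xi> *v u) - J p *v (A *v (\<Gamma> \<xi> *v u))"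
      by (simp only: JS matrix_vector_mult_diff_distrib matrix_vector_right_distrib QJ)
    then show "Q2 *v a = ((Q ** \<Gamma>\<^sub>2 (J p *v \<xi>) - \<Gamma>\<^sub>2 (J p *v \<xi>) ** Q) + (Q ** G - G ** Q)) *v a"
      unfolding a Q2(2)
      by (simp add: matrix_vector_mult_add_rdistrib matrix_vector_mult_diff_rdistrib
          matrix_vector_mul_assoc[symmetric] matrix_vector_mult_diff_distrib GJ QJ negv JS[of _ "A *v u"])
  qed
  then have X2: "?\<Sigma> H (End_chart N k) = (J p *v \<xi>, (Q ** \<Gamma>\<^sub>2 (J p *v \<xi>) - \<Gamma>\<^sub>2 (J p *v \<xi>) ** Q) + (Q ** G - G ** Q))"
    using Q2(1) by simp
  have "?\<Sigma> H \<in> tangent_space (End_bundle N) ?z1"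
    by (rule twistor_lift_derivative(1)[OF L x p_def Q_def Ht H(2)])
  note JN = twistor_J_adapted(1)[OF SN D2 yN k_def card l f1 \<Gamma>\<^sub>2_def G_sp this X2]
  have "Q1 = snd (?JN ?z1 (?\<Sigma> H) (End_chart N k))"
    by (simp only: J_eq[symmetric] Q1(1) snd_conv)
  also have "\<dots> = (Q ** \<Gamma>\<^sub>2 (Q *v (J p *v \<xi>)) - \<Gamma>\<^sub>2 (Q *v (J p *v \<xi>)) ** Q) + Q ** (Q ** G - G ** Q)"
    by (simp only: JN snd_conv)
  finally have "Q1 = (Q ** \<Gamma>\<^sub>2 (Q *v (J p *v \<xi>)) - \<Gamma>\<^sub>2 (Q *v (J p *v \<xi>)) ** Q) + Q ** (Q ** G - G ** Q)" .
  then have "Q1 *v (J p *v u) = ((Q ** \<Gamma>\<^sub>2 (Q *v (J p *v \<xi>)) - \<Gamma>\<^sub>2 (Q *v (J p *v \<xi>)) ** Q) + Q ** (Q ** G - G ** Q)) *v (J p *v u)"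
    by simp
  then have eq: "J' p (A *v \<xi>) *v (A *v u) + J p *v (A *v (\<Gamma> (A *v \<xi>) *v u)) - J p *v (\<Gamma> (A *v \<xi>) *v (A *v u))
      - Q *v (J' p (A *v \<xi>) *v u) =
      Q *v (\<Gamma>\<^sub>2 (J p *v (A *v \<xi>)) *v (J p *v u)) - \<Gamma>\<^sub>2 (J p *v (A *v \<xi>)) *v (J p *v (A *v u))
      + (J p *v (A *v S \<xi> (A *v u)) - J p *v (A *v (A *v S \<xi> u)))"
    unfolding Q1(2)
    by (simp add: matrix_vector_mult_add_rdistrib matrix_vector_mult_diff_rdistrib
        matrix_vector_mul_assoc[symmetric] matrix_vector_mult_diff_distrib GJ QJ negv algebra_simps)
  have group: "b + a = a' + s" if "a + g = q + q'" "j + (a' + (g + h)) = q + (b + (g' + q'))" "s + g' = j + h"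
    for a g q q' j a' h b g' s :: "real^'m"
  proof -
    have "a = q + q' - g" "s = j + h - g'" using that(1,3) by (simp_all add: eq_diff_eq)
    moreover have "b = j + (a' + (g + h)) - q - g' - q'" by (simp add: that(2))
    ultimately show ?thesis by simp
  qed
  have "Q *v (J p *v S (A *v \<xi>) u) = Q *v (\<Gamma>\<^sub>2 (J p *v (A *v \<xi>)) *v (J p *v u)) + Q *v (J' p (A *v \<xi>) *v u)
      - J p *v (A *v (\<Gamma> (A *v \<xi>) *v u))"
    by (simp only: JS matrix_vector_mult_diff_distrib matrix_vector_right_distrib QJ)
  then have e1: "J p *v (A *v S (A *v \<xi>) u) + J p *v (A *v (\<Gamma> (A *v \<xi>) *v u)) =
      Q *v (J' p (A *v \<xi>) *v u) + Q *v (\<Gamma>\<^sub>2 (J p *v (A *v \<xi>)) *v (J p *v u))"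
    by (simp add: QJ algebra_simps)
  have e2: "J' p (A *v \<xi>) *v (A *v u) + (J p *v (A *v (A *v S \<xi> u)) +
      (J p *v (A *v (\<Gamma> (A *v \<xi>) *v u)) + \<Gamma>\<^sub>2 (J p *v (A *v \<xi>)) *v (J p *v (A *v u)))) =
      Q *v (J' p (A *v \<xi>) *v u) + (J p *v (A *v S \<xi> (A *v u)) +
      (J p *v (\<Gamma> (A *v \<xi>) *v (A *v u)) + Q *v (\<Gamma>\<^sub>2 (J p *v (A *v \<xi>)) *v (J p *v u))))"
    using eq by (simp add: algebra_simps)
  have e3: "J p *v S (A *v \<xi>) (A *v u) + J p *v (\<Gamma> (A *v \<xi>) *v (A *v u)) =
      J' p (A *v \<xi>) *v (A *v u) + \<Gamma>\<^sub>2 (J p *v (A *v \<xi>)) *v (J p *v (A *v u))"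
    using JS[of "A *v \<xi>" "A *v u"] by (simp add: algebra_simps)
  have "J p *v (A *v S (A *v \<xi>) u) - J p *v S (A *v \<xi>) (A *v u) =
      J p *v (A *v (A *v S \<xi> u)) - J p *v (A *v S \<xi> (A *v u))"
    using group[OF e1 e2 e3] by (simp add: algebra_simps)
  then have "K p *v (J p *v (A *v S (A *v \<xi>) u - S (A *v \<xi>) (A *v u))) =
      K p *v (J p *v (A *v (A *v S \<xi> u - S \<xi> (A *v u))))"
    by (simp add: matrix_vector_mult_diff_distrib)
  then show ?thesis by (simp add: K_J[OF p])
qed


lemma inv_into_\<tau>:
  assumes x: "x \<in> carrier_of M"
  shows "inv_into (carrier_of N) \<tau> x = \<sigma> x"
proof -
  have b: "bij_betw \<sigma> (carrier_of M) (carrier_of N)" using \<sigma> by (simp add: diffeomorphism_def)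
  have "\<sigma> x \<in> carrier_of N" using b x by (auto simp: bij_betw_def)
  moreover have "inj_on \<tau> (carrier_of N)" using bij_betw_inv_into[OF b] by (simp add: bij_betw_def)
  ultimately have "inv_into (carrier_of N) \<tau> (\<tau> (\<sigma> x)) = \<sigma> x" by (rule inv_into_f_f[rotated])
  then show ?thesis by (simp add: \<tau>_\<sigma>[OF x])
qed

lemma pull_back_field:
  assumes "x \<in> carrier_of M"
  shows "push_forward N M \<tau> X x = tangent_map N M \<tau> (\<sigma> x) (X (\<sigma> x))"
  using assms by (simp add: push_forward_def inv_into_\<tau> Let_def)

lemma pull_back_field_in_chart:
  assumes X: "X \<in> vector_fields N"
  shows "p \<in> source \<Longrightarrow> push_forward N M \<tau> X (chart_inv c p) c = D\<psi> (\<phi> p) (X (chart_inv k (\<phi> p)) k)"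
    "smooth_on source (\<lambda>p. push_forward N M \<tau> X (chart_inv c p) c)"
proof -
  show 1: "push_forward N M \<tau> X (chart_inv c p) c = D\<psi> (\<phi> p) (X (chart_inv k (\<phi> p)) k)"
    if ps: "p \<in> source" for p
  proof -
    obtain x where x: "x \<in> fst c" "\<sigma> x \<in> fst k" "p = snd c x" "chart_inv c p = x"
      using source_point[OF ps] by blast
    have ck: "chart_inv k (\<phi> p) = \<sigma> x" using chart_inv_chart[OF N k x(2)] by (simp add: x(3) \<phi>_chart[OF x(1)])
    show ?thesis
      unfolding ck x(4) pull_back_field[OF c_carrier[OF x(1)]] tangent_map_\<tau>[OF x(1,2) vector_fieldD(1)[OF X]]
        coord_vec_self[OF M charts_at_point(1)[OF x(1)]]
      by (simp only: x(3))
  qed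
  have tk: "target \<subseteq> snd k ` fst k" by (auto simp: target_def)
  have "smooth_on source (\<lambda>p. X (chart_inv k (\<phi> p)) k)"
    by (rule smooth_on_compose[OF open_source atlas_open[OF N k] vector_fieldD(2)[OF X k] smooth_\<phi>])
      (use \<phi>_target tk in auto)
  then have "smooth_on source (\<lambda>p. D\<psi> (\<phi> p) (X (chart_inv k (\<phi> p)) k))"
    unfolding D\<psi>_def
    by (intro smooth_on_frechet_apply[OF open_source open_target smooth_\<psi> smooth_\<phi>])
      (use \<phi>_target in auto)
  then show "smooth_on source (\<lambda>p. push_forward N M \<tau> X (chart_inv c p) c)"
    by (subst smooth_on_cong[OF open_source 1])
qed

end

lemma pull_back_vector_field:
  fixes M :: "('a, real^'m) atlas" and N :: "('b, real^'m) atlas"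
  assumes M: "smooth_atlas M" and N: "smooth_atlas N" and \<sigma>: "diffeomorphism M N \<sigma>"
    and X: "X \<in> vector_fields N"
  shows "push_forward N M (inv_into (carrier_of M) \<sigma>) X \<in> vector_fields M"
proof -
  let ?Y = "push_forward N M (inv_into (carrier_of M) \<sigma>) X"
  have loc: "\<exists>k. x \<in> fst c \<and> \<sigma> x \<in> fst k \<and> diffeomorphism_in_charts M N \<sigma> c k" if "c \<in> M" "x \<in> fst c" for c x
  proof -
    have "\<sigma> x \<in> carrier_of N"
      using \<sigma> that by (auto simp: diffeomorphism_def bij_betw_def carrier_of_def)
    then obtain k where "k \<in> N" "\<sigma> x \<in> fst k" by (auto simp: carrier_of_def)
    then show ?thesis using M N \<sigma> that by (intro exI[of _ k]) (simp add: diffeomorphism_in_charts_def)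
  qed
  show ?thesis unfolding vector_fields_def
  proof (intro CollectI conjI allI ballI)
    fix x
    show "?Y x \<in> tangent_space M x"
    proof (cases "x \<in> carrier_of M")
      case True
      then obtain c where xc: "c \<in> M" "x \<in> fst c" by (auto simp: carrier_of_def)
      then obtain k where xk: "\<sigma> x \<in> fst k" "diffeomorphism_in_charts M N \<sigma> c k" using loc by blast
      interpret diffeomorphism_in_charts M N \<sigma> c k by (rule xk(2))
      show ?thesis
        unfolding pull_back_field[OF True] tangent_map_\<tau>[OF xc(2) xk(1) vector_fieldD(1)[OF X]]
        by (rule coord_vec_tangent[OF M charts_at_point(1)[OF xc(2)]])
    next
      case False
      then have "?Y x = 0" by (simp add: push_forward_def)
      then show ?thesis using tangent_zero[OF M] by simp
    qed
  next
    fix c assume c: "c \<in> M"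
    show "smooth_on (snd c ` fst c) (\<lambda>p. ?Y (chart_inv c p) c)"
    proof (rule smooth_on_local)
      fix p assume "p \<in> snd c ` fst c"
      then obtain x where x: "x \<in> fst c" "p = snd c x" by blast
      then obtain k where xk: "\<sigma> x \<in> fst k" "diffeomorphism_in_charts M N \<sigma> c k" using loc[OF c] by blast
      interpret diffeomorphism_in_charts M N \<sigma> c k by (rule xk(2))
      show "\<exists>U. open U \<and> p \<in> U \<and> smooth_on U (\<lambda>p. ?Y (chart_inv c p) c)"
        using open_source source_point_in[OF x(1) xk(1)] x(2) pull_back_field_in_chart(2)[OF X] by blast
    qed
  qed
qed

context diffeomorphism_in_charts
begin

text \<open>
  The field \<open>Y\<close> and its pull-back \<open>Y'\<close> satisfy \<open>Y(\<phi> p) = J Y'(p)\<close>. Differentiating this produces the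
  second derivative of \<open>\<phi>\<close>, which is the inhomogeneous term in the transformation rule of the Christoffel maps.
\<close>

lemma connection_push_forward_in_chart:
  assumes MM: "smooth_manifold M" and NN: "smooth_manifold N"
    and D: "linear_connection M D" and D2: "linear_connection N D\<^sub>2"
    and x: "x \<in> fst c" "\<sigma> x \<in> fst k" and p_def: "p = snd c x"
    and transform: "\<And>\<xi> u. K p *v (christoffel N D\<^sub>2 (\<sigma> x) k (J p *v \<xi>) (J p *v u) + J' p \<xi> *v u) =
      christoffel M D x c \<xi> u"
    and X: "X \<in> vector_fields N" and Y: "Y \<in> vector_fields N"
  shows "D\<^sub>2 X Y (\<sigma> x) = tangent_map M N \<sigma> x (D (push_forward N M \<tau> X) (push_forward N M \<tau> Y) x)"
proof -
  have p: "p \<in> source" using source_point_in[OF x] p_def by simp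
  have \<phi>p: "\<phi> p = snd k (\<sigma> x)" by (simp add: p_def \<phi>_chart[OF x(1)])
  note cx = charts_at_point(1)[OF x(1)] and ky = charts_at_point(2)[OF x(2)]
  let ?X = "push_forward N M \<tau> X" and ?Y = "push_forward N M \<tau> Y"
  have XM: "?X \<in> vector_fields M" and YM: "?Y \<in> vector_fields M"
    using pull_back_vector_field[OF M N \<sigma>] X Y by blast+
  have JX: "J p' *v push_forward N M \<tau> Z (chart_inv c p') c = Z (chart_inv k (\<phi> p')) k"
    if "Z \<in> vector_fields N" "p' \<in> source" for Z p'
    using pull_back_field_in_chart(1)[OF that] J_apply[OF that(2)] D\<phi>_D\<psi>[OF that(2)] by simp
  have at: "chart_inv c p = x" "chart_inv k (\<phi> p) = \<sigma> x"
    using chart_inv_chart[OF M c x(1)] chart_inv_chart[OF N k x(2)] by (simp_all add: p_def \<phi>_chart[OF x(1)])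
  have JXx: "J p *v ?X x c = X (\<sigma> x) k" "J p *v ?Y x c = Y (\<sigma> x) k"
    using JX[OF X p] JX[OF Y p] by (simp_all add: at)
  let ?dY = "frechet_derivative (\<lambda>q. Y (chart_inv k q) k) (at (snd k (\<sigma> x)))"
  let ?dY' = "frechet_derivative (\<lambda>p. ?Y (chart_inv c p) c) (at p)"
  have pc: "p \<in> snd c ` fst c" using x(1) p_def by simp
  have dY': "((\<lambda>p. ?Y (chart_inv c p) c) has_derivative ?dY') (at p)"
    by (rule smooth_on_has_derivative[OF vector_fieldD(2)[OF YM c] pc])
  have kk: "snd k (\<sigma> x) \<in> snd k ` fst k" using x(2) by simp
  have "((\<lambda>q. Y (chart_inv k q) k) has_derivative ?dY) (at (\<phi> p))"
    unfolding \<phi>p by (rule smooth_on_has_derivative[OF vector_fieldD(2)[OF Y k] kk])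
  from diff_chain_at[OF \<phi>_derivative[OF p] this]
  have 1: "((\<lambda>p. Y (chart_inv k (\<phi> p)) k) has_derivative (\<lambda>\<xi>. ?dY (D\<phi> p \<xi>))) (at p)"
    by (simp add: o_def)
  have "((\<lambda>p. J p *v ?Y (chart_inv c p) c) has_derivative (\<lambda>\<xi>. J p *v ?dY' \<xi> + J' p \<xi> *v ?Y x c)) (at p)"
    using bounded_bilinear.FDERIV[OF bounded_bilinear_matrix_vector_mult J_derivative[OF p] dY'] by (simp add: at)
  then have 2: "((\<lambda>p. Y (chart_inv k (\<phi> p)) k) has_derivative (\<lambda>\<xi>. J p *v ?dY' \<xi> + J' p \<xi> *v ?Y x c)) (at p)"
    by (rule has_derivative_transform_within_open[OF _ open_source p]) (rule JX[OF Y])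
  have chain: "?dY (J p *v \<xi>) = J p *v ?dY' \<xi> + J' p \<xi> *v ?Y x c" for \<xi>
    using fun_cong[OF has_derivative_unique[OF 1 2], of \<xi>] by (simp add: J_apply[OF p])
  \<comment> \<open>the transformation rule of Christoffel maps\<close>
  have Jtr: "christoffel N D\<^sub>2 (\<sigma> x) k (J p *v \<xi>) (J p *v u) + J' p \<xi> *v u = J p *v christoffel M D x c \<xi> u" for \<xi> u
    using transform[of \<xi> u] J_K[OF p] by metis
  have "D\<^sub>2 X Y (\<sigma> x) k = ?dY (X (\<sigma> x) k) + christoffel N D\<^sub>2 (\<sigma> x) k (X (\<sigma> x) k) (Y (\<sigma> x) k)"
    by (rule connection_in_coordinates[OF NN D2 ky X Y])
  also have "\<dots> = J p *v ?dY' (?X x c) + (christoffel N D\<^sub>2 (\<sigma> x) k (J p *v ?X x c) (J p *v ?Y x c)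
      + J' p (?X x c) *v ?Y x c)"
    by (simp add: JXx[symmetric] chain)
  also have "\<dots> = J p *v (?dY' (?X x c) + christoffel M D x c (?X x c) (?Y x c))"
    by (simp only: Jtr matrix_vector_right_distrib)
  also have "\<dots> = J p *v (D ?X ?Y x c)"
    using connection_in_coordinates[OF MM D cx XM YM] by (simp add: p_def)
  finally have "D\<^sub>2 X Y (\<sigma> x) k = D\<phi> p (D ?X ?Y x c)" by (simp add: J_apply[OF p])
  moreover have "tangent_map M N \<sigma> x (D ?X ?Y x) = coord_vec N (\<sigma> x) k (D\<phi> p (D ?X ?Y x c))"
    unfolding p_def by (rule tangent_map_\<sigma>[OF x vector_fieldD(1)[OF connection_in[OF D XM YM]]])
  ultimately show ?thesis
    using coord_vec_eq[OF vector_fieldD(1)[OF connection_in[OF D2 X Y]] ky] by simp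
qed

text \<open>
  The difference tensor \<open>S\<close> satisfies the hypotheses of \<open>cubic_form_vanishes\<close>; its symmetry also uses that of
  the second derivative of \<open>\<phi>\<close>.
\<close>

lemma christoffel_transformation:
  assumes SM: "symplectic_manifold M \<omega>" and SN: "symplectic_manifold N \<omega>\<^sub>1"
    and \<sigma>s: "symplectomorphism M \<omega> N \<omega>\<^sub>1 \<sigma>"
    and D: "symplectic_connection M \<omega> D" and D2: "symplectic_connection N \<omega>\<^sub>1 D\<^sub>2"
    and card: "CARD('m) = 2 * n" and l: "l \<le> n"
    and hol: "pseudo_holomorphic (End_bundle M) (twistor_space M \<omega> n l) (twistor_J M (twistor_space M \<omega> n l) D)
      (End_bundle N) (twistor_space N \<omega>\<^sub>1 n l) (twistor_J N (twistor_space N \<omega>\<^sub>1 n l) D\<^sub>2) (twistor_lift M N \<sigma>)"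
    and x: "x \<in> fst c" "\<sigma> x \<in> fst k" and p_def: "p = snd c x"
    and c_def: "c = some_chart M x" and k_def: "k = some_chart N (\<sigma> x)"
  shows "K p *v (christoffel N D\<^sub>2 (\<sigma> x) k (J p *v \<xi>) (J p *v u) + J' p \<xi> *v u) = christoffel M D x c \<xi> u"
proof -
  have p: "p \<in> source" using source_point_in[OF x] p_def by simp
  note cx = charts_at_point(1)[OF x(1)] and ky = charts_at_point(2)[OF x(2)]
  note MM = symplectic_manifoldD(1)[OF SM] and NN = symplectic_manifoldD(1)[OF SN]
  let ?B = "local_form M \<omega> c (snd c x)"
  define G where "G \<xi> u = K p *v (christoffel N D\<^sub>2 (\<sigma> x) k (J p *v \<xi>) (J p *v u) + J' p \<xi> *v u)" for \<xi> u
  define S where "S \<xi> u = K p *v (christoffel N D\<^sub>2 (\<sigma> x) k (J p *v \<xi>) (J p *v u) + J' p \<xi> *v u)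
    - christoffel M D x c \<xi> u" for \<xi> u
  have SG: "S \<xi> u = G \<xi> u - christoffel M D x c \<xi> u" for \<xi> u by (simp add: S_def G_def)
  note bil = local_form_bilinear[OF M cx symplectic_manifoldD(3)[OF SM]]
    and skew = local_form_skew[OF M cx symplectic_manifoldD(3)[OF SM]]
  have lB: "linear (\<lambda>a. ?B a b)" "linear (?B a)" for a b using bil by (auto simp: bilinear_def)
  have lin: "linear (S \<xi>)" for \<xi>
    unfolding S_def
    by (intro linearI)
      (simp_all add: linear_add[OF christoffel_linear_right] linear_cmul[OF christoffel_linear_right]
        matrix_vector_right_distrib matrix_vector_mult_scaleR algebra_simps)
  have sym: "S \<xi> u = S u \<xi>" for \<xi> u
    unfolding S_def
    by (simp only: christoffel_symmetric[OF NN symplectic_connectionD[OF D2] ky, of "J p *v \<xi>"]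
        christoffel_symmetric[OF MM symplectic_connectionD[OF D] cx, of \<xi>] J'_symmetric[OF p, of \<xi>])
  have sp: "?B (S \<xi> u) v + ?B u (S \<xi> v) = 0" for \<xi> u v
  proof -
    have "?B (G \<xi> u) v + ?B u (G \<xi> v) = ?B (christoffel M D x c \<xi> u) v + ?B u (christoffel M D x c \<xi> v)"
      using local_form_pull_back_derivative[OF SN \<sigma>s D2 x p_def G_def, of u v \<xi>]
        frechet_derivative_eq[OF christoffel_compatible[OF MM D symplectic_manifoldD(3)[OF SM] cx, of u v], of \<xi>]
      by (simp add: p_def)
    then show ?thesis by (simp add: SG linear_diff[OF lB(1)] linear_diff[OF lB(2)])
  qed
  have "S \<xi> u = 0"
  proof (rule cubic_form_vanishes[where B = ?B and S = S and n = n and l = l, OF bil skew local_form_nondegenerate[OF SM cx] card lin sym sp])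
    show "A *v S (A *v \<xi>) u - S (A *v \<xi>) (A *v u) = A *v (A *v S \<xi> u - S \<xi> (A *v u))"
      if "adapted_frame ?B n l f A" for f A \<xi> u
      using difference_tensor_commutator[OF SM SN \<sigma>s D D2 card l hol x p_def c_def k_def S_def lin, of f A \<xi> u] sp that
      by (simp only: p_def)
  qed
  then show ?thesis by (simp add: S_def)
qed

end

theorem corollary4p1:
  fixes M :: "('a, real^'m) atlas" and M\<^sub>1 :: "('b, real^'m) atlas"
    and \<omega> :: "('a, real^'m) two_form" and \<omega>\<^sub>1 :: "('b, real^'m) two_form"
    and D :: "('a, real^'m) connection" and D\<^sub>2 :: "('b, real^'m) connection"
    and \<sigma> :: "'a \<Rightarrow> 'b" and n l :: nat
  assumes "CARD('m) = 2 * n" and "l \<le> n"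
    and "symplectic_manifold M \<omega>" and "symplectic_manifold M\<^sub>1 \<omega>\<^sub>1"
    and "symplectomorphism M \<omega> M\<^sub>1 \<omega>\<^sub>1 \<sigma>"
    and "symplectic_connection M \<omega> D" and "symplectic_connection M\<^sub>1 \<omega>\<^sub>1 D\<^sub>2"
    and "pseudo_holomorphic
           (End_bundle M) (twistor_space M \<omega> n l)
             (twistor_J M (twistor_space M \<omega> n l) D)
           (End_bundle M\<^sub>1) (twistor_space M\<^sub>1 \<omega>\<^sub>1 n l)
             (twistor_J M\<^sub>1 (twistor_space M\<^sub>1 \<omega>\<^sub>1 n l) D\<^sub>2)
           (twistor_lift M M\<^sub>1 \<sigma>)"
  shows "\<forall>X\<in>vector_fields M\<^sub>1. \<forall>Y\<in>vector_fields M\<^sub>1.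
           D\<^sub>2 X Y = push_connection M M\<^sub>1 \<sigma> D X Y"
proof (intro ballI ext)
  note SM = assms(3) and SN = assms(4) and \<sigma>s = assms(5) and DM = assms(6) and DN = assms(7)
  note LM = symplectic_connectionD(1)[OF DM] and LN = symplectic_connectionD(1)[OF DN]
  note A = symplectic_manifoldD(2)[OF SM] and A1 = symplectic_manifoldD(2)[OF SN]
  have \<sigma>d: "diffeomorphism M M\<^sub>1 \<sigma>" using \<sigma>s by (simp add: symplectomorphism_def)
  then have bij: "bij_betw \<sigma> (carrier_of M) (carrier_of M\<^sub>1)" by (simp add: diffeomorphism_def)
  let ?\<tau> = "inv_into (carrier_of M) \<sigma>"
  fix X Y y k'
  assume X: "X \<in> vector_fields M\<^sub>1" and Y: "Y \<in> vector_fields M\<^sub>1"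
  have push: "push_connection M M\<^sub>1 \<sigma> D X Y y = (if y \<in> carrier_of M\<^sub>1 then
      tangent_map M M\<^sub>1 \<sigma> (?\<tau> y) (D (push_forward M\<^sub>1 M ?\<tau> X) (push_forward M\<^sub>1 M ?\<tau> Y) (?\<tau> y)) else 0)"
    by (simp add: push_connection_def push_forward_def[of M M\<^sub>1 \<sigma>] Let_def)
  have "D\<^sub>2 X Y y = push_connection M M\<^sub>1 \<sigma> D X Y y"
  proof (cases "y \<in> carrier_of M\<^sub>1")
    case True
    define x where "x = ?\<tau> y"
    have y: "\<sigma> x = y" and xM: "x \<in> carrier_of M"
      using bij True by (auto simp: x_def bij_betw_def f_inv_into_f inv_into_into)
    define c where "c = some_chart M x"
    define k where "k = some_chart M\<^sub>1 (\<sigma> x)"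
    have cx: "c \<in> charts_at M x" unfolding c_def by (rule some_chart_in[OF xM])
    have ky: "k \<in> charts_at M\<^sub>1 (\<sigma> x)" unfolding k_def by (rule some_chart_in) (simp add: y True)
    interpret diffeomorphism_in_charts M M\<^sub>1 \<sigma> c k
      using A A1 \<sigma>d charts_atD(1)[OF cx] charts_atD(1)[OF ky] by (simp add: diffeomorphism_in_charts_def)
    have "D\<^sub>2 X Y (\<sigma> x) = tangent_map M M\<^sub>1 \<sigma> x (D (push_forward M\<^sub>1 M ?\<tau> X) (push_forward M\<^sub>1 M ?\<tau> Y) x)"
      by (rule connection_push_forward_in_chart[OF symplectic_manifoldD(1)[OF SM] symplectic_manifoldD(1)[OF SN]
            LM LN charts_atD(2)[OF cx] charts_atD(2)[OF ky] refl _ X Y])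
        (rule christoffel_transformation[OF SM SN \<sigma>s DM DN assms(1,2,8) charts_atD(2)[OF cx]
            charts_atD(2)[OF ky] refl c_def k_def])
    then show ?thesis using True by (simp add: push y x_def[symmetric])
  next
    case False
    then show ?thesis
      using tangent_space_outside[OF False vector_fieldD(1)[OF connection_in[OF LN X Y]]] by (simp add: push)
  qed
  then show "D\<^sub>2 X Y y k' = push_connection M M\<^sub>1 \<sigma> D X Y y k'" by simp
qed

end
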